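(* Let $p$ be an odd prime, let $\mu$ be a character of $\mathbb Q_p^\times$ of conductor exponent $n=1$, let $\eta$ be trivial or $\left(\frac{\cdot}p\right)$, and assume $c(\eta\mu)>0$ and $c(\eta\mu^{-1})>0$, so that $c_\eta(\pi_\psi(\mu))=2$. Then the $2$-dimensional space spanned by the functions $$f_1(g)=\begin{cases}\mu_B(b)\eta(k_0)&\text{if }g=b(y(p),1)k_0\text{ for some }b\in B,\ k_0\in\overline{K_2},\\ 0&\text{otherwise,}\end{cases}$$ $$f_\lambda(g)=\begin{cases}\mu_B(b)\eta(k_0)&\text{if }g=b(y(\lambda p),1)k_0\text{ for some }b\in B,\ k_0\in\overline{K_2},\\ 0&\text{otherwise}\end{cases}$$ has a basis $\{v_1,v_2\}$ such that $\mathcal U_0(v_1)=\mathcal U_0(v_2)=\mathcal Y_1(v_1)=\mathcal Y_1(v_2)=0$ and $\mathcal W_1(v_1)=\sqrt{p^*}\,v_1$, $\mathcal W_1(v_2)=-\sqrt{p^*}\,v_2$.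
   Context: Let $G=\mathrm{SL}_2(\mathbb Q_p)$, $K=\mathrm{SL}_2(\mathbb Z_p)$, $K_m=K_0(p^m)=\{\begin{pmatrix}a&b\\ c&d\end{pmatrix}\in K:c\in p^m\mathbb Z_p\}$. $(\cdot,\cdot)_p$ is the quadratic Hilbert symbol. For $A=\begin{pmatrix}a&b\\ c&d\end{pmatrix}$ put $\tau(A)=c$ if $c\ne0$, $\tau(A)=d$ if $c=0$; for $g\in G$ put $s_p(g)=(c,d)_p$ if $cd\neq0$ and $\mathrm{ord}_p(c)$ is odd, $s_p(g)=1$ otherwise; $c(g,h)=(\tau(gh)\tau(g),\tau(gh)\tau(h))_p\,s_p(g)s_p(h)s_p(gh)$. $\widetilde G=G\times\{\pm1\}$ with $(g,\epsilon_1)(h,\epsilon_2)=(gh,\epsilon_1\epsilon_2c(g,h))$; $\overline S$ is the full inverse image of $S\subset G$. The cover splits over $K$ by $k\mapsto (k,1)$. $\eta$ defines the genuine character $\eta((\begin{pmatrix}a&b\\ c&d\end{pmatrix},\epsilon))=\epsilon\eta(d)$ of $\overline{K_m}$ for $m\ge c(\eta)$. $c(\cdot)$ of a character is its conductor exponent, where $\eta\mu^{\pm1}$ is regarded as a character of $\mathbb Z_p^\times$. $\lambda\in\mathbb Z_p^\times$ is a nonsquare mod $p$; $x(s)=\begin{pmatrix}1&s\\ 0&1\end{pmatrix}$, $y(s)=\begin{pmatrix}1&0\\ s&1\end{pmatrix}$, $h(t)=\mathrm{diag}(t,t^{-1})$, $w(1)=\begin{pmatrix}0&1\\ -1&0\end{pmatrix}$.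 $B\subset\widetilde G$ is the full inverse image of the upper triangular Borel subgroup. $\psi$ is a nontrivial additive character of $\mathbb Q_p$ of conductor $0$ (trivial on $\mathbb Z_p$, not on $p^{-1}\mathbb Z_p$); $\gamma(\psi')$ is the Weil index of $x\mapsto x^2$ with respect to $\psi'$, $\gamma(a,\psi)=\gamma(\psi_a)/\gamma(\psi)$, $\psi_a(x)=\psi(ax)$. Put $\mu_B((h(a)x(b),\epsilon))=\epsilon|a|\mu(a)\gamma(a,\psi)^{-1}$. $\pi_\psi(\mu)$ is right translation on the space $V(\mu)$ of locally constant $f:\widetilde G\to\mathbb C$ with $f(bg)=\mu_B(b)f(g)$, $b\in B$; $V(\mu)_\eta^{K_m}=\{f\in V(\mu):f(g\tilde k)=f(g)\eta(\tilde k)\ \forall\tilde k\in\overline{K_m}\}$ for $m\ge c(\eta)$; $c_\eta(\pi_\psi(\mu))$ is the least such $m$ with $V(\mu)_\eta^{K_m}\ne0$. At level $K_2$: $\mathcal U_0$ and $\mathcal V_{1,a}$ ($a\in\{1,\lambda\}$) are the functions $F$ on $\widetilde G$ with $F(\tilde k\tilde g\tilde k')=\overline\eta(\tilde k)\overline\eta(\tilde k')F(\tilde g)$ ($\tilde k,\tilde k'\in\overline{K_2}$), supported on the $\overline{K_2}$-double coset of $(w(1),1)$, resp. $(y(ap),1)$, with value $1$ at that element; they act on $V(\mu)_\eta^{K_2}$ by $F\cdot v=\int_{\widetilde G}F(g)\pi_\psi(\mu)(g)v\,dg$, $\mathrm{vol}(\overline{K_2})=1$. $\mathcal Y_1=I+\mathcal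 V_{1,1}+\mathcal V_{1,\lambda}$, $\mathcal W_1=\mathcal V_{1,1}-\mathcal V_{1,\lambda}$. $p^*=\left(\frac{-1}p\right)p$, $\sqrt{p^*}=\epsilon_p\sqrt p$, $\epsilon_p=\gamma(p,\psi)$.
   Formalization: The formal theorem also assumes that V(μ)_η^{K_m} is nonzero for some m ≥ c(η), equivalently μ(-1)=η(-1); otherwise all these spaces vanish, c_η(π_ψ(μ)) is undefined and f_1, f_λ are not well defined. *)

theory Defs
  imports
    "HOL-Analysis.Analysis"
    "HOL-Algebra.Group"
    "HOL-Number_Theory.Number_Theory"
    "HOL-Library.Function_Algebras"
begin

definition absp :: "'a::{field_char_0,complete_space} \<Rightarrow> real" where
  "absp x = dist x 0"

text \<open>
  \<open>padic_field p TYPE('a)\<close> says that \<open>'a\<close>, with its metric, is the field of p-adic numbers: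
  a complete field whose metric comes from a multiplicative absolute value, which restricts to the
  normalised p-adic absolute value on the integers (hence on the rationals), and in which the
  rationals are dense.  This determines \<open>'a\<close> up to a unique isometric isomorphism.
  Completeness and the triangle inequality come from the type class.
\<close>
definition padic_field :: "nat \<Rightarrow> 'a::{field_char_0,complete_space} itself \<Rightarrow> bool" where
  "padic_field p (_ :: 'a itself) \<longleftrightarrow>
     prime p \<and>
     (\<forall>x y z :: 'a. dist (x + z) (y + z) = dist x y) \<and>
     (\<forall>x y :: 'a. absp (x * y) = absp x * absp y) \<and>
     (\<forall>n::int. n \<noteq> 0 \<longrightarrow> absp (of_int n :: 'a) = 1 / real p ^ multiplicity (int p) n) \<and>
     closure (range (of_rat :: rat \<Rightarrow> 'a)) = UNIV"

definition Zp :: "'a::{field_char_0,complete_space} set" where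
  "Zp = {x. absp x \<le> 1}"

definition Zp_units :: "'a::{field_char_0,complete_space} set" where
  "Zp_units = {x. absp x = 1}"

definition pow_ideal :: "nat \<Rightarrow> nat \<Rightarrow> 'a::{field_char_0,complete_space} set" where
  "pow_ideal p m = {of_nat p ^ m * z | z. z \<in> Zp}"

definition ordp :: "nat \<Rightarrow> 'a::{field_char_0,complete_space} \<Rightarrow> int" where
  "ordp p x = (THE n. absp x = real p powi (- n))"

definition residue_mod :: "nat \<Rightarrow> 'a::{field_char_0,complete_space} \<Rightarrow> int" where
  "residue_mod p x = (THE r. 0 \<le> r \<and> r < int p \<and> x - of_int r \<in> pow_ideal p 1)"

definition legendre_char :: "nat \<Rightarrow> 'a::{field_char_0,complete_space} \<Rightarrow> complex" where
  "legendre_char p u = of_int (Legendre (residue_mod p u) (int p))"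

definition hilbert :: "'a::field \<Rightarrow> 'a \<Rightarrow> int" where
  "hilbert a b =
     (if \<exists>x y z. (x, y, z) \<noteq> (0, 0, 0) \<and> z\<^sup>2 = a * x\<^sup>2 + b * y\<^sup>2 then 1 else - 1)"

text \<open>
  The topology is carried separately.  On the second countable locally compact groups occurring
  here, finiteness on compact sets already makes \<open>M\<close> a Radon measure.
\<close>
definition left_haar_measure ::
  "('g, 'm) monoid_scheme \<Rightarrow> 'g topology \<Rightarrow> 'g measure \<Rightarrow> bool" where
  "left_haar_measure G T M \<longleftrightarrow>
     group G \<and> topspace T = carrier G \<and>
     space M = carrier G \<and> sets M = sigma_sets (carrier G) {U. openin T U} \<and>
     (\<forall>C. compactin T C \<longrightarrow> emeasure M C < \<infinity>) \<and>
     (\<forall>U. openin T U \<longrightarrow> U \<noteq> {} \<longrightarrow> emeasure M U > 0) \<and>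
     (\<forall>g\<in>carrier G. \<forall>S\<in>sets M. emeasure M ((\<lambda>h. g \<otimes>\<^bsub>G\<^esub> h) ` S) = emeasure M S)"

definition add_grp :: "'a::ab_group_add monoid" where
  "add_grp = \<lparr>carrier = UNIV, mult = (+), one = 0\<rparr>"

definition additive_character ::
  "('a::{field_char_0,complete_space} \<Rightarrow> complex) \<Rightarrow> bool" where
  "additive_character \<psi> \<longleftrightarrow>
     continuous_on UNIV \<psi> \<and> (\<forall>x. norm (\<psi> x) = 1) \<and> (\<forall>x y. \<psi> (x + y) = \<psi> x * \<psi> y)"

definition conductor_zero ::
  "nat \<Rightarrow> ('a::{field_char_0,complete_space} \<Rightarrow> complex) \<Rightarrow> bool" where
  "conductor_zero p \<psi> \<longleftrightarrow>
     (\<forall>x\<in>Zp. \<psi> x = 1) \<and> (\<exists>x\<in>Zp. \<psi> (x / of_nat p) \<noteq> 1)"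

text \<open>Multiplicative characters are total functions; their value at 0 is irrelevant.\<close>
definition mult_character ::
  "('a::{field_char_0,complete_space} \<Rightarrow> complex) \<Rightarrow> bool" where
  "mult_character \<mu> \<longleftrightarrow>
     continuous_on (- {0}) \<mu> \<and> (\<forall>x. x \<noteq> 0 \<longrightarrow> \<mu> x \<noteq> 0) \<and>
     (\<forall>x y. x \<noteq> 0 \<longrightarrow> y \<noteq> 0 \<longrightarrow> \<mu> (x * y) = \<mu> x * \<mu> y)"

text \<open>For \<open>n = 0\<close> the condition reads: \<open>\<xi>\<close> is trivial on all units.\<close>
definition cond_exp :: "nat \<Rightarrow> ('a::{field_char_0,complete_space} \<Rightarrow> complex) \<Rightarrow> nat" where
  "cond_exp p \<xi> = (LEAST n. \<forall>u\<in>Zp_units. u - 1 \<in> pow_ideal p n \<longrightarrow> \<xi> u = 1)"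

definition schwartz :: "('a::{field_char_0,complete_space} \<Rightarrow> complex) set" where
  "schwartz = {\<phi>. (\<forall>x. \<exists>U. open U \<and> x \<in> U \<and> (\<forall>y\<in>U. \<phi> y = \<phi> x)) \<and>
                  compact (closure {x. \<phi> x \<noteq> 0})}"

definition fourier ::
  "('a::{field_char_0,complete_space} \<Rightarrow> complex) \<Rightarrow> 'a measure \<Rightarrow> ('a \<Rightarrow> complex) \<Rightarrow> 'a \<Rightarrow> complex"
  where "fourier \<xi> M \<phi> y = (LINT x|M. \<phi> x * \<xi> (x * y))"

definition self_dual ::
  "('a::{field_char_0,complete_space} \<Rightarrow> complex) \<Rightarrow> 'a measure \<Rightarrow> bool" where
  "self_dual \<xi> M \<longleftrightarrow> (\<forall>\<phi>\<in>schwartz. \<forall>x. fourier \<xi> M (fourier \<xi> M \<phi>) x = \<phi> (- x))"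

text \<open>
  Weil's theorem for the character of second degree \<open>x \<mapsto> \<xi> (x\<^sup>2)\<close>, whose associated
  symmetric isomorphism is \<open>\<rho> x = 2 x\<close>: with respect to the self-dual measure, the Fourier transform
  of the distribution \<open>\<xi> (x\<^sup>2)\<close> is \<open>\<gamma> |\<rho>|^(-1/2) \<xi> (- (y/2)\<^sup>2)\<close>.  Here \<open>dx\<close> is any Haar measure;
  the self-dual one is a multiple \<open>M\<close> of it.
\<close>
definition weil_index ::
  "'a::{field_char_0,complete_space} measure \<Rightarrow> ('a \<Rightarrow> complex) \<Rightarrow> complex" where
  "weil_index dx \<xi> = (THE \<gamma>. \<exists>c>0. let M = scale_measure (ennreal c) dx in
     self_dual \<xi> M \<and>
     (\<forall>\<phi>\<in>schwartz. (LINT x|M. \<phi> x * \<xi> (x\<^sup>2)) =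
        \<gamma> * complex_of_real (1 / sqrt (absp (2::'a))) *
          (LINT y|M. fourier \<xi> M \<phi> y * \<xi> (- ((y / 2)\<^sup>2)))))"

definition weil_gamma ::
  "'a::{field_char_0,complete_space} measure \<Rightarrow> ('a \<Rightarrow> complex) \<Rightarrow> 'a \<Rightarrow> complex" where
  "weil_gamma dx \<psi> a = weil_index dx (\<lambda>x. \<psi> (a * x)) / weil_index dx \<psi>"

definition sqrt_pstar ::
  "nat \<Rightarrow> 'a::{field_char_0,complete_space} measure \<Rightarrow> ('a \<Rightarrow> complex) \<Rightarrow> complex" where
  "sqrt_pstar p dx \<psi> = weil_gamma dx \<psi> (of_nat p) * complex_of_real (sqrt (real p))"

type_synonym 'a mp = "('a^2^2) \<times> int"

definition mat2 :: "'a::zero \<Rightarrow> 'a \<Rightarrow> 'a \<Rightarrow> 'a \<Rightarrow> 'a^2^2" where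
  "mat2 a b c d = vector [vector [a, b], vector [c, d]]"

definition SL2 :: "('a::{field_char_0,complete_space}^2^2) set" where
  "SL2 = {A. det A = 1}"

definition SL2_Zp :: "('a::{field_char_0,complete_space}^2^2) set" where
  "SL2_Zp = {A \<in> SL2. \<forall>i j. A $ i $ j \<in> Zp}"

definition K0 :: "nat \<Rightarrow> nat \<Rightarrow> ('a::{field_char_0,complete_space}^2^2) set" where
  "K0 p m = {A \<in> SL2_Zp. A $ 2 $ 1 \<in> pow_ideal p m}"

definition borel_subgroup :: "('a::{field_char_0,complete_space}^2^2) set" where
  "borel_subgroup = {A \<in> SL2. A $ 2 $ 1 = 0}"

definition tau :: "'a::field^2^2 \<Rightarrow> 'a" where
  "tau A = (if A $ 2 $ 1 \<noteq> 0 then A $ 2 $ 1 else A $ 2 $ 2)"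

definition s_sign :: "nat \<Rightarrow> 'a::{field_char_0,complete_space}^2^2 \<Rightarrow> int" where
  "s_sign p A = (if A $ 2 $ 1 * A $ 2 $ 2 \<noteq> 0 \<and> odd (ordp p (A $ 2 $ 1))
                 then hilbert (A $ 2 $ 1) (A $ 2 $ 2) else 1)"

definition cocycle :: "nat \<Rightarrow> 'a::{field_char_0,complete_space}^2^2 \<Rightarrow> 'a^2^2 \<Rightarrow> int" where
  "cocycle p g h =
     hilbert (tau (g ** h) * tau g) (tau (g ** h) * tau h) *
       s_sign p g * s_sign p h * s_sign p (g ** h)"

definition full_preimage :: "('a^2^2) set \<Rightarrow> 'a mp set" where
  "full_preimage S = S \<times> {1, - 1}"

definition Mp :: "nat \<Rightarrow> 'a::{field_char_0,complete_space} mp monoid" where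
  "Mp p = \<lparr>carrier = full_preimage SL2,
           mult = (\<lambda>(g, e1) (h, e2). (g ** h, e1 * e2 * cocycle p g h)),
           one = (mat 1, 1)\<rparr>"

text \<open>
  The group topology in which \<open>k \<mapsto> (k, 1)\<close> identifies \<open>SL2_Zp\<close> with an open subgroup: the sets
  \<open>g \<cdot> (U, 1)\<close>, with \<open>U\<close> a neighbourhood of 1 in \<open>SL2_Zp\<close>, are the basic neighbourhoods of \<open>g\<close>.
  This is not the product topology, since the cocycle is not locally constant.
\<close>
definition Mp_topology :: "nat \<Rightarrow> 'a::{field_char_0,complete_space} mp topology" where
  "Mp_topology p = topology (\<lambda>W. W \<subseteq> carrier (Mp p) \<and>
     (\<forall>g\<in>W. \<exists>U. open U \<and> mat 1 \<in> U \<and> (\<forall>u \<in> U \<inter> SL2_Zp. g \<otimes>\<^bsub>Mp p\<^esub> (u, 1) \<in> W)))"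

definition Kbar :: "nat \<Rightarrow> nat \<Rightarrow> 'a::{field_char_0,complete_space} mp set" where
  "Kbar p m = full_preimage (K0 p m)"

definition Bbar :: "'a::{field_char_0,complete_space} mp set" where
  "Bbar = full_preimage borel_subgroup"

definition y_elt :: "'a::{field_char_0,complete_space} \<Rightarrow> 'a mp" where
  "y_elt s = (mat2 1 0 s 1, 1)"

definition w_elt :: "'a::{field_char_0,complete_space} mp" where
  "w_elt = (mat2 0 1 (- 1) 0, 1)"

definition eta_ext :: "('a \<Rightarrow> complex) \<Rightarrow> 'a mp \<Rightarrow> complex" where
  "eta_ext \<eta> k = of_int (snd k) * \<eta> (fst k $ 2 $ 2)"

text \<open>The matrix \<open>h(a) x(b)\<close> has upper left entry \<open>a\<close>.\<close>
definition mu_B ::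
  "'a::{field_char_0,complete_space} measure \<Rightarrow> ('a \<Rightarrow> complex) \<Rightarrow> ('a \<Rightarrow> complex) \<Rightarrow> 'a mp \<Rightarrow> complex"
  where
  "mu_B dx \<psi> \<mu> b = (let a = fst b $ 1 $ 1 in
     of_int (snd b) * complex_of_real (absp a) * \<mu> a * inverse (weil_gamma dx \<psi> a))"

text \<open>Functions on the metaplectic group are represented by functions vanishing off its carrier.\<close>
definition V_space ::
  "nat \<Rightarrow> 'a::{field_char_0,complete_space} measure \<Rightarrow> ('a \<Rightarrow> complex) \<Rightarrow> ('a \<Rightarrow> complex) \<Rightarrow>
     ('a mp \<Rightarrow> complex) set" where
  "V_space p dx \<psi> \<mu> = {f.
     (\<forall>g. g \<notin> carrier (Mp p) \<longrightarrow> f g = 0) \<and>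
     (\<forall>g\<in>carrier (Mp p). \<exists>W. openin (Mp_topology p) W \<and> g \<in> W \<and> (\<forall>h\<in>W. f h = f g)) \<and>
     (\<forall>b\<in>Bbar. \<forall>g\<in>carrier (Mp p). f (b \<otimes>\<^bsub>Mp p\<^esub> g) = mu_B dx \<psi> \<mu> b * f g)}"

definition V_eta ::
  "nat \<Rightarrow> 'a::{field_char_0,complete_space} measure \<Rightarrow> ('a \<Rightarrow> complex) \<Rightarrow> ('a \<Rightarrow> complex) \<Rightarrow>
     ('a \<Rightarrow> complex) \<Rightarrow> nat \<Rightarrow> ('a mp \<Rightarrow> complex) set" where
  "V_eta p dx \<psi> \<mu> \<eta> m = {f \<in> V_space p dx \<psi> \<mu>.
     \<forall>g\<in>carrier (Mp p). \<forall>k\<in>Kbar p m. f (g \<otimes>\<^bsub>Mp p\<^esub> k) = f g * eta_ext \<eta> k}"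

definition c_eta ::
  "nat \<Rightarrow> 'a::{field_char_0,complete_space} measure \<Rightarrow> ('a \<Rightarrow> complex) \<Rightarrow> ('a \<Rightarrow> complex) \<Rightarrow>
     ('a \<Rightarrow> complex) \<Rightarrow> nat" where
  "c_eta p dx \<psi> \<mu> \<eta> = (LEAST m. m \<ge> cond_exp p \<eta> \<and> V_eta p dx \<psi> \<mu> \<eta> m \<noteq> {0})"

definition f_fun ::
  "nat \<Rightarrow> 'a::{field_char_0,complete_space} measure \<Rightarrow> ('a \<Rightarrow> complex) \<Rightarrow> ('a \<Rightarrow> complex) \<Rightarrow>
     ('a \<Rightarrow> complex) \<Rightarrow> 'a \<Rightarrow> 'a mp \<Rightarrow> complex" where
  "f_fun p dx \<psi> \<mu> \<eta> s g =
     (if \<exists>b\<in>Bbar. \<exists>k\<in>Kbar p 2. g = b \<otimes>\<^bsub>Mp p\<^esub> y_elt s \<otimes>\<^bsub>Mp p\<^esub> k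
      then (THE z. \<exists>b\<in>Bbar. \<exists>k\<in>Kbar p 2. g = b \<otimes>\<^bsub>Mp p\<^esub> y_elt s \<otimes>\<^bsub>Mp p\<^esub> k \<and>
                     z = mu_B dx \<psi> \<mu> b * eta_ext \<eta> k)
      else 0)"

definition hecke_fun ::
  "nat \<Rightarrow> ('a::{field_char_0,complete_space} \<Rightarrow> complex) \<Rightarrow> 'a mp \<Rightarrow> 'a mp \<Rightarrow> complex" where
  "hecke_fun p \<eta> g0 = (THE F.
     (\<forall>k\<in>Kbar p 2. \<forall>k'\<in>Kbar p 2. \<forall>g\<in>carrier (Mp p).
        F (k \<otimes>\<^bsub>Mp p\<^esub> g \<otimes>\<^bsub>Mp p\<^esub> k') = cnj (eta_ext \<eta> k) * cnj (eta_ext \<eta> k') * F g) \<and>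
     (\<forall>g. g \<notin> {k \<otimes>\<^bsub>Mp p\<^esub> g0 \<otimes>\<^bsub>Mp p\<^esub> k' | k k'. k \<in> Kbar p 2 \<and> k' \<in> Kbar p 2} \<longrightarrow> F g = 0) \<and>
     F g0 = 1)"

text \<open>
  The integral of the vector-valued function \<open>g \<mapsto> F g \<cdot> \<pi>(g) v\<close> is taken pointwise; for the
  functions of interest it is a finite sum.
\<close>
definition hecke_act ::
  "nat \<Rightarrow> 'a::{field_char_0,complete_space} mp measure \<Rightarrow> ('a mp \<Rightarrow> complex) \<Rightarrow>
     ('a mp \<Rightarrow> complex) \<Rightarrow> 'a mp \<Rightarrow> complex" where
  "hecke_act p dg F v = (\<lambda>x. if x \<in> carrier (Mp p)
     then (LINT g|dg. F g * v (x \<otimes>\<^bsub>Mp p\<^esub> g)) else 0)"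

definition U0_op ::
  "nat \<Rightarrow> 'a::{field_char_0,complete_space} mp measure \<Rightarrow> ('a \<Rightarrow> complex) \<Rightarrow>
     ('a mp \<Rightarrow> complex) \<Rightarrow> 'a mp \<Rightarrow> complex" where
  "U0_op p dg \<eta> v = hecke_act p dg (hecke_fun p \<eta> w_elt) v"

definition V1_op ::
  "nat \<Rightarrow> 'a::{field_char_0,complete_space} mp measure \<Rightarrow> ('a \<Rightarrow> complex) \<Rightarrow> 'a \<Rightarrow>
     ('a mp \<Rightarrow> complex) \<Rightarrow> 'a mp \<Rightarrow> complex" where
  "V1_op p dg \<eta> a v = hecke_act p dg (hecke_fun p \<eta> (y_elt (a * of_nat p))) v"

definition Y1_op ::
  "nat \<Rightarrow> 'a::{field_char_0,complete_space} mp measure \<Rightarrow> ('a \<Rightarrow> complex) \<Rightarrow> 'a \<Rightarrow>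
     ('a mp \<Rightarrow> complex) \<Rightarrow> 'a mp \<Rightarrow> complex" where
  "Y1_op p dg \<eta> l v = v + V1_op p dg \<eta> 1 v + V1_op p dg \<eta> l v"

definition W1_op ::
  "nat \<Rightarrow> 'a::{field_char_0,complete_space} mp measure \<Rightarrow> ('a \<Rightarrow> complex) \<Rightarrow> 'a \<Rightarrow>
     ('a mp \<Rightarrow> complex) \<Rightarrow> 'a mp \<Rightarrow> complex" where
  "W1_op p dg \<eta> l v = V1_op p dg \<eta> 1 v - V1_op p dg \<eta> l v"

definition cscale :: "complex \<Rightarrow> ('b \<Rightarrow> complex) \<Rightarrow> 'b \<Rightarrow> complex" where
  "cscale c f = (\<lambda>x. c * f x)"

global_interpretation cfun: vector_space "cscale :: complex \<Rightarrow> ('b \<Rightarrow> complex) \<Rightarrow> _"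
  by unfold_locales (auto simp: cscale_def fun_eq_iff algebra_simps)

end

theory Submission
  imports Defs
begin

text \<open>
  A function \<open>v\<close> of level \<open>p\<^sup>2\<close> vanishes at \<open>1\<close> and at \<open>w(1)\<close>, because \<open>\<eta>\<mu>\<close> is nontrivial on the units. Hence \<open>v\<close> is
  determined by \<open>\<phi>(j) = v(y(jp))\<close>, a function on the residues modulo \<open>p\<close> with
  \<open>\<phi>(t\<^sup>2 j) = \<mu>(1/t) \<eta>(t) \<phi>(j)\<close>, and \<open>f\<^sub>1\<close>, \<open>f\<^sub>\<lambda>\<close> are supported on the squares and on the nonsquares.
  The operator \<open>U\<^sub>0\<close> vanishes since \<open>y(jp) K\<^sub>2 w(1) K\<^sub>2\<close> lies in \<open>K\<^sub>1 w(1) K\<^sub>2\<close>, where \<open>v = 0\<close>. As \<open>K\<^sub>1\<close> is the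
  union of the cosets \<open>y(jp) K\<^sub>2\<close>, the operator \<open>Y\<^sub>1\<close> replaces \<open>\<phi>\<close> by its sum over all residues, which is
  \<open>0\<close>, and \<open>W\<^sub>1\<close> is the convolution of \<open>\<phi>\<close> with the Legendre symbol. The autocorrelation of the Legendre
  symbol gives \<open>W\<^sub>1\<^sup>2 = p\<^sup>*\<close>, and \<open>W\<^sub>1\<close> has trace \<open>0\<close>, so both square roots of \<open>p\<^sup>*\<close> are eigenvalues. The
  Weil index is a Gauss sum, which yields \<open>\<gamma>(p,\<psi>)\<^sup>2 = (-1/p)\<close> and the values of the genuine character
  on the torus.
\<close>

subsection \<open>The p-adic absolute value\<close>

text \<open>The general cocycle of the cover is never handled. It is computed on
  \<open>K0 p 1\<close>, where it is trivial, on the Borel subgroup, where it is a Hilbert symbol,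
  and against \<open>w(1)\<close>; against - 1 it is only shown to be symmetric. The group laws
  themselves come with the Haar measure on \<open>Mp p\<close>, and every other product is compared
  through its matrix. The identity mu(-1) = eta(-1), without which \<open>f_fun\<close> would be ill
  defined, is not among the hypotheses. It is extracted from the existence of a nonzero equivariant
  vector at some level, because the lift of - 1 is central in the cover. The Weil index is a
  definite description built on Weil's functional equation and a self-dual measure, so it has to be
  evaluated on step functions. The sign of the quadratic Gauss sum stays undetermined: both square
  roots of p* occur as eigenvalues, and the torus character only involves the ratio of gamma(ab) to
  gamma(a) gamma(b), so the square of the Gauss sum suffices.\<close>

lemma absp_0 [simp]: "absp 0 = 0"
  by (simp add: absp_def)

lemma absp_eq_0 [simp]: "absp x = 0 \<longleftrightarrow> x = 0"
  by (simp add: absp_def)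

lemma absp_ge_0 [simp]: "0 \<le> absp x"
  by (simp add: absp_def)

lemma absp_le_0 [simp]: "absp x \<le> 0 \<longleftrightarrow> x = 0"
  by (simp add: absp_def)

lemma absp_not_less_0 [simp]: "\<not> absp x < 0"
  by (simp add: absp_def)

lemma absp_gt_0 [simp]: "0 < absp x \<longleftrightarrow> x \<noteq> 0"
  by (simp add: absp_def)

locale padic =
  fixes p :: nat and ty :: "'a::{field_char_0,complete_space} itself"
  assumes padic: "padic_field p ty" and odd_p: "odd p"
begin

lemma prime_p: "prime p"
  using padic by (simp add: padic_field_def)

lemma p_gt_1: "1 < p" and p_ge_3: "3 \<le> p" and p_gt_0: "0 < p" and p_neq_0 [simp]: "p \<noteq> 0"
proof -
  show "1 < p" using prime_p prime_gt_1_nat by blast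
  then show "3 \<le> p" "0 < p" "p \<noteq> 0" using odd_p by presburger+
qed

lemma dist_absp: "dist x y = absp (x - y :: 'a)"
  using padic unfolding padic_field_def absp_def
  by (metis add.commute add_0 diff_add_cancel)

lemma absp_mult: "absp (x * y :: 'a) = absp x * absp y"
  using padic by (simp add: padic_field_def)

lemma absp_of_int: "n \<noteq> 0 \<Longrightarrow> absp (of_int n :: 'a) = 1 / real p ^ multiplicity (int p) n"
  using padic by (simp add: padic_field_def)

lemma absp_1 [simp]: "absp (1 :: 'a) = 1"
  using absp_of_int[of 1] by simp

lemma absp_minus [simp]: "absp (- x :: 'a) = absp x"
proof -
  have "absp (-1 :: 'a) = 1"
    using absp_of_int[of "-1"] multiplicity_unit_right[of "-1" "int p"] by simp
  then show ?thesis using absp_mult[of "-1" x] by simp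
qed

lemma absp_diff_commute: "absp (x - y :: 'a) = absp (y - x)"
  using absp_minus[of "x - y"] by simp

lemma absp_power: "absp (x ^ n :: 'a) = absp x ^ n"
  by (induction n) (auto simp: absp_mult)

lemma absp_inverse: "absp (inverse x :: 'a) = inverse (absp x)"
proof (cases "x = 0")
  case False
  then have "absp x * absp (inverse x) = 1" by (simp flip: absp_mult)
  then show ?thesis by (simp add: inverse_unique)
qed simp

lemma absp_divide: "absp (x / y :: 'a) = absp x / absp y"
  by (simp add: divide_inverse absp_mult absp_inverse)

lemma absp_triangle: "absp (x + y :: 'a) \<le> absp x + absp y"
  using dist_triangle[of x "- y" 0] by (simp add: dist_absp)

lemma absp_of_int_le: "absp (of_int n :: 'a) \<le> 1"
proof (cases "n = 0")
  case False
  then show ?thesis using p_gt_1 by (simp add: absp_of_int)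
qed simp

lemma absp_of_nat_le: "absp (of_nat n :: 'a) \<le> 1"
  using absp_of_int_le[of "int n"] by simp

lemma absp_sum: "finite A \<Longrightarrow> absp (\<Sum>i\<in>A. f i :: 'a) \<le> (\<Sum>i\<in>A. absp (f i))"
  by (induction A rule: finite_induct) (auto intro: order_trans[OF absp_triangle])

text \<open>By the binomial theorem \<open>|x + y|\<^sup>n \<le> (n + 1) M\<^sup>n\<close>, which forces \<open>|x + y| \<le> M\<close>.\<close>
lemma absp_add_le:
  assumes x: "absp (x :: 'a) \<le> M" and y: "absp y \<le> M"
  shows "absp (x + y) \<le> M"
proof (rule ccontr)
  assume "\<not> absp (x + y) \<le> M"
  then have gt: "M < absp (x + y)" by simp
  have M: "0 \<le> M" using x absp_ge_0 order_trans by blast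
  have bd: "absp (x + y) ^ n \<le> real (n + 1) * M ^ n" for n
  proof -
    have "absp (x + y) ^ n = absp (\<Sum>k\<le>n. of_nat (n choose k) * x ^ k * y ^ (n - k))"
      by (simp flip: absp_power add: binomial_ring)
    also have "\<dots> \<le> (\<Sum>k\<le>n. absp (of_nat (n choose k) * x ^ k * y ^ (n - k)))"
      by (rule absp_sum) simp
    also have "\<dots> \<le> (\<Sum>k\<le>n. M ^ n)"
    proof (rule sum_mono)
      fix k assume "k \<in> {..n}"
      then have k: "k \<le> n" by simp
      have "absp (of_nat (n choose k) * x ^ k * y ^ (n - k)) =
          absp (of_nat (n choose k) :: 'a) * (absp x ^ k * absp y ^ (n - k))"
        by (simp add: absp_mult absp_power)
      also have "\<dots> \<le> 1 * (M ^ k * M ^ (n - k))"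
        by (intro mult_mono power_mono x y absp_of_nat_le) (use M in auto)
      finally show "absp (of_nat (n choose k) * x ^ k * y ^ (n - k)) \<le> M ^ n"
        using k by (simp flip: power_add)
    qed
    finally show ?thesis by simp
  qed
  have pos: "M > 0"
  proof (rule ccontr)
    assume "\<not> M > 0"
    then have "x = 0" "y = 0" using x y M by auto
    then show False using gt M by simp
  qed
  define r where "r = absp (x + y) / M"
  have r: "r > 1" using gt pos by (simp add: r_def)
  have rn: "r ^ n \<le> real (n + 1)" for n
    using bd[of n] pos by (simp add: r_def power_divide field_simps)
  have "(\<lambda>n. real n * (1 / r) ^ n + (1 / r) ^ n) \<longlonglongrightarrow> 0 + 0"
    using r by (intro tendsto_add powser_times_n_limit_0 LIMSEQ_power_zero) auto
  moreover have "real n * (1 / r) ^ n + (1 / r) ^ n \<ge> 1" for n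
    using rn[of n] r by (simp add: power_divide field_simps)
  ultimately show False
    using LIMSEQ_le_const[of _ "0 :: real" 1] by fastforce
qed

lemma absp_diff_le: "absp (x :: 'a) \<le> M \<Longrightarrow> absp y \<le> M \<Longrightarrow> absp (x - y) \<le> M"
  using absp_add_le[of x M "- y"] by simp

lemma absp_add_less:
  assumes "absp (x :: 'a) < M" and "absp y < M"
  shows "absp (x + y) < M"
  using absp_add_le[of x "max (absp x) (absp y)" y] assms by auto

lemma absp_diff_less: "absp (x :: 'a) < M \<Longrightarrow> absp y < M \<Longrightarrow> absp (x - y) < M"
  using absp_add_less[of x M "- y"] by simp

lemma absp_add_eq:
  assumes "absp (x :: 'a) < absp y"
  shows "absp (x + y) = absp y"
proof (rule antisym)
  show "absp (x + y) \<le> absp y" using absp_add_le[of x "absp y" y] assms by simp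
  show "absp y \<le> absp (x + y)"
  proof (rule ccontr)
    assume "\<not> absp y \<le> absp (x + y)"
    then show False using absp_diff_less[of "x + y" "absp y" x] assms by simp
  qed
qed

lemma absp_add_eq': "absp (y :: 'a) < absp x \<Longrightarrow> absp (x + y) = absp x"
  using absp_add_eq[of y x] by (simp add: add.commute)

lemma absp_eq_of_close: "absp (x - y :: 'a) < absp y \<Longrightarrow> absp x = absp y"
  using absp_add_eq[of "x - y" y] by simp

lemma absp_p [simp]: "absp (of_nat p :: 'a) = 1 / real p"
proof -
  have "prime_elem (int p)" using prime_p by simp
  then show ?thesis using absp_of_int[of "int p"] p_gt_0 by simp
qed

lemma of_nat_p_neq_0 [simp]: "(of_nat p :: 'a) \<noteq> 0"
  using p_gt_0 by simp

lemma absp_of_int_eq_1: "\<not> int p dvd n \<Longrightarrow> absp (of_int n :: 'a) = 1"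
  using absp_of_int[of n] by (cases "n = 0") (auto simp: not_dvd_imp_multiplicity_0)

lemma absp_of_int_dvd: "int p ^ m dvd n \<Longrightarrow> absp (of_int n :: 'a) \<le> 1 / real p ^ m"
proof -
  assume "int p ^ m dvd n"
  then obtain k where k: "n = int p ^ m * k" by blast
  have "absp (of_int n :: 'a) = (1 / real p) ^ m * absp (of_int k :: 'a)"
    by (simp add: k absp_mult absp_power)
  also have "\<dots> \<le> (1 / real p) ^ m * 1"
    by (intro mult_left_mono absp_of_int_le) auto
  finally show ?thesis by (simp add: power_divide)
qed

lemma absp_of_int_le_iff: "absp (of_int n :: 'a) \<le> 1 / real p ^ m \<longleftrightarrow> int p ^ m dvd n"
proof
  assume a: "absp (of_int n :: 'a) \<le> 1 / real p ^ m"
  show "int p ^ m dvd n"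
  proof (cases "n = 0")
    case False
    then have "1 / real p ^ multiplicity (int p) n \<le> 1 / real p ^ m" using a by (simp add: absp_of_int)
    then have "real p ^ m \<le> real p ^ multiplicity (int p) n" using p_gt_0 by (simp add: field_simps)
    then have "m \<le> multiplicity (int p) n" using p_gt_1 by simp
    then show ?thesis by (rule multiplicity_dvd')
  qed simp
qed (rule absp_of_int_dvd)

lemma absp_2 [simp]: "absp (2 :: 'a) = 1"
proof -
  have "\<not> int p dvd 2" using p_ge_3 zdvd_imp_le[of "int p" 2] by linarith
  then show ?thesis using absp_of_int_eq_1[of 2] by simp
qed

section \<open>Discreteness of the value group and approximation by integers\<close>

lemma ex_rat_close:
  assumes "e > 0"
  obtains a b :: int where "b \<noteq> 0" "absp (x - of_int a / of_int b :: 'a) < e"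
proof -
  have "closure (range (of_rat :: rat \<Rightarrow> 'a)) = UNIV"
    using padic unfolding padic_field_def by (elim conjE)
  then have "x \<in> closure (range (of_rat :: rat \<Rightarrow> 'a))" by (simp only: UNIV_I)
  then have "\<exists>y\<in>range (of_rat :: rat \<Rightarrow> 'a). dist y x < e"
    using assms unfolding closure_approachable by blast
  then obtain q :: rat where q: "dist (of_rat q) x < e" by blast
  obtain a b :: int where "q = Fract a b" "b > 0" by (cases q) blast
  then have "b \<noteq> 0" and "q = of_int a / of_int b" by (auto simp: Fract_of_int_quotient)
  then have "(of_rat q :: 'a) = of_int a / of_int b" by (simp add: of_rat_divide)
  then show ?thesis using that[OF \<open>b \<noteq> 0\<close>, of a] q absp_diff_commute[of x] by (simp add: dist_absp)
qed

text \<open>The value group does not grow on completion: a rational number closer to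
  \<open>x\<close> than \<open>absp x\<close> has the same absolute value as \<open>x\<close>, by
  the ultrametric inequality.\<close>

lemma absp_value:
  assumes "x \<noteq> (0 :: 'a)"
  obtains n :: int where "absp x = real p powi n"
proof -
  have "absp x > 0" using assms by simp
  then obtain a b :: int where ab: "b \<noteq> 0" "absp (x - of_int a / of_int b) < absp x"
    by (rule ex_rat_close)
  have eq: "absp (of_int a / of_int b :: 'a) = absp x"
    using absp_eq_of_close[of "of_int a / of_int b" x] ab(2) by (simp add: absp_diff_commute)
  then have "a \<noteq> 0" using assms by auto
  then have "absp (of_int a / of_int b :: 'a) =
      real p powi (int (multiplicity (int p) b) - int (multiplicity (int p) a))"
    using ab(1) p_gt_0 by (simp add: absp_divide absp_of_int power_int_diff)
  then show ?thesis using that eq by simp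
qed

lemma powi_less_iff: "real p powi m < real p powi n \<longleftrightarrow> m < n"
proof (cases "m < n")
  case True
  then show ?thesis using p_gt_1 power_int_strict_increasing[of m n "real p"] by simp
next
  case False
  then show ?thesis using p_gt_1 power_int_increasing[of n m "real p"] by simp
qed

lemma powi_le_iff: "real p powi m \<le> real p powi n \<longleftrightarrow> m \<le> n"
  using powi_less_iff[of n m] by linarith

lemma powi_inject: "real p powi m = real p powi n \<longleftrightarrow> m = n"
  using powi_less_iff[of m n] powi_less_iff[of n m] less_irrefl[of "real p powi n"]
  by (cases m n rule: linorder_cases) simp_all

lemma powi_pos: "0 < real p powi n"
  using p_gt_0 by simp

text \<open>Nonzero absolute values are powers of \<open>p\<close>, so a strict bound is the next
  smaller weak one. This is why \<open>absp x < 1\<close> can serve throughout as membership in the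
  maximal ideal.\<close>

lemma absp_less_powi: "absp (x :: 'a) < real p powi n \<longleftrightarrow> absp x \<le> real p powi (n - 1)"
proof (cases "x = 0")
  case True
  then show ?thesis using powi_pos[of n] powi_pos[of "n - 1"] by (simp del: zero_less_power_int)
next
  case False
  then obtain k where "absp x = real p powi k" by (rule absp_value)
  then show ?thesis by (simp add: powi_less_iff powi_le_iff)
qed

lemma absp_lt_1: "absp (x :: 'a) < 1 \<longleftrightarrow> absp x \<le> 1 / real p"
  using absp_less_powi[of x 0] by (simp add: power_int_minus inverse_eq_divide)

lemma absp_of_int_lt_1_iff: "absp (of_int n :: 'a) < 1 \<longleftrightarrow> int p dvd n"
  using absp_of_int_le_iff[of n 1] by (simp add: absp_lt_1)

lemma ordp_powi: "absp (x :: 'a) = real p powi (- n) \<Longrightarrow> ordp p x = n"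
  unfolding ordp_def by (rule the_equality) (auto simp: powi_inject)

lemma absp_ordp: "x \<noteq> (0 :: 'a) \<Longrightarrow> absp x = real p powi (- ordp p x)"
  by (metis absp_value ordp_powi minus_minus)

lemma pow_ideal_iff: "x \<in> pow_ideal p m \<longleftrightarrow> absp (x :: 'a) \<le> 1 / real p ^ m"
proof
  assume "x \<in> pow_ideal p m"
  then show "absp x \<le> 1 / real p ^ m"
    by (auto simp: pow_ideal_def Zp_def absp_mult absp_power power_divide mult_left_le divide_right_mono)
next
  assume a: "absp x \<le> 1 / real p ^ m"
  have "absp (x / of_nat p ^ m) \<le> 1"
    using a p_gt_0 by (simp add: absp_divide absp_power power_divide field_simps)
  then have "x / of_nat p ^ m \<in> Zp" by (simp add: Zp_def)
  moreover have "x = of_nat p ^ m * (x / of_nat p ^ m)" using of_nat_p_neq_0 by (simp del: of_nat_eq_0_iff)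
  ultimately show "x \<in> pow_ideal p m" unfolding pow_ideal_def by blast
qed

text \<open>Take a nearby rational number in lowest terms. Its absolute value is at most 1, so
  \<open>p\<close> cannot divide the denominator, which is therefore invertible modulo
  \<open>p ^ m\<close>.\<close>

lemma Zp_int_close:
  assumes x: "absp (x :: 'a) \<le> 1"
  obtains n :: int where "0 \<le> n" "n < int p ^ m" "absp (x - of_int n) \<le> 1 / real p ^ m"
proof -
  have "1 / real p ^ m > 0" using p_gt_0 by simp
  then obtain a b :: int where ab: "b \<noteq> 0" "absp (x - of_int a / of_int b) < 1 / real p ^ m"
    by (rule ex_rat_close)
  define g where "g = gcd a b"
  define a' b' where "a' = a div g" and "b' = b div g"
  have g: "g \<noteq> 0" using ab by (simp add: g_def)
  have a'b': "a = a' * g" "b = b' * g" by (auto simp: a'_def b'_def g_def)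
  have cop: "coprime a' b'" unfolding a'_def b'_def g_def using ab(1) by (simp add: div_gcd_coprime)
  have q: "(of_int a / of_int b :: 'a) = of_int a' / of_int b'" using g by (simp add: a'b')
  have b'0: "b' \<noteq> 0" using ab(1) a'b' by auto
  have "1 / real p ^ m \<le> 1" using p_gt_1 by simp
  then have "absp (x - (x - of_int a' / of_int b')) \<le> 1"
    using absp_diff_le[of x 1 "x - of_int a' / of_int b'"] x ab(2) unfolding q by linarith
  then have le: "absp (of_int a' / of_int b' :: 'a) \<le> 1" by simp
  have nb: "\<not> int p dvd b'"
  proof
    assume pb: "int p dvd b'"
    then have "\<not> int p dvd a'" using cop prime_p
      by (meson coprime_common_divisor not_prime_unit prime_nat_int_transfer)
    then have "absp (of_int a' :: 'a) = 1" by (rule absp_of_int_eq_1)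
    moreover have "absp (of_int b' :: 'a) < 1" using pb by (simp add: absp_of_int_lt_1_iff)
    moreover have "absp (of_int b' :: 'a) > 0" using b'0 by simp
    ultimately show False using le by (simp add: absp_divide divide_le_eq_1)
  qed
  then have "coprime b' (int p ^ m)"
    using prime_p by (metis coprime_commute coprime_power_left_iff prime_imp_coprime prime_nat_int_transfer)
  then obtain c where c: "[b' * c = 1] (mod int p ^ m)"
    using cong_solve_coprime_int by blast
  define n where "n = (a' * c) mod int p ^ m"
  have "[b' * n = a'] (mod int p ^ m)"
    using cong_scalar_left[OF c, of a'] unfolding n_def cong_def by (simp add: mod_mult_right_eq ac_simps)
  then have "int p ^ m dvd b' * n - a'" by (simp add: cong_iff_dvd_diff)
  then have "absp (of_int (b' * n - a') :: 'a) \<le> 1 / real p ^ m" by (rule absp_of_int_dvd)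
  moreover have "absp (of_int b' :: 'a) = 1" using nb by (rule absp_of_int_eq_1)
  moreover have "(of_int (b' * n - a') :: 'a) = of_int b' * (of_int n - of_int a' / of_int b')"
    using b'0 by (simp add: field_simps)
  ultimately have "absp (of_int n - of_int a' / of_int b' :: 'a) \<le> 1 / real p ^ m"
    by (simp add: absp_mult)
  then have "absp ((x - of_int a' / of_int b') - (of_int n - of_int a' / of_int b')) \<le> 1 / real p ^ m"
    using ab(2) unfolding q by (intro absp_diff_le[of "x - of_int a' / of_int b'"]) auto
  then have "absp (x - of_int n) \<le> 1 / real p ^ m" by simp
  moreover have "0 \<le> n" "n < int p ^ m" using p_gt_0 by (auto simp: n_def)
  ultimately show ?thesis using that by blast
qed

lemma of_int_close_iff:
  "absp (of_int a - of_int b :: 'a) \<le> 1 / real p ^ m \<longleftrightarrow> [a = b] (mod int p ^ m)"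
  using absp_of_int_le_iff[of "a - b" m] by (simp add: cong_iff_dvd_diff)

lemma of_int_close_iff_1:
  "absp (of_int a - of_int b :: 'a) < 1 \<longleftrightarrow> [a = b] (mod int p)"
  using of_int_close_iff[of a b 1] by (simp add: absp_lt_1)

section \<open>The residue map\<close>

lemma residue_mod_eqI:
  assumes "0 \<le> r" "r < int p" "absp (x - of_int r :: 'a) < 1"
  shows "residue_mod p x = r"
  unfolding residue_mod_def
proof (rule the_equality)
  show "0 \<le> r \<and> r < int p \<and> x - of_int r \<in> pow_ideal p 1"
    using assms by (simp add: pow_ideal_iff absp_lt_1)
next
  fix s assume s: "0 \<le> s \<and> s < int p \<and> x - of_int s \<in> pow_ideal p 1"
  then have "absp ((x - of_int r) - (x - of_int s)) < 1"
    by (intro absp_diff_less[of "x - of_int r"] assms) (simp add: pow_ideal_iff absp_lt_1)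
  then have "[s = r] (mod int p)" using of_int_close_iff_1[of s r] by simp
  then show "s = r" using s assms unfolding cong_def by simp
qed

lemma residue_mod:
  assumes "absp (x :: 'a) \<le> 1"
  shows "0 \<le> residue_mod p x" "residue_mod p x < int p" "absp (x - of_int (residue_mod p x)) < 1"
proof -
  obtain n where "0 \<le> n" "n < int p ^ 1" "absp (x - of_int n) \<le> 1 / real p ^ 1"
    using Zp_int_close[OF assms, where m=1] by blast
  then have n: "0 \<le> n" "n < int p" "absp (x - of_int n) < 1" by (auto simp: absp_lt_1)
  then have "residue_mod p x = n" by (rule residue_mod_eqI)
  with n show "0 \<le> residue_mod p x" "residue_mod p x < int p" "absp (x - of_int (residue_mod p x)) < 1"
    by auto
qed

lemma residue_mod_cong_iff:
  assumes "absp (x :: 'a) \<le> 1"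
  shows "[residue_mod p x = n] (mod int p) \<longleftrightarrow> absp (x - of_int n) < 1"
proof -
  have "absp (x - of_int n) < 1 \<longleftrightarrow> absp (of_int (residue_mod p x) - of_int n :: 'a) < 1"
    using absp_add_less[OF residue_mod(3)[OF assms], of "of_int (residue_mod p x) - of_int n"]
      absp_diff_less[of "x - of_int n" 1 "x - of_int (residue_mod p x)"] residue_mod(3)[OF assms]
    by auto
  then show ?thesis by (simp add: of_int_close_iff_1)
qed

lemma residue_mod_of_int: "[residue_mod p (of_int n :: 'a) = n] (mod int p)"
  by (subst residue_mod_cong_iff) (auto simp: absp_of_int_le)

lemma residue_mod_close:
  assumes "absp (x :: 'a) \<le> 1" "absp (x - y) < 1"
  shows "residue_mod p x = residue_mod p y"
proof -
  have y: "absp y \<le> 1" using absp_diff_le[of x 1 "x - y"] assms by simp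
  have "absp ((x - y) + (y - of_int (residue_mod p y))) < 1"
    using assms residue_mod(3)[OF y] by (intro absp_add_less)
  then show ?thesis using residue_mod[OF y] by (intro residue_mod_eqI) auto
qed

end

subsection \<open>Squares, the Legendre symbol and the Hilbert symbol\<close>

lemma Legendre_cong: "[a = b] (mod m) \<Longrightarrow> Legendre a m = Legendre b m"
proof -
  assume a: "[a = b] (mod m)"
  have "[a = 0] (mod m) \<longleftrightarrow> [b = 0] (mod m)" using a cong_sym cong_trans by blast
  moreover have "QuadRes m a \<longleftrightarrow> QuadRes m b"
    unfolding QuadRes_def using a cong_sym cong_trans by blast
  ultimately show ?thesis by (simp add: Legendre_def)
qed

text \<open>Euler's criterion yields the identity modulo \<open>p\<close> only. As both sides lie in
  {-1, 0, 1}, they differ by at most 2, which is less than \<open>p\<close>.\<close>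

lemma Legendre_mult:
  assumes "prime p" "2 < p"
  shows "Legendre (a * b) (int p) = Legendre a (int p) * Legendre b (int p)"
proof -
  have "[Legendre (a * b) (int p) = (a * b) ^ ((p - 1) div 2)] (mod int p)"
    by (rule euler_criterion[OF assms])
  moreover have "[Legendre a (int p) * Legendre b (int p) = a ^ ((p - 1) div 2) * b ^ ((p - 1) div 2)] (mod int p)"
    by (intro cong_mult euler_criterion assms)
  ultimately have c: "[Legendre (a * b) (int p) = Legendre a (int p) * Legendre b (int p)] (mod int p)"
    by (metis cong_sym cong_trans power_mult_distrib)
  have v: "Legendre n (int p) \<in> {-1, 0, 1}" for n by (simp add: Legendre_def)
  define d where "d = Legendre (a * b) (int p) - Legendre a (int p) * Legendre b (int p)"
  have "\<bar>d\<bar> \<le> 2"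
    using v[of "a * b"] v[of a] v[of b] unfolding d_def by (elim insertE emptyE) simp_all
  moreover have "int p dvd d"
    using c by (simp add: d_def cong_iff_dvd_diff)
  ultimately have "d = 0"
    using assms(2) dvd_imp_le_int[of d "int p"] by linarith
  then show ?thesis by (simp add: d_def)
qed

context padic
begin

definition lg :: "'a \<Rightarrow> int" where
  "lg u = Legendre (residue_mod p u) (int p)"

lemma residue_mod_cong_0:
  assumes "absp (u :: 'a) = 1"
  shows "\<not> [residue_mod p u = 0] (mod int p)"
  using residue_mod_cong_iff[of u 0] assms by simp

lemma lg_cases: "absp u = 1 \<Longrightarrow> lg u = 1 \<or> lg u = - 1"
  using residue_mod_cong_0 by (simp add: lg_def Legendre_def)

lemma lg_not_unit: "absp u < 1 \<Longrightarrow> lg u = 0"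
  using residue_mod_cong_iff[of u 0] by (simp add: lg_def Legendre_def)

lemma lg_square_eq_1: "absp u = 1 \<Longrightarrow> lg u * lg u = 1"
  using lg_cases by fastforce

lemma lg_of_int: "lg (of_int n) = Legendre n (int p)"
  unfolding lg_def by (rule Legendre_cong[OF residue_mod_of_int])

lemma lg_close: "absp u \<le> 1 \<Longrightarrow> absp (u - v) < 1 \<Longrightarrow> lg u = lg v"
  unfolding lg_def using residue_mod_close by simp

lemma residue_mod_mult:
  assumes u: "absp (u :: 'a) \<le> 1" and v: "absp v \<le> 1"
  shows "[residue_mod p (u * v) = residue_mod p u * residue_mod p v] (mod int p)"
proof -
  have uv: "absp (u * v) \<le> 1" using u v by (simp add: absp_mult mult_le_one)
  let ?a = "of_int (residue_mod p u) :: 'a" and ?b = "of_int (residue_mod p v) :: 'a"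
  have "absp (u * (v - ?b)) < 1"
    using u residue_mod(3)[OF v] by (simp add: absp_mult) (metis absp_ge_0 mult_le_one mult_left_le_one_le order_le_less_trans)
  moreover have "absp ((u - ?a) * ?b) < 1"
    using absp_of_int_le[of "residue_mod p v"] residue_mod(3)[OF u]
    by (simp add: absp_mult) (metis absp_ge_0 mult_left_le order_le_less_trans)
  ultimately have "absp (u * (v - ?b) + (u - ?a) * ?b) < 1" by (rule absp_add_less)
  then have "absp (u * v - of_int (residue_mod p u * residue_mod p v)) < 1"
    by (simp add: algebra_simps)
  then show ?thesis using residue_mod_cong_iff[OF uv] by blast
qed

lemma lg_mult: "absp u \<le> 1 \<Longrightarrow> absp v \<le> 1 \<Longrightarrow> lg (u * v) = lg u * lg v"
  unfolding lg_def using Legendre_cong[OF residue_mod_mult] Legendre_mult prime_p p_ge_3 by simp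

lemma lg_1 [simp]: "lg 1 = 1"
  using lg_mult[of 1 1] lg_cases[of 1] by auto

lemma lg_square: "absp y = 1 \<Longrightarrow> lg (y\<^sup>2) = 1"
  using lg_mult[of y y] lg_square_eq_1[of y] by (simp add: power2_eq_square)

text \<open>\<open>h = (e - h\<^sup>2) / 2\<close> is a contraction of the maximal ideal, and \<open>(1 + h)\<^sup>2 = 1 + e\<close> at its fixed point.\<close>
lemma square_root_near_1:
  assumes "absp (x - 1 :: 'a) < 1"
  obtains y :: 'a where "y\<^sup>2 = x" "absp (y - 1) < 1"
proof -
  define e where "e = x - 1"
  define f where "f = (\<lambda>h. (e - h\<^sup>2) / 2)"
  define S where "S = {h :: 'a. absp h \<le> 1 / real p}"
  have p1: "1 / real p < 1" using p_gt_1 by simp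
  have e: "absp e \<le> 1 / real p" using assms by (simp add: e_def absp_lt_1)
  have S: "S = cball 0 (1 / real p)" by (auto simp: S_def dist_absp)
  have "complete S" unfolding S complete_eq_closed by simp
  moreover have "S \<noteq> {}" using p_gt_0 by (auto simp: S)
  moreover have "f ` S \<subseteq> S"
  proof
    fix z assume "z \<in> f ` S"
    then obtain h where h: "absp h \<le> 1 / real p" "z = f h" by (auto simp: S_def)
    have "absp (h\<^sup>2) \<le> 1 / real p * 1"
      unfolding power2_eq_square absp_mult using h p1 by (intro mult_mono) auto
    then have "absp (e - h\<^sup>2) \<le> 1 / real p" using e by (intro absp_diff_le) auto
    then show "z \<in> S" by (simp add: S_def h f_def absp_divide)
  qed
  moreover have "dist (f h) (f k) \<le> (1 / real p) * dist h k" if "h \<in> S" "k \<in> S" for h k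
  proof -
    have "f h - f k = (k - h) * (k + h) / 2"
      by (simp add: f_def power2_eq_square field_simps)
    then have "absp (f h - f k) = absp (h - k) * absp (k + h)"
      by (simp only: absp_divide absp_mult absp_diff_commute[of k h] absp_2 div_by_1)
    moreover have "absp (k + h) \<le> 1 / real p" using that by (intro absp_add_le) (auto simp: S_def)
    then have "absp (h - k) * absp (k + h) \<le> absp (h - k) * (1 / real p)"
      by (intro mult_left_mono) auto
    ultimately show ?thesis by (simp add: dist_absp)
  qed
  ultimately obtain h where h: "h \<in> S" "f h = h"
    using Banach_fix[of S "1 / real p" f] p1 p_gt_0 by auto
  have "(1 + h)\<^sup>2 = 1 + 2 * h + h\<^sup>2" by (simp add: power2_eq_square algebra_simps)
  also have "2 * h = e - h\<^sup>2" using h(2) by (simp add: f_def field_simps)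
  finally have "(1 + h)\<^sup>2 = x" by (simp add: e_def)
  moreover have "absp ((1 + h) - 1) < 1" using h(1) by (simp add: S_def absp_lt_1)
  ultimately show ?thesis using that by blast
qed

text \<open>If \<open>r\<close> is an integer whose square is congruent to \<open>u\<close>, then
  the quotient of \<open>u\<close> by that square is near 1 and so has a square root.\<close>

lemma lg_eq_1_iff:
  assumes u: "absp u = 1"
  shows "lg u = 1 \<longleftrightarrow> (\<exists>y. y\<^sup>2 = u)"
proof
  assume "lg u = 1"
  then have "QuadRes (int p) (residue_mod p u)" by (simp add: lg_def Legendre_def split: if_splits)
  then obtain r where "[residue_mod p u = r\<^sup>2] (mod int p)" unfolding QuadRes_def using cong_sym by blast
  then have c: "absp (u - of_int (r\<^sup>2)) < 1" using residue_mod_cong_iff[of u] u by simp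
  then have r: "absp (of_int (r\<^sup>2) :: 'a) = 1"
    using absp_eq_of_close[of "of_int (r\<^sup>2)" u] u by (simp add: absp_diff_commute)
  then have "(of_int r :: 'a) \<noteq> 0" by auto
  then have "u / of_int (r\<^sup>2) - 1 = (u - of_int (r\<^sup>2)) / of_int (r\<^sup>2)" by (simp add: field_simps)
  then have "absp (u / of_int (r\<^sup>2) - 1) < 1" using c r by (simp add: absp_divide)
  then obtain y where y: "y\<^sup>2 = u / of_int (r\<^sup>2)" by (rule square_root_near_1)
  have "(y * of_int r)\<^sup>2 = u" using y \<open>of_int r \<noteq> 0\<close> by (simp add: power_mult_distrib)
  then show "\<exists>y. y\<^sup>2 = u" by blast
next
  assume "\<exists>y. y\<^sup>2 = u"
  then obtain y where y: "y\<^sup>2 = u" by blast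
  then have "absp y ^ 2 = 1" using u absp_power[of y 2] by simp
  then have "absp y = 1" using absp_ge_0[of y] by (simp add: power2_eq_1_iff) 
  then show "lg u = 1" using lg_square y by blast
qed

section \<open>The Hilbert symbol in odd residue characteristic\<close>

definition upart :: "'a \<Rightarrow> 'a" where
  "upart a = a * of_nat p powi (- ordp p a)"

lemma powi_add: "real p powi (m + n) = real p powi m * real p powi n"
  by (rule power_int_add) simp

lemma absp_powi: "absp (x powi n :: 'a) = absp x powi n"
  by (simp add: power_int_def absp_power absp_inverse)

lemma absp_p_powi: "absp ((of_nat p :: 'a) powi n) = real p powi (- n)"
  by (simp add: absp_powi power_int_minus power_int_divide_distrib inverse_eq_divide)

lemma absp_upart: "a \<noteq> 0 \<Longrightarrow> absp (upart a) = 1"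
  unfolding upart_def absp_mult absp_p_powi by (subst absp_ordp) (simp_all flip: power_int_add)

lemma upart_ordp: "a = upart a * of_nat p powi ordp p a"
  by (simp add: upart_def power_int_minus)

lemma ordp_mult:
  assumes "a \<noteq> (0 :: 'a)" "b \<noteq> 0"
  shows "ordp p (a * b) = ordp p a + ordp p b"
  using absp_ordp[OF assms(1)] absp_ordp[OF assms(2)] p_gt_0
  by (intro ordp_powi) (simp add: absp_mult power_int_add[symmetric])

lemma upart_mult: "a \<noteq> 0 \<Longrightarrow> b \<noteq> 0 \<Longrightarrow> upart (a * b) = upart a * upart b"
  by (simp add: upart_def ordp_mult power_int_add power_int_diff power_int_minus field_simps)

lemma ordp_unit: "absp (u :: 'a) = 1 \<Longrightarrow> ordp p u = 0"
  by (rule ordp_powi) simp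

lemma ordp_p: "ordp p (of_nat p :: 'a) = 1"
  by (rule ordp_powi) (simp add: power_int_minus inverse_eq_divide)

lemma upart_p: "upart (of_nat p) = 1"
  by (simp add: upart_def ordp_p power_int_minus)

lemma hilbert_cases: "hilbert a b = 1 \<or> hilbert a b = - 1"
  by (simp add: hilbert_def)

lemma hilbert_eq_1I:
  "z\<^sup>2 = a * x\<^sup>2 + b * y\<^sup>2 \<Longrightarrow> (x, y, z) \<noteq> (0, 0, 0) \<Longrightarrow> hilbert a b = 1"
  unfolding hilbert_def by (intro if_P exI conjI)

lemma hilbert_eq_1E:
  assumes "hilbert a b = 1"
  obtains x y z where "z\<^sup>2 = a * x\<^sup>2 + b * y\<^sup>2" "(x, y, z) \<noteq> (0, 0, 0)"
proof -
  have "\<exists>x y z. (x, y, z) \<noteq> (0, 0, 0) \<and> z\<^sup>2 = a * x\<^sup>2 + b * y\<^sup>2"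
  proof (rule ccontr)
    assume "\<not> ?thesis"
    then have "hilbert a b = - 1" unfolding hilbert_def by (rule if_not_P)
    then show False using assms by simp
  qed
  then show ?thesis using that by blast
qed

lemma hilbert_eqI:
  "(hilbert a b = 1 \<Longrightarrow> hilbert c d = 1) \<Longrightarrow> (hilbert c d = 1 \<Longrightarrow> hilbert a b = 1) \<Longrightarrow> hilbert a b = hilbert c d"
  using hilbert_cases[of a b] hilbert_cases[of c d] by argo

lemma hilbert_commute: "hilbert (a :: 'a) b = hilbert b a"
proof -
  have *: "hilbert b a = 1" if h: "hilbert a b = 1" for a b :: 'a
  proof -
    obtain x y z where "z\<^sup>2 = a * x\<^sup>2 + b * y\<^sup>2" "(x, y, z) \<noteq> (0, 0, 0)"
      using h by (rule hilbert_eq_1E)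
    then show ?thesis by (intro hilbert_eq_1I[of z b y a x]) (simp_all add: add.commute)
  qed
  show ?thesis by (rule hilbert_eqI) (rule *, assumption)+
qed

lemma hilbert_mult_square:
  assumes t: "t \<noteq> (0 :: 'a)"
  shows "hilbert (a * t\<^sup>2) b = hilbert a b"
proof -
  have *: "hilbert (a * t\<^sup>2) b = 1" if h: "hilbert a b = 1" and t: "t \<noteq> 0" for a b t :: 'a
  proof -
    obtain x y z where "z\<^sup>2 = a * x\<^sup>2 + b * y\<^sup>2" "(x, y, z) \<noteq> (0, 0, 0)"
      using h by (rule hilbert_eq_1E)
    then show ?thesis using t
      by (intro hilbert_eq_1I[of z "a * t\<^sup>2" "x / t" b y]) (simp_all add: power_divide)
  qed
  show ?thesis
  proof (rule hilbert_eqI)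
    assume "hilbert (a * t\<^sup>2) b = 1"
    from *[OF this, of "inverse t"] t show "hilbert a b = 1" by (simp add: power_inverse mult.assoc)
  qed (use * t in blast)
qed

text \<open>Multiplying \<open>z\<^sup>2 - a x\<^sup>2 = b y\<^sup>2\<close> by \<open>- a\<close> gives \<open>(a x)\<^sup>2 = a z\<^sup>2 - a b y\<^sup>2\<close>.\<close>
lemma hilbert_neg_mult:
  assumes a: "a \<noteq> (0 :: 'a)"
  shows "hilbert a (- (a * b)) = hilbert a b"
proof -
  have *: "hilbert a (- (a * b)) = 1" if "hilbert a b = 1" for b
  proof -
    obtain x y z where h: "z\<^sup>2 = a * x\<^sup>2 + b * y\<^sup>2" "(x, y, z) \<noteq> (0, 0, 0)"
      using \<open>hilbert a b = 1\<close> by (rule hilbert_eq_1E)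
    have "(a * x)\<^sup>2 = a * z\<^sup>2 + (- (a * b)) * y\<^sup>2"
      unfolding h(1) by (simp add: power2_eq_square algebra_simps)
    then show ?thesis using h(2) a by (intro hilbert_eq_1I[of "a * x" a z _ y]) auto
  qed
  show ?thesis
  proof (rule hilbert_eqI)
    assume "hilbert a (- (a * b)) = 1"
    then have "hilbert a (- (a * (- (a * b)))) = 1" by (rule *)
    moreover have "hilbert a (- (a * (- (a * b)))) = hilbert (b * a\<^sup>2) a"
      by (subst hilbert_commute) (simp add: power2_eq_square algebra_simps)
    ultimately show "hilbert a b = 1" using hilbert_mult_square[OF a] hilbert_commute[of a b] by simp
  qed (rule *)
qed

lemma lg_eq_1_square: "absp u = 1 \<Longrightarrow> lg u = 1 \<Longrightarrow> \<exists>y. y\<^sup>2 = u"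
  using lg_eq_1_iff by blast

text \<open>Units modulo squares form a group of order two, with \<open>lg\<close> as its nontrivial
  character. The unit \<open>t\<close> is what later carries one \<open>y(jp)\<close> to another by
  torus conjugation.\<close>

lemma nonresidue_square_class:
  assumes "absp u = 1" "absp v = 1" "lg u = lg v"
  obtains t where "v = u * t\<^sup>2" "absp t = 1"
proof -
  have "absp (v / u) = 1" using assms by (simp add: absp_divide)
  moreover have "lg (v / u) * lg u = lg v"
    using lg_mult[of "v / u" u] assms calculation by (cases "u = 0") simp_all
  then have "lg (v / u) * (lg u * lg u) = lg u * lg u" using assms by simp
  then have "lg (v / u) = 1" unfolding lg_square_eq_1[OF assms(1)] by simp
  ultimately obtain t where t: "t\<^sup>2 = v / u" using lg_eq_1_square by blast
  have "u \<noteq> 0" using assms by auto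
  moreover have "absp t ^ 2 = 1" using absp_power[of t 2] \<open>absp (v / u) = 1\<close> t by simp
  then have "absp t = 1" using absp_ge_0[of t] by (simp add: power2_eq_1_iff)
  ultimately show ?thesis using that[of t] t by simp
qed

lemma hilbert_square_right: "s\<^sup>2 = v \<Longrightarrow> hilbert a v = 1"
  by (rule hilbert_eq_1I[of s a 0 v 1]) auto

text \<open>If both units are nonsquares, \<open>z\<^sup>2 = u (x\<^sup>2 + 1)\<close> is solved with \<open>x\<^sup>2 + 1\<close> the least nonresidue.\<close>
lemma hilbert_units:
  assumes u: "absp (u :: 'a) = 1" and v: "absp (v :: 'a) = 1"
  shows "hilbert u v = 1"
proof (cases "lg u = 1 \<or> lg v = 1")
  case True
  then show ?thesis
    using lg_eq_1_square[OF u] lg_eq_1_square[OF v] hilbert_square_right hilbert_commute by metis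
next
  case False
  then have nu: "lg u = -1" "lg v = -1" using lg_cases[OF u] lg_cases[OF v] by auto
  have r: "0 \<le> residue_mod p u" "residue_mod p u < int p" "absp (u - of_int (residue_mod p u)) < 1"
    using residue_mod[of u] u by auto
  define P where "P n \<longleftrightarrow> lg (of_nat n) = - 1" for n :: nat
  have "lg (of_int (residue_mod p u)) = - 1" using lg_close[of u] r u nu by simp
  then have P: "P (nat (residue_mod p u))" using r by (simp add: P_def)
  define n where "n = (LEAST n. P n)"
  have n: "P n" "n \<le> nat (residue_mod p u)" unfolding n_def using P by (rule LeastI, rule Least_le)
  have np: "n < p" using n(2) r by linarith
  have n0: "n \<noteq> 0"
  proof
    assume "n = 0"
    then show False using n(1) lg_not_unit[of 0] by (simp add: P_def)
  qed
  have n1: "n \<noteq> 1"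
  proof
    assume "n = 1"
    then show False using n(1) by (simp add: P_def)
  qed
  define m where "m = n - 1"
  have m: "m > 0" "m < p" "n = Suc m" using n0 n1 np by (auto simp: m_def)
  have "\<not> P m" using not_less_Least[of m P] m(3) by (simp add: n_def[symmetric])
  moreover have um: "absp (of_nat m :: 'a) = 1" if "m > 0" "m < p" for m
    using absp_of_int_eq_1[of "int m"] that zdvd_imp_le[of "int p" "int m"] by force
  ultimately have "lg (of_nat m) = 1" using lg_cases[of "of_nat m"] m by (auto simp: P_def)
  then have "\<exists>x :: 'a. x\<^sup>2 = of_nat m" by (rule lg_eq_1_square[OF um[OF m(1,2)]])
  then obtain x :: 'a where x: "x\<^sup>2 = of_nat m" by (rule exE)
  have "lg u = lg v" using nu by simp
  then obtain t where t: "v = u * t\<^sup>2" "absp t = 1" by (rule nonresidue_square_class[OF u v])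
  have t0: "t \<noteq> 0" using t by auto
  have un: "absp (of_nat n :: 'a) = 1" using um n0 np by simp
  have "lg (u * of_nat n) = 1" using lg_mult[of u "of_nat n"] u un nu n(1) by (simp add: P_def)
  moreover have "absp (u * of_nat n) = 1" using u un by (simp add: absp_mult)
  ultimately obtain z where z: "z\<^sup>2 = u * of_nat n" using lg_eq_1_square by blast
  have "u * x\<^sup>2 + v * (1 / t)\<^sup>2 = u * of_nat n"
    using t0 by (simp add: x t m(3) power_divide algebra_simps)
  then show ?thesis using z t0 by (intro hilbert_eq_1I[of z u x v "1 / t"]) auto
qed

text \<open>For a nonsquare unit \<open>v\<close> the form z^2 - v y^2 is anisotropic modulo
  \<open>p\<close>, so a nonzero value has even valuation. The valuation of u p x^2 is odd, and only
  the zero solution remains.\<close>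

lemma hilbert_p_unit:
  assumes u: "absp (u :: 'a) = 1" and v: "absp (v :: 'a) = 1"
  shows "hilbert (u * of_nat p) v = lg v"
proof (cases "lg v = 1")
  case True
  then show ?thesis using lg_eq_1_square[OF v] hilbert_square_right by metis
next
  case False
  have "hilbert (u * of_nat p) v \<noteq> 1"
  proof
    assume "hilbert (u * of_nat p) v = 1"
    then obtain x y z where h: "z\<^sup>2 = u * of_nat p * x\<^sup>2 + v * y\<^sup>2" "(x, y, z) \<noteq> (0, 0, 0)"
      by (rule hilbert_eq_1E)
    have ax: "absp (z\<^sup>2 - v * y\<^sup>2) = (absp x)\<^sup>2 / real p"
      using u by (simp add: h(1) absp_mult absp_power)
    have "absp (z\<^sup>2 - v * y\<^sup>2) = (max (absp z) (absp y))\<^sup>2"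
    proof (cases "absp z" "absp y" rule: linorder_cases)
      case less
      then have "absp (z\<^sup>2) < absp (- (v * y\<^sup>2))"
        using v by (simp add: absp_mult absp_power power_strict_mono)
      then show ?thesis using absp_add_eq[of "z\<^sup>2" "- (v * y\<^sup>2)"] less v by (simp add: absp_mult absp_power)
    next
      case greater
      then have "absp (- (v * y\<^sup>2)) < absp (z\<^sup>2)"
        using v by (simp add: absp_mult absp_power power_strict_mono)
      then show ?thesis using absp_add_eq'[of "- (v * y\<^sup>2)" "z\<^sup>2"] greater by (simp add: absp_power)
    next
      case equal
      show ?thesis
      proof (cases "y = 0")
        case True
        then show ?thesis using equal by simp
      next
        case False
        \<comment> \<open>Cancellation between terms of equal size would make \<open>v\<close>
          congruent to \<open>(z / y)\<^sup>2\<close>.\<close>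
        have "\<not> absp ((z / y)\<^sup>2 - v) < 1"
        proof
          assume a: "absp ((z / y)\<^sup>2 - v) < 1"
          have zy: "absp (z / y) = 1" using equal False by (simp add: absp_divide)
          then have "lg ((z / y)\<^sup>2) = lg v" using a by (intro lg_close) (simp_all add: absp_power)
          then show False using lg_square[OF zy] \<open>lg v \<noteq> 1\<close> by simp
        qed
        moreover have "absp ((z / y)\<^sup>2 - v) \<le> 1"
          using equal False v by (intro absp_diff_le) (simp_all add: absp_power absp_divide)
        ultimately have "absp ((z / y)\<^sup>2 - v) = 1" by simp
        moreover have "z\<^sup>2 - v * y\<^sup>2 = ((z / y)\<^sup>2 - v) * y\<^sup>2"
          using False by (simp add: power_divide field_simps)
        ultimately show ?thesis using equal by (simp only: absp_mult absp_power max.idem mult_1)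
      qed
    qed
    then have e: "(max (absp z) (absp y))\<^sup>2 = (absp x)\<^sup>2 / real p" using ax by simp
    show False
    proof (cases "x = 0")
      case True
      then have "max (absp z) (absp y) = 0" using e by simp
      then have "absp z \<le> 0" "absp y \<le> 0" by linarith+
      then show False using h(2) True by simp
    next
      case False
      then obtain k where k: "absp x = real p powi k" by (rule absp_value)
      have "max (absp z) (absp y) \<noteq> 0"
      proof
        assume "max (absp z) (absp y) = 0"
        then show False using e False p_gt_0 by simp
      qed
      then obtain w where w: "w \<noteq> 0" "max (absp z) (absp y) = absp (w :: 'a)"
        by (cases "absp z \<le> absp y") (auto simp: max_def)
      obtain m where m: "absp w = real p powi m" using w(1) by (rule absp_value)
      have "real p powi (m + m) = real p powi (k + k + (- 1))"
        using e unfolding w m k powi_add by (simp add: power2_eq_square power_int_minus divide_inverse)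
      then have "m + m = k + k + (- 1)" by (simp only: powi_inject)
      then show False by presburger
    qed
  qed
  then show ?thesis using False lg_cases[OF v] hilbert_cases by metis
qed

text \<open>Multiplying the second argument by minus the first gives -uv times a square, which
  reduces the symbol to one against a unit.\<close>

lemma hilbert_p_p:
  assumes u: "absp (u :: 'a) = 1" and v: "absp (v :: 'a) = 1"
  shows "hilbert (u * of_nat p) (v * of_nat p) = lg (- 1) * lg u * lg v"
proof -
  have u0: "u * of_nat p \<noteq> 0" using u by auto
  have "hilbert (u * of_nat p) (v * of_nat p) = hilbert (- (u * v) * (of_nat p)\<^sup>2) (u * of_nat p)"
    using hilbert_neg_mult[OF u0, of "v * of_nat p"] hilbert_commute[of "u * of_nat p"]
    by (simp add: power2_eq_square ac_simps)
  also have "\<dots> = hilbert (u * of_nat p) (- (u * v))"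
    using hilbert_mult_square[of "of_nat p"] hilbert_commute by (simp only: of_nat_p_neq_0 not_False_eq_True)
  also have "\<dots> = lg (- 1 * u * v)"
    using hilbert_p_unit[of u "- (u * v)"] u v by (simp add: absp_mult)
  also have "\<dots> = lg (- 1) * lg u * lg v"
    using u v lg_mult[of "- 1 * u" v] lg_mult[of "- 1" u] by (simp add: absp_mult)
  finally show ?thesis .
qed

lemma hilbert_mult_even_power:
  "hilbert (a * (of_nat p :: 'a) powi (2 * n)) b = hilbert a b"
  using hilbert_mult_square[of "of_nat p powi n" a b]
  by (simp add: power2_eq_square flip: power_int_add)

text \<open>For nonzero \<open>a\<close>, the unit or unit times \<open>p\<close> that differs from
  \<open>a\<close> by an even power of \<open>p\<close>.\<close>

definition opart :: "'a \<Rightarrow> 'a" where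
  "opart a = upart a * (if odd (ordp p a) then of_nat p else 1)"

lemma hilbert_opart: "hilbert a b = hilbert (opart a) (b :: 'a)"
proof -
  define n where "n = ordp p a div 2"
  have "a = opart a * of_nat p powi (2 * n)"
  proof (cases "odd (ordp p a)")
    case True
    then have "ordp p a = 1 + 2 * n" unfolding n_def by presburger
    then have "a = upart a * of_nat p powi (1 + 2 * n)" using upart_ordp[of a] by simp
    also have "\<dots> = opart a * of_nat p powi (2 * n)"
      using True by (subst power_int_add) (simp_all add: opart_def)
    finally show ?thesis .
  next
    case False
    then have "ordp p a = 2 * n" unfolding n_def by presburger
    then show ?thesis using upart_ordp[of a] False by (simp add: opart_def)
  qed
  then show ?thesis using hilbert_mult_even_power[of "opart a" n b] by simp
qed

text \<open>The tame symbol. Solvability of a conic becomes an explicit sign depending on the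
  parities of the valuations and on the unit parts; bilinearity, invisible in the definition, is
  read off from it.\<close>

lemma hilbert_formula:
  assumes "a \<noteq> (0 :: 'a)" "b \<noteq> 0"
  shows "hilbert a b =
    (if odd (ordp p a) \<and> odd (ordp p b) then lg (- 1) else 1) *
    (if odd (ordp p b) then lg (upart a) else 1) * (if odd (ordp p a) then lg (upart b) else 1)"
proof -
  have u: "absp (upart a) = 1" "absp (upart b) = 1" using assms by (simp_all add: absp_upart)
  have "hilbert a b = hilbert (opart a) (opart b)"
    using hilbert_opart[of a b] hilbert_opart[of b "opart a"] hilbert_commute[of "opart a" b]
      hilbert_commute[of "opart a" "opart b"] by simp
  moreover have "hilbert (upart a) (upart b * of_nat p) = lg (upart a)"
    using hilbert_p_unit[OF u(2,1)] hilbert_commute[of "upart a"] by simp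
  ultimately show ?thesis
    using hilbert_p_unit[OF u] hilbert_p_p[OF u] hilbert_units[OF u] by (simp add: opart_def)
qed

lemma hilbert_mult_left:
  assumes "a \<noteq> (0 :: 'a)" "a' \<noteq> 0" "b \<noteq> 0"
  shows "hilbert (a * a') b = hilbert a b * hilbert a' b"
proof -
  have u: "absp (upart a) = 1" "absp (upart a') = 1" "absp (upart b) = 1"
    using assms by (simp_all add: absp_upart)
  have m: "lg (upart a * upart a') = lg (upart a) * lg (upart a')" using u by (intro lg_mult) auto
  have q: "lg (upart b) * lg (upart b) = 1" "lg (- 1) * lg (- 1) = 1"
    using lg_square_eq_1 u by auto
  have q': "lg (upart b) * (lg (upart b) * x) = x" "lg (- 1) * (lg (- 1) * x) = x" for x
    using q by (simp_all flip: mult.assoc)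
  have z: "a * a' \<noteq> 0" using assms by simp
  show ?thesis
    unfolding hilbert_formula[OF z assms(3)] hilbert_formula[OF assms(1,3)] hilbert_formula[OF assms(2,3)]
      ordp_mult[OF assms(1,2)] upart_mult[OF assms(1,2)] m
    using q q' by (cases "odd (ordp p a)"; cases "odd (ordp p a')"; cases "odd (ordp p b)")
      (simp_all add: ac_simps)
qed

lemma hilbert_mult_right:
  "a \<noteq> (0 :: 'a) \<Longrightarrow> b \<noteq> 0 \<Longrightarrow> b' \<noteq> 0 \<Longrightarrow> hilbert a (b * b') = hilbert a b * hilbert a b'"
  using hilbert_mult_left[of b b' a] by (simp add: hilbert_commute[of a])

lemma hilbert_sq: "hilbert a b * hilbert a b = 1"
  using hilbert_cases[of a b] by auto

lemma hilbert_self: "a \<noteq> (0 :: 'a) \<Longrightarrow> hilbert a a = hilbert a (- 1)"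
  using hilbert_neg_mult[of a "- 1"] by simp

text \<open>The Steinberg relation in homogeneous form: z^2 = xz + yz means that the symbol of xz
  and yz is 1, which is then expanded by bilinearity. It is the additive input to the cocycle
  computation.\<close>

lemma hilbert_sum:
  assumes "x \<noteq> (0 :: 'a)" "y \<noteq> 0" "x + y = z" "z \<noteq> 0"
  shows "hilbert x y * hilbert (- (x * y)) z = 1"
proof -
  have "hilbert (x * z) (y * z) = 1"
    by (rule hilbert_eq_1I[of z _ 1 _ 1]) (simp_all add: assms(3)[symmetric] power2_eq_square algebra_simps)
  moreover have "hilbert (x * z) (y * z) = hilbert x (y * z) * hilbert z (y * z)"
    using assms by (intro hilbert_mult_left) simp_all
  moreover have "hilbert x (y * z) = hilbert x y * hilbert x z"
    using assms by (intro hilbert_mult_right) simp_all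
  moreover have "hilbert z (y * z) = hilbert z y * hilbert z z"
    using assms by (intro hilbert_mult_right) simp_all
  ultimately have 1: "hilbert x y * hilbert x z * (hilbert z y * hilbert z z) = 1" by simp
  have "hilbert (- (x * y)) z = hilbert (- 1) z * (hilbert x z * hilbert y z)"
    using hilbert_mult_left[of "- 1" "x * y" z] hilbert_mult_left[of x y z] assms by simp
  then have "hilbert (- (x * y)) z = hilbert z z * (hilbert x z * hilbert z y)"
    unfolding hilbert_self[OF assms(4)] hilbert_commute[of y z] hilbert_commute[of "- 1" z] .
  then have "hilbert x y * hilbert (- (x * y)) z = hilbert x y * hilbert x z * (hilbert z y * hilbert z z)"
    by (simp only: mult_ac)
  then show ?thesis unfolding 1 .
qed

lemma hilbert_unit_even:
  assumes u: "absp (u :: 'a) = 1" and a: "a \<noteq> 0" and e: "even (ordp p a)"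
  shows "hilbert a u = 1"
proof -
  have "u \<noteq> 0" using u by auto
  then show ?thesis unfolding hilbert_formula[OF a \<open>u \<noteq> 0\<close>] using e by (simp add: ordp_unit u)
qed

end

subsection \<open>Two-by-two matrices and the cocycle\<close>

lemma mat2_nth [simp]:
  "mat2 a b c d $ 1 $ 1 = a" "mat2 a b c d $ 1 $ 2 = b"
  "mat2 a b c d $ 2 $ 1 = c" "mat2 a b c d $ 2 $ 2 = d"
  by (simp_all add: mat2_def vector_2)

lemma mat2_eta: "mat2 (A $ 1 $ 1) (A $ 1 $ 2) (A $ 2 $ 1) (A $ 2 $ 2) = A"
  by (simp add: vec_eq_iff forall_2)

lemma mat2_cases: obtains a b c d where "A = mat2 a b c d"
  using mat2_eta[of A] by metis

lemma mat2_eq_iff [simp]: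
  "mat2 a b c d = mat2 a' b' c' d' \<longleftrightarrow> a = a' \<and> b = b' \<and> c = c' \<and> d = d'"
  by (auto simp: vec_eq_iff forall_2)

lemma mat2_mult:
  "mat2 a b c d ** mat2 a' b' c' d' =
    mat2 (a * a' + b * c') (a * b' + b * d') (c * a' + d * c') (c * b' + d * (d' :: 'b::semiring_1))"
  by (simp add: vec_eq_iff forall_2 matrix_matrix_mult_def sum_2)

lemma mat_1_eq_mat2: "mat 1 = mat2 1 0 0 (1 :: 'b::semiring_1)"
  by (simp add: vec_eq_iff forall_2 mat_def)

lemma mat2_in_SL2 [simp]: "mat2 a b c d \<in> SL2 \<longleftrightarrow> a * d - b * c = 1"
  by (simp add: SL2_def det_2)

lemma SL2_mult: "A \<in> SL2 \<Longrightarrow> B \<in> SL2 \<Longrightarrow> A ** B \<in> SL2"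
  by (simp add: SL2_def det_mul)

lemma mat2_in_borel [simp]: "mat2 a b c d \<in> borel_subgroup \<longleftrightarrow> c = 0 \<and> a * d = 1"
  by (auto simp: borel_subgroup_def)

context padic
begin

lemma mat2_in_SL2_Zp:
  "mat2 a b c d \<in> SL2_Zp \<longleftrightarrow>
    a * d - b * c = 1 \<and> absp a \<le> 1 \<and> absp b \<le> 1 \<and> absp c \<le> 1 \<and> absp (d :: 'a) \<le> 1"
  by (auto simp: SL2_Zp_def Zp_def forall_2)

lemma mat2_in_K0:
  "mat2 a b c d \<in> K0 p m \<longleftrightarrow>
    a * d - b * c = 1 \<and> absp a \<le> 1 \<and> absp b \<le> 1 \<and> absp (d :: 'a) \<le> 1 \<and> absp c \<le> 1 / real p ^ m"
proof -
  have "1 / real p ^ m \<le> 1" using p_gt_1 by simp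
  then show ?thesis by (auto simp: K0_def mat2_in_SL2_Zp pow_ideal_iff)
qed

lemma K0_subset_SL2: "K0 p m \<subseteq> (SL2 :: ('a^2^2) set)"
  by (auto simp: K0_def SL2_Zp_def)

lemma K0_mono:
  assumes "n \<le> m" shows "K0 p m \<subseteq> (K0 p n :: ('a^2^2) set)"
proof -
  have "1 / real p ^ m \<le> 1 / real p ^ n" using assms p_gt_1 by (simp add: field_simps power_increasing)
  then show ?thesis by (auto simp: K0_def pow_ideal_iff)
qed

text \<open>Determinant 1 with \<open>c\<close> in the maximal ideal gives ad = 1 modulo
  \<open>p\<close>, and integrality then forces both diagonal entries to be units.\<close>

lemma K0_1_iff:
  "mat2 a b c d \<in> K0 p 1 \<longleftrightarrow>
    a * d - b * c = 1 \<and> absp a = 1 \<and> absp b \<le> 1 \<and> absp (d :: 'a) = 1 \<and> absp c < 1 \<and> absp (a * d - 1) < 1"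
proof
  assume "mat2 a b c d \<in> K0 p 1"
  then have h: "a * d - b * c = 1" "absp a \<le> 1" "absp b \<le> 1" "absp d \<le> 1" "absp c < 1"
    by (auto simp: mat2_in_K0 absp_lt_1)
  have "absp (b * c) \<le> 1 * absp c" unfolding absp_mult using h by (intro mult_right_mono) auto
  then have bc: "absp (b * c) < 1" using h by simp
  have "a * d - 1 = b * c" using h(1) by (simp add: algebra_simps)
  then have ad: "absp (a * d - 1) < 1" using bc by simp
  then have "absp (a * d) = 1" using absp_eq_of_close[of "a * d" 1] by simp
  then have prod: "absp a * absp d = 1" by (simp add: absp_mult)
  have "absp a * absp d \<le> absp a * 1" by (intro mult_left_mono) (use h in auto)
  moreover have "absp a * absp d \<le> 1 * absp d" by (intro mult_right_mono) (use h in auto)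
  ultimately have "absp a = 1" "absp d = 1" using prod h by linarith+
  then show "a * d - b * c = 1 \<and> absp a = 1 \<and> absp b \<le> 1 \<and> absp d = 1 \<and> absp c < 1 \<and> absp (a * d - 1) < 1"
    using h ad by blast
qed (auto simp: mat2_in_K0 absp_lt_1)

lemma K0_1_cases:
  assumes "A \<in> K0 p 1"
  obtains a b c d :: 'a where "A = mat2 a b c d" "a * d - b * c = 1" "absp a = 1" "absp b \<le> 1"
    "absp d = 1" "absp c < 1" "absp (a * d - 1) < 1"
  using assms K0_1_iff by (cases A rule: mat2_cases) blast

section \<open>The cocycle on \<open>K0 p 1\<close>, on the Borel subgroup and at
  \<open>w(1)\<close>\<close>

lemma tau_mat2: "tau (mat2 a b c d) = (if c \<noteq> 0 then c else d)"
  by (simp add: tau_def)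

text \<open>The parity condition in \<open>s_sign\<close> disappears, because an entry of even
  valuation has trivial symbol against a unit.\<close>

lemma s_sign_unit_d:
  "absp (d :: 'a) = 1 \<Longrightarrow> s_sign p (mat2 a b c d) = (if c \<noteq> 0 then hilbert c d else 1)"
  using hilbert_unit_even[of d c] by (auto simp: s_sign_def)

lemma s_sign_unit_c: "absp (c :: 'a) = 1 \<Longrightarrow> s_sign p (mat2 a b c d) = 1"
  by (simp add: s_sign_def ordp_unit)

lemma s_sign_c_0: "s_sign p (mat2 a b 0 d) = 1"
  by (simp add: s_sign_def)

lemma s_sign_cases: "s_sign p A = 1 \<or> s_sign p A = - 1"
  using hilbert_cases[of "A $ 2 $ 1" "A $ 2 $ 2"] by (simp add: s_sign_def)

lemma cocycle_cases: "cocycle p A B = 1 \<or> cocycle p A B = - 1"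
  using hilbert_cases[of "tau (A ** B) * tau A" "tau (A ** B) * tau B"] s_sign_cases[of A] s_sign_cases[of B]
    s_sign_cases[of "A ** B"] unfolding cocycle_def by (elim disjE) simp_all

text \<open>The quotient of two congruent units is near 1, hence a square.\<close>

lemma hilbert_unit_cong:
  assumes u: "absp (u :: 'a) = 1" and uv: "absp (u - v) < 1"
  shows "hilbert x u = hilbert x v"
proof -
  have v: "absp v = 1" using absp_eq_of_close[of v u] u uv by (simp add: absp_diff_commute)
  then have v0: "v \<noteq> 0" by auto
  have "u / v - 1 = (u - v) / v" using v0 by (simp add: field_simps)
  then have "absp (u / v - 1) < 1" using uv v by (simp add: absp_divide)
  then obtain y where y: "y\<^sup>2 = u / v" by (rule square_root_near_1)
  then have "u = v * y\<^sup>2" using v0 by simp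
  moreover have "y \<noteq> 0" using y u v0 by auto
  ultimately show ?thesis using hilbert_mult_square[of y v x] by (simp add: hilbert_commute[of x])
qed

lemma hilbert_inverse_unit:
  assumes d: "absp (d :: 'a) = 1" and ad: "absp (a * d - 1) < 1" and x: "x \<noteq> 0"
  shows "hilbert x a = hilbert x d"
proof -
  have d0: "d \<noteq> 0" using d by auto
  have e: "absp (a * d) = 1" using absp_eq_of_close[of "a * d" 1] ad by simp
  then have "a \<noteq> 0" by auto
  have "hilbert x (a * d) = 1" using hilbert_unit_cong[of "a * d" 1 x] e ad hilbert_square_right[of 1 1 x] by simp
  then have "hilbert x a * hilbert x d = 1" using hilbert_mult_right[OF x \<open>a \<noteq> 0\<close> d0] by simp
  then show ?thesis using hilbert_cases[of x a] hilbert_cases[of x d] by auto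
qed

lemma hilbert_sq': "hilbert a b * (hilbert a b * z) = z"
  by (simp add: hilbert_sq flip: mult.assoc)

text \<open>The cover splits over \<open>K0 p 1\<close> with all signs equal to 1. Inside the
  symbols a unit matters only modulo \<open>p\<close>, so \<open>d''\<close> acts as
  \<open>d * d'\<close> and \<open>a'\<close> as \<open>d'\<close>. What remains is a case split on
  the vanishing of the lower left entries, where \<open>tau\<close> and \<open>s_sign\<close> change
  their form.\<close>

lemma cocycle_K0:
  assumes g: "g \<in> K0 p 1" and h: "h \<in> (K0 p 1 :: ('a^2^2) set)"
  shows "cocycle p g h = 1" and "g ** h \<in> K0 p 1"
proof -
  obtain a b c d where G: "g = mat2 a b c d" "a * d - b * c = 1" "absp a = 1" "absp b \<le> 1"
    "absp d = 1" "absp c < 1" "absp (a * d - 1) < 1" using g by (rule K0_1_cases)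
  obtain a' b' c' d' where H: "h = mat2 a' b' c' d'" "a' * d' - b' * c' = 1" "absp a' = 1" "absp b' \<le> 1"
    "absp d' = 1" "absp c' < 1" "absp (a' * d' - 1) < 1" using h by (rule K0_1_cases)
  have le: "absp (x * y) \<le> 1" if "absp x \<le> 1" "absp y \<le> 1" for x y :: 'a
    using that by (simp add: absp_mult mult_le_one)
  have lt: "absp (x * y) < 1" if "absp x < 1" "absp y \<le> 1" for x y :: 'a
    using that mult_right_mono[of "absp x" 1 "absp y"] mult_left_le[of "absp y" "absp x"] by (simp add: absp_mult)
  define c'' where "c'' = c * a' + d * c'"
  define d'' where "d'' = c * b' + d * d'"
  have gh: "g ** h = mat2 (a * a' + b * c') (a * b' + b * d') c'' d''"
    by (simp add: G(1) H(1) mat2_mult c''_def d''_def)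
  have "absp c'' < 1" unfolding c''_def
    using lt[of c a'] lt[of c' d] G H by (intro absp_add_less) (simp_all add: mult.commute)
  moreover have "absp (a * a' + b * c') \<le> 1" "absp (a * b' + b * d') \<le> 1" "absp d'' \<le> 1"
    unfolding d''_def by (intro absp_add_le le; use G H in simp)+
  moreover have "g ** h \<in> SL2" using g h K0_subset_SL2 SL2_mult by blast
  ultimately show gh_in: "g ** h \<in> K0 p 1" unfolding gh by (simp add: mat2_in_K0 absp_lt_1)
  then have d''1: "absp d'' = 1" unfolding gh K0_1_iff by simp
  have dd: "absp (d'' - d * d') < 1" using lt[of c b'] G H by (simp add: d''_def)
  have n0: "a \<noteq> 0" "d \<noteq> 0" "a' \<noteq> 0" "d' \<noteq> 0" "d'' \<noteq> 0" using G H d''1 by auto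
  have d''h: "hilbert x d'' = hilbert x d * hilbert x d'" if "x \<noteq> 0" for x
    using hilbert_unit_cong[OF d''1 dd] hilbert_mult_right[OF that n0(2,4)] by simp
  have a'h: "hilbert x a' = hilbert x d'" if "x \<noteq> 0" for x
    using hilbert_inverse_unit[OF H(5,7) that] .
  have u1: "hilbert d d' = 1" "hilbert d d = 1" "hilbert d' d' = 1" "hilbert d' d = 1"
    "hilbert d (- 1) = 1" "hilbert d' (- 1) = 1"
    using G H by (simp_all add: hilbert_units)
  have s: "s_sign p g = (if c \<noteq> 0 then hilbert c d else 1)"
    "s_sign p h = (if c' \<noteq> 0 then hilbert c' d' else 1)"
    "s_sign p (g ** h) = (if c'' \<noteq> 0 then hilbert c'' d'' else 1)"
    by (simp_all only: gh s_sign_unit_d[OF d''1]) (simp_all only: G(1) H(1) s_sign_unit_d[OF G(5)] s_sign_unit_d[OF H(5)])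
  have t: "tau g = (if c \<noteq> 0 then c else d)" "tau h = (if c' \<noteq> 0 then c' else d')"
    "tau (g ** h) = (if c'' \<noteq> 0 then c'' else d'')"
    by (simp_all only: gh tau_mat2) (simp_all only: G(1) H(1) tau_mat2)
  note bil = hilbert_mult_left hilbert_mult_right
  note sq = mult_ac hilbert_sq hilbert_sq' mult_1_left mult_1_right
  have c1: "hilbert x c = hilbert c x" "hilbert x c' = hilbert c' x" "hilbert x c'' = hilbert c'' x" for x :: 'a
    using hilbert_commute by blast+
  show "cocycle p g h = 1"
  proof (cases "c = 0")
    case c: True
    show ?thesis
    proof (cases "c' = 0")
      case True
      then have "c'' = 0" using c by (simp add: c''_def)
      have "hilbert (d'' * d) (d'' * d') = 1"
        using d''1 G H by (intro hilbert_units) (simp_all add: absp_mult)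
      then show ?thesis unfolding cocycle_def s t using c True \<open>c'' = 0\<close> by simp
    next
      case False
      have c'': "c'' = d * c'" using c by (simp add: c''_def)
      have e: "hilbert (c'' * d) (c'' * c') = hilbert c' d"
      proof -
        have "c'' * d = c' * d\<^sup>2" "c'' * c' = d * c'\<^sup>2" by (simp_all add: c'' power2_eq_square)
        then show ?thesis using hilbert_mult_square[OF n0(2)] hilbert_mult_square[OF False]
          by (simp add: hilbert_commute[of c'])
      qed
      have "hilbert c'' d'' = hilbert c' d * hilbert c' d'"
        using d''h[of c''] False n0 u1 by (simp add: c'' bil)
      then show ?thesis unfolding cocycle_def s t using c False n0 e
        by (simp add: c'' hilbert_sq hilbert_sq' ac_simps)
    qed
  next
    case c: False
    show ?thesis
    proof (cases "c' = 0")
      case True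
      then have c'': "c'' = c * a'" by (simp add: c''_def)
      have "a' * d' = 1" using H(2) True by simp
      then have "c'' * d' = c" "c'' * c = a' * c\<^sup>2" by (simp_all add: c'' power2_eq_square mult.assoc)
      then have e: "hilbert (c'' * c) (c'' * d') = hilbert c d'"
        using hilbert_mult_square[OF c, of a' c] a'h[OF c] hilbert_commute by simp
      have "hilbert c'' d'' = hilbert c d * hilbert c d'"
      proof -
        have "hilbert c'' d'' = hilbert c d'' * hilbert a' d''" using c n0 by (simp add: c'' bil)
        moreover have "hilbert a' d'' = 1" using H d''1 by (intro hilbert_units)
        ultimately show ?thesis using d''h[OF c] by simp
      qed
      then show ?thesis unfolding cocycle_def s t using c True n0 e
        by (simp add: c'' hilbert_sq hilbert_sq' ac_simps)
    next
      case c': False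
      show ?thesis
      proof (cases "c'' = 0")
        case True
        \<comment> \<open>Here \<open>c'\<close> is \<open>c\<close> times the unit
          \<open>- (a' / d)\<close>, so all symbols with \<open>c'\<close> can be expressed through
          \<open>c\<close>.\<close>
        then have "c * a' = - (d * c')" by (simp add: c''_def eq_neg_iff_add_eq_0)
        then have cc': "c' = - (c * (a' / d))" using n0 by (simp add: field_simps)
        have ad: "absp (a' / d) = 1" using G H by (simp add: absp_divide)
        have hcc': "hilbert c c' = hilbert c d' * hilbert c d"
        proof -
          have "hilbert c c' = hilbert c (a' / d)" unfolding cc' by (rule hilbert_neg_mult[OF c])
          also have "\<dots> = hilbert c (a' * inverse d)" by (simp add: divide_inverse)
          also have "\<dots> = hilbert c a' * hilbert c (inverse d)" using c n0 by (simp add: bil)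
          also have "hilbert c (inverse d) = hilbert c d"
            using hilbert_inverse_unit[of d "inverse d" c] G(5) n0 c by simp
          finally show ?thesis using a'h[OF c] by simp
        qed
        have unit: "hilbert c' u = hilbert c u" if u: "absp u = 1" for u
        proof -
          have "u \<noteq> 0" using u by auto
          have "c' = (- (a' / d)) * c" by (simp add: cc')
          then have "hilbert c' u = hilbert (- (a' / d)) u * hilbert c u"
            using c n0 \<open>u \<noteq> 0\<close> hilbert_mult_left[of "- (a' / d)" c u] by simp
          moreover have "hilbert (- (a' / d)) u = 1" using ad u by (intro hilbert_units) simp_all
          ultimately show ?thesis by simp
        qed
        have "hilbert (d'' * c) (d'' * c') = hilbert d'' d'' * hilbert d'' c' * (hilbert c d'' * hilbert c c')"
          using c c' n0 by (simp add: bil mult_ac)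
        moreover have "hilbert d'' d'' = 1" using d''1 by (intro hilbert_units)
        moreover have "hilbert d'' c' = hilbert c d''" using unit[OF d''1] hilbert_commute[of d''] by simp
        ultimately have e: "hilbert (d'' * c) (d'' * c') = hilbert c d' * hilbert c d"
          using hcc' by (simp add: hilbert_sq hilbert_sq')
        show ?thesis unfolding cocycle_def s t using c c' True e unit[OF H(5)]
          by (simp add: hilbert_sq hilbert_sq' mult_ac)
      next
        case c'': False
        \<comment> \<open>Generic case: apply \<open>hilbert_sum\<close> to the two summands of
          \<open>c''\<close>. Once expanded, its left side is the cocycle factor by factor.\<close>
        have "hilbert (c * a') (d * c') * hilbert (- ((c * a') * (d * c'))) c'' = 1"
          using c c' c'' n0 by (intro hilbert_sum) (simp_all add: c''_def)
        moreover have "hilbert (c * a') (d * c') = hilbert c d * hilbert c c' * hilbert c' d'"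
        proof -
          have "hilbert (c * a') (d * c') = hilbert c d * hilbert c c' * (hilbert a' d * hilbert a' c')"
            using c c' n0 by (simp add: bil mult_ac)
          moreover have "hilbert a' d = 1" using G H by (intro hilbert_units)
          moreover have "hilbert a' c' = hilbert c' d'" using a'h[OF c'] hilbert_commute[of a'] by simp
          ultimately show ?thesis by simp
        qed
        moreover have "hilbert (- ((c * a') * (d * c'))) c'' =
            hilbert c'' (- 1) * (hilbert c'' c * hilbert c'' d') * (hilbert c'' d * hilbert c'' c')"
        proof -
          have "- ((c * a') * (d * c')) = (- 1) * ((c * a') * (d * c'))" by simp
          then have "hilbert (- ((c * a') * (d * c'))) c'' = hilbert c'' ((- 1) * ((c * a') * (d * c')))"
            using hilbert_commute by simp
          also have "\<dots> = hilbert c'' (- 1) * (hilbert c'' c * hilbert c'' a' * (hilbert c'' d * hilbert c'' c'))"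
            using c c' c'' n0 hilbert_mult_right[of c'' "- 1" "(c * a') * (d * c')"]
              hilbert_mult_right[of c'' "c * a'" "d * c'"] hilbert_mult_right[of c'' c a']
              hilbert_mult_right[of c'' d c'] by simp
          finally show ?thesis using a'h[OF c''] by (simp add: mult_ac)
        qed
        ultimately have S: "(hilbert c d * hilbert c c' * hilbert c' d') *
            (hilbert c'' (- 1) * (hilbert c'' c * hilbert c'' d') * (hilbert c'' d * hilbert c'' c')) = 1" by simp
        have "hilbert (c'' * c) (c'' * c') = hilbert c'' c'' * hilbert c'' c' * (hilbert c c'' * hilbert c c')"
          using c c' c'' by (simp add: bil mult_ac)
        then have "hilbert (c'' * c) (c'' * c') = hilbert c'' (- 1) * hilbert c'' c' * (hilbert c'' c * hilbert c c')"
          using hilbert_self[OF c''] hilbert_commute[of c c''] by simp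
        then have "cocycle p g h = hilbert c'' (- 1) * hilbert c'' c' * (hilbert c'' c * hilbert c c') *
          hilbert c d * hilbert c' d' * (hilbert c'' d * hilbert c'' d')"
          unfolding cocycle_def s t using c c' c'' d''h[OF c''] by simp
        also have "\<dots> = (hilbert c d * hilbert c c' * hilbert c' d') *
            (hilbert c'' (- 1) * (hilbert c'' c * hilbert c'' d') * (hilbert c'' d * hilbert c'' c'))"
          by (simp only: mult_ac)
        finally show ?thesis unfolding S .
      qed
    qed
  qed
qed

text \<open>\<open>tau\<close> is the lower right entry here, and d d' d equals a' up to a square.
  The resulting symbol later cancels the one in \<open>weil_gamma_mult\<close>, which is what makes
  \<open>mu_B\<close> multiplicative.\<close>

lemma cocycle_borel:
  assumes "a * d = (1 :: 'a)" "a' * d' = 1"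
  shows "cocycle p (mat2 a b 0 d) (mat2 a' b' 0 d') = hilbert a a'"
proof -
  have n0: "a \<noteq> 0" "d \<noteq> 0" "a' \<noteq> 0" "d' \<noteq> 0" using assms by auto
  have "d * d' * d = a' * (d * d')\<^sup>2" "d * d' * d' = a * (d * d')\<^sup>2"
    using assms by (simp_all add: power2_eq_square)
  then have "hilbert (d * d' * d) (d * d' * d') = hilbert a' a"
    using hilbert_mult_square[of "d * d'"] n0 hilbert_commute by simp
  then show ?thesis
    by (simp add: cocycle_def mat2_mult tau_mat2 s_sign_c_0 hilbert_commute[of a])
qed

text \<open>A product with \<open>w(1)\<close> has a unit as lower left entry, hence trivial
  \<open>s_sign\<close>. The symbols left over are symbols of units or reduce by
  \<open>hilbert_neg_mult\<close> to the \<open>s_sign\<close> of \<open>k\<close>.\<close>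

lemma cocycle_K0_w:
  assumes "k \<in> (K0 p 1 :: ('a^2^2) set)"
  shows "cocycle p k (mat2 0 1 (- 1) 0) = 1" and "cocycle p (mat2 0 1 (- 1) 0) k = 1"
proof -
  obtain a b c d where G: "k = mat2 a b c d" "a * d - b * c = 1" "absp a = 1" "absp b \<le> 1"
    "absp d = 1" "absp c < 1" "absp (a * d - 1) < 1" using assms by (rule K0_1_cases)
  have n0: "a \<noteq> 0" "d \<noteq> 0" using G by auto
  have sw: "s_sign p (mat2 0 1 (- 1) (0 :: 'a)) = 1" by (simp add: s_sign_def)
  have sk: "s_sign p k = (if c \<noteq> 0 then hilbert c d else 1)" unfolding G(1) using G by (intro s_sign_unit_d)
  show "cocycle p k (mat2 0 1 (- 1) 0) = 1"
  proof -
    have kw: "k ** mat2 0 1 (- 1) 0 = mat2 (- b) a (- d) c" by (simp add: G(1) mat2_mult)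
    have "s_sign p (mat2 (- b) a (- d) c) = 1" using G by (intro s_sign_unit_c) simp
    moreover have "hilbert (- (d * c)) d = hilbert c d" if "c \<noteq> 0"
      using hilbert_neg_mult[OF n0(2), of c] hilbert_commute by simp
    moreover have "hilbert (- (d * d)) d = 1" using G by (intro hilbert_units) (simp_all add: absp_mult)
    ultimately show ?thesis
      unfolding cocycle_def kw sw sk using n0 by (simp add: G(1) tau_mat2 hilbert_sq)
  qed
  show "cocycle p (mat2 0 1 (- 1) 0) k = 1"
  proof -
    have wk: "mat2 0 1 (- 1) 0 ** k = mat2 c d (- a) (- b)" by (simp add: G(1) mat2_mult)
    have "s_sign p (mat2 c d (- a) (- b)) = 1" using G by (intro s_sign_unit_c) simp
    moreover have "hilbert a (- (a * c)) = hilbert c d" if "c \<noteq> 0"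
      using hilbert_neg_mult[OF n0(1), of c] hilbert_commute[of a c] hilbert_inverse_unit[OF G(5,7) that] by simp
    moreover have "hilbert a (- (a * d)) = 1" using G by (intro hilbert_units) (simp_all add: absp_mult)
    ultimately show ?thesis
      unfolding cocycle_def wk sw sk using n0 by (simp add: G(1) tau_mat2 hilbert_sq)
  qed
qed

text \<open>The cocycle formula is symmetric in two commuting matrices. Thus the lift of - 1 is
  central in the cover, which later forces mu(-1) = eta(-1).\<close>

lemma cocycle_minus_1: "cocycle p (mat2 (- 1) 0 0 (- 1)) A = cocycle p (A :: 'a^2^2) (mat2 (- 1) 0 0 (- 1))"
proof -
  have "mat2 (- 1) 0 0 (- 1) ** A = A ** mat2 (- 1) 0 0 (- 1)"
    by (cases A rule: mat2_cases) (simp add: mat2_mult)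
  then show ?thesis unfolding cocycle_def by (simp add: hilbert_commute mult_ac)
qed

end

subsection \<open>Haar measure\<close>

text \<open>Integrals in this development are finite sums over cosets, both for step functions on
  the field and for Hecke functions on the cover.\<close>

lemma has_bochner_integral_finite_partition:
  fixes c :: "'i \<Rightarrow> 'b::{banach, second_countable_topology}"
  assumes I: "finite I" "disjoint_family_on A I"
    and A: "\<And>i. i \<in> I \<Longrightarrow> A i \<in> sets M" "\<And>i. i \<in> I \<Longrightarrow> emeasure M (A i) < \<infinity>"
    and f: "\<And>i x. i \<in> I \<Longrightarrow> x \<in> A i \<Longrightarrow> f x = c i" "\<And>x. x \<in> space M \<Longrightarrow> x \<notin> (\<Union>i\<in>I. A i) \<Longrightarrow> f x = 0"
  shows "has_bochner_integral M f (\<Sum>i\<in>I. measure M (A i) *\<^sub>R c i)"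
proof -
  have "has_bochner_integral M (\<lambda>x. \<Sum>i\<in>I. indicator (A i) x *\<^sub>R c i) (\<Sum>i\<in>I. measure M (A i) *\<^sub>R c i)"
    by (intro has_bochner_integral_sum has_bochner_integral_indicator A)
  moreover have "f x = (\<Sum>i\<in>I. indicator (A i) x *\<^sub>R c i)" if x: "x \<in> space M" for x
  proof (cases "x \<in> (\<Union>i\<in>I. A i)")
    case True
    then obtain i where i: "i \<in> I" "x \<in> A i" by blast
    have "(\<Sum>j\<in>I. indicator (A j) x *\<^sub>R c j) = (\<Sum>j\<in>I. if j = i then c i else 0)"
    proof (rule sum.cong)
      fix j assume j: "j \<in> I"
      show "indicator (A j) x *\<^sub>R c j = (if j = i then c i else 0)"
      proof (cases "j = i")
        case False
        then have "x \<notin> A j" using I(2) i j unfolding disjoint_family_on_def by blast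
        then show ?thesis using False by simp
      qed (use i in simp)
    qed simp
    then show ?thesis using f(1)[OF i] i I by (simp add: sum.delta)
  next
    case False
    then show ?thesis using f(2)[OF x False] by (simp add: indicator_def)
  qed
  ultimately show ?thesis by (subst has_bochner_integral_cong[OF refl]) auto
qed

section \<open>Fractional ideals, their cosets and Schwartz functions\<close>

context padic
begin

text \<open>The fractional ideal of elements of valuation at least \<open>n\<close>: larger indices
  are smaller balls.\<close>

definition pball :: "int \<Rightarrow> 'a set" where
  "pball n = {x. absp x \<le> real p powi (- n)}"

lemma pball_iff: "x \<in> pball n \<longleftrightarrow> absp x \<le> real p powi (- n)"
  by (simp add: pball_def)

lemma pball_0_iff: "x \<in> pball 0 \<longleftrightarrow> absp x \<le> 1"
  by (simp add: pball_def)

lemma zero_in_pball [simp]: "0 \<in> pball n"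
  using powi_pos[of "- n"] by (simp add: pball_iff del: zero_less_power_int)

lemma pball_add: "x \<in> pball n \<Longrightarrow> y \<in> pball n \<Longrightarrow> x + y \<in> pball n"
  unfolding pball_iff by (rule absp_add_le)

lemma pball_diff: "x \<in> pball n \<Longrightarrow> y \<in> pball n \<Longrightarrow> x - y \<in> pball n"
  unfolding pball_iff by (rule absp_diff_le)

lemma pball_minus_iff [simp]: "- x \<in> pball n \<longleftrightarrow> x \<in> pball n"
  by (simp add: pball_iff)

lemma pball_add_cancel: "x \<in> pball n \<Longrightarrow> y + x \<in> pball n \<longleftrightarrow> y \<in> pball n"
  using pball_add[of y n x] pball_diff[of "y + x" n x] by auto

lemma pball_mono: "m \<le> n \<Longrightarrow> x \<in> pball n \<Longrightarrow> x \<in> pball m"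
  unfolding pball_iff using powi_le_iff[of "- n" "- m"] by linarith

lemma pball_mult:
  assumes "x \<in> pball m" "y \<in> pball n" shows "x * y \<in> pball (m + n)"
proof -
  have "absp x * absp y \<le> real p powi (- m) * real p powi (- n)"
    using assms unfolding pball_iff by (intro mult_mono) auto
  then show ?thesis using powi_add[of "- m" "- n"] by (simp add: pball_iff absp_mult)
qed

lemma p_powi_in_pball: "(of_nat p :: 'a) powi n \<in> pball n"
  by (simp add: pball_iff absp_p_powi)

lemma p_powi_cancel [simp]:
  "of_nat p powi n * (inverse (of_nat p powi n) * x) = (x :: 'a)"
  "inverse (of_nat p powi n) * (of_nat p powi n * x) = (x :: 'a)"
  by (simp_all flip: mult.assoc)

lemma mult_p_powi_in_pball_iff: "of_nat p powi n * x \<in> pball (m + n) \<longleftrightarrow> x \<in> pball m"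
proof
  assume "of_nat p powi n * x \<in> pball (m + n)"
  from pball_mult[OF p_powi_in_pball[of "- n"] this] show "x \<in> pball m"
    by (simp add: power_int_minus)
next
  assume "x \<in> pball m"
  from pball_mult[OF p_powi_in_pball[of n] this] show "of_nat p powi n * x \<in> pball (m + n)"
    by (simp add: add.commute)
qed

lemma mult_in_pball_iff:
  assumes "absp a = real p powi (- k)"
  shows "a * x \<in> pball n \<longleftrightarrow> x \<in> pball (n - k)"
proof -
  have "real p powi (- k) * absp x \<le> real p powi (- n) \<longleftrightarrow> absp x \<le> real p powi (- (n - k))"
    using powi_add[of "- k" "- (n - k)"] powi_pos[of "- k"] mult_le_cancel_left_pos by simp
  then show ?thesis using assms by (simp add: pball_iff absp_mult)
qed

lemma in_pball_large: obtains n where "x \<in> pball n"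
proof (cases "x = 0")
  case True then show ?thesis using that by simp
next
  case False
  then obtain k where "absp x = real p powi k" by (rule absp_value)
  then have "x \<in> pball (- k)" by (simp add: pball_iff)
  then show ?thesis by (rule that)
qed

lemma ball_subset_pball:
  assumes "x \<in> pball n" shows "ball x (real p powi (- n)) \<subseteq> pball n"
proof
  fix y assume "y \<in> ball x (real p powi (- n))"
  then have "y - x \<in> pball n" by (simp add: dist_absp pball_iff absp_diff_commute)
  then show "y \<in> pball n" using pball_add[OF _ assms, of "y - x"] by simp
qed

lemma open_pball: "open (pball n)"
  unfolding open_contains_ball using ball_subset_pball powi_pos by blast

lemma pball_cball: "pball n = cball 0 (real p powi (- n))"
  by (auto simp: pball_iff dist_absp)

lemma closed_pball: "closed (pball n)"
  unfolding pball_cball by (rule closed_cball)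

text \<open>For 0 \<le> j < p^m these elements represent \<open>pball N\<close> modulo
  \<open>pball (N + int m)\<close>.\<close>

definition rep :: "int \<Rightarrow> int \<Rightarrow> 'a" where
  "rep N j = of_nat p powi N * of_int j"

lemma rep_in_pball: "rep N j \<in> pball N"
  using mult_p_powi_in_pball_iff[of N "of_int j" 0] absp_of_int_le[of j] by (simp add: rep_def pball_0_iff)

lemma rep_diff_in_pball_iff:
  "rep N i - rep N j \<in> pball (N + int m) \<longleftrightarrow> [i = j] (mod int p ^ m)"
proof -
  have "rep N i - rep N j \<in> pball (N + int m) \<longleftrightarrow> of_nat p powi N * (of_int i - of_int j) \<in> pball (int m + N)"
    by (simp add: rep_def algebra_simps)
  also have "\<dots> \<longleftrightarrow> absp (of_int i - of_int j :: 'a) \<le> 1 / real p ^ m"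
    unfolding mult_p_powi_in_pball_iff by (simp add: pball_iff power_int_minus inverse_eq_divide)
  also have "\<dots> \<longleftrightarrow> [i = j] (mod int p ^ m)" by (rule of_int_close_iff)
  finally show ?thesis .
qed

lemma rep_ex:
  assumes "x \<in> pball N"
  obtains j where "0 \<le> j" "j < int p ^ m" "x - rep N j \<in> pball (N + int m)"
proof -
  have "of_nat p powi (- N) * x \<in> pball 0"
    using mult_p_powi_in_pball_iff[of "- N" x N] assms by simp
  then obtain j where j: "0 \<le> j" "j < int p ^ m" "absp (of_nat p powi (- N) * x - of_int j) \<le> 1 / real p ^ m"
    unfolding pball_0_iff by (rule Zp_int_close)
  have "of_nat p powi N * (of_nat p powi (- N) * x - of_int j) \<in> pball (int m + N)"
    unfolding mult_p_powi_in_pball_iff using j(3) by (simp add: pball_iff power_int_minus inverse_eq_divide)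
  then have "x - rep N j \<in> pball (N + int m)"
    by (simp add: rep_def right_diff_distrib power_int_minus add.commute)
  then show ?thesis using that j by blast
qed

definition coset :: "'a \<Rightarrow> int \<Rightarrow> 'a set" where
  "coset r n = {x. x - r \<in> pball n}"

lemma coset_image: "coset r n = (+) r ` pball n"
proof
  show "coset r n \<subseteq> (+) r ` pball n"
    by (rule subsetI, rule image_eqI[where x = "_ - r"]) (auto simp: coset_def)
qed (auto simp: coset_def)

lemma open_coset: "open (coset r n)"
  unfolding open_contains_ball
proof
  fix x assume x: "x \<in> coset r n"
  have "ball x (real p powi (- n)) \<subseteq> coset r n"
  proof
    fix y assume "y \<in> ball x (real p powi (- n))"
    then have "y - x \<in> pball n" by (simp add: dist_absp pball_iff absp_diff_commute)
    then have "(y - x) + (x - r) \<in> pball n" using x by (intro pball_add) (simp_all add: coset_def)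
    then show "y \<in> coset r n" by (simp add: coset_def)
  qed
  then show "\<exists>e>0. ball x e \<subseteq> coset r n" using powi_pos by blast
qed

lemma disjoint_coset_rep: "disjoint_family_on (\<lambda>j. coset (rep N j) (N + int m)) {0..<int p ^ m}"
  unfolding disjoint_family_on_def
proof (intro ballI impI)
  fix i j assume ij: "i \<in> {0..<int p ^ m}" "j \<in> {0..<int p ^ m}" "i \<noteq> j"
  show "coset (rep N i) (N + int m) \<inter> coset (rep N j) (N + int m) = {}"
  proof (rule ccontr)
    assume "\<not> ?thesis"
    then obtain x where "x - rep N i \<in> pball (N + int m)" "x - rep N j \<in> pball (N + int m)"
      by (auto simp: coset_def)
    from pball_diff[OF this(2,1)] have "[i = j] (mod int p ^ m)" by (simp add: rep_diff_in_pball_iff)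
    then show False using ij by (simp add: cong_def)
  qed
qed

lemma pball_eq_cosets: "pball N = (\<Union>j\<in>{0..<int p ^ m}. coset (rep N j) (N + int m))"
proof (intro equalityI subsetI)
  fix x assume "x \<in> pball N"
  then obtain j where "0 \<le> j" "j < int p ^ m" "x - rep N j \<in> pball (N + int m)" by (rule rep_ex)
  then show "x \<in> (\<Union>j\<in>{0..<int p ^ m}. coset (rep N j) (N + int m))" by (auto simp: coset_def)
next
  fix x assume "x \<in> (\<Union>j\<in>{0..<int p ^ m}. coset (rep N j) (N + int m))"
  then obtain j where "x - rep N j \<in> pball (N + int m)" by (auto simp: coset_def)
  then have "x - rep N j \<in> pball N" by (rule pball_mono[rotated]) simp
  from pball_add[OF this rep_in_pball[of N j]] show "x \<in> pball N" by simp
qed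

lemma pball_small:
  assumes "e > 0" obtains m :: nat where "real p powi (- (N + int m)) < e"
proof -
  have "1 / real p < 1" using p_gt_1 by simp
  moreover have "e / real p powi (- N) > 0" using assms powi_pos by (intro divide_pos_pos)
  ultimately obtain m where m: "(1 / real p) ^ m < e / real p powi (- N)"
    using real_arch_pow_inv by blast
  have "real p powi (- (N + int m)) = real p powi (- N) * (1 / real p) ^ m"
    using powi_add[of "- N" "- int m"] by (simp add: power_int_minus power_divide inverse_eq_divide)
  also have "\<dots> < e" using m powi_pos[of "- N"] by (simp add: pos_less_divide_eq mult.commute)
  finally show ?thesis by (rule that)
qed

lemma compact_pball: "compact (pball N)"
  unfolding compact_eq_totally_bounded
proof (intro conjI allI impI)
  show "complete (pball N)" unfolding complete_eq_closed by (rule closed_pball)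
  fix e :: real assume "e > 0"
  then obtain m :: nat where m: "real p powi (- (N + int m)) < e" by (rule pball_small)
  have "pball N \<subseteq> (\<Union>x\<in>rep N ` {0..<int p ^ m}. ball x e)"
  proof
    fix x assume "x \<in> pball N"
    then obtain j where j: "0 \<le> j" "j < int p ^ m" "x - rep N j \<in> pball (N + int m)" by (rule rep_ex)
    then have "x \<in> ball (rep N j) e" using m by (simp add: pball_iff dist_absp absp_diff_commute)
    then show "x \<in> (\<Union>x\<in>rep N ` {0..<int p ^ m}. ball x e)" using j by auto
  qed
  then show "\<exists>k. finite k \<and> pball N \<subseteq> (\<Union>x\<in>k. ball x e)" by (intro exI[of _ "rep N ` {0..<int p ^ m}"]) simp
qed

text \<open>Compactness makes local constancy uniform: a Lebesgue number for the cover of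
  \<open>pball N\<close> by open sets of constancy yields one ball of periods. Outside
  \<open>pball N\<close> a small translation stays outside, where the function is 0.\<close>

lemma schwartzE:
  assumes "\<phi> \<in> schwartz"
  obtains N n0 where "\<And>x. x \<notin> pball N \<Longrightarrow> \<phi> x = 0"
    "\<And>n x h. n0 \<le> n \<Longrightarrow> h \<in> pball n \<Longrightarrow> \<phi> (x + h) = \<phi> (x :: 'a)"
proof -
  have lc: "\<exists>U. open U \<and> x \<in> U \<and> (\<forall>y\<in>U. \<phi> y = \<phi> x)" for x
    using assms by (simp add: schwartz_def)
  have cp: "compact (closure {x. \<phi> x \<noteq> 0})" using assms by (simp add: schwartz_def)
  obtain r where r: "\<And>x. \<phi> x \<noteq> 0 \<Longrightarrow> absp x \<le> r"
  proof -
    have "bounded {x. \<phi> x \<noteq> 0}" using compact_imp_bounded[OF cp] bounded_subset closure_subset by blast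
    then obtain e where "\<forall>y\<in>{x. \<phi> x \<noteq> 0}. dist 0 y \<le> e" unfolding bounded_any_center[where a = 0] by blast
    then show ?thesis using that[of e] by (simp add: dist_absp)
  qed
  obtain N where N: "\<And>x. x \<notin> pball N \<Longrightarrow> \<phi> x = 0"
  proof -
    obtain n :: nat where n: "r < real p ^ n" using real_arch_pow[of "real p" r] p_gt_1 by auto
    have "\<phi> x = 0" if "x \<notin> pball (- int n)" for x
    proof (rule ccontr)
      assume "\<phi> x \<noteq> 0"
      from r[OF this] n have "x \<in> pball (- int n)" by (simp add: pball_iff)
      then show False using that by blast
    qed
    then show ?thesis using that by blast
  qed
  define G where "G = {U. open U \<and> (\<exists>x\<in>U. \<forall>y\<in>U. \<phi> y = \<phi> x)}"
  have "pball N \<subseteq> \<Union>G" using lc unfolding G_def by blast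
  then obtain e where e: "0 < e" "\<And>x. x \<in> pball N \<Longrightarrow> \<exists>U\<in>G. ball x e \<subseteq> U"
    by (rule Heine_Borel_lemma[OF compact_pball]) (auto simp: G_def)
  obtain m :: nat where m: "real p powi (- (N + int m)) < e" using e(1) by (rule pball_small)
  have "\<phi> (x + h) = \<phi> x" if nh: "N + int m \<le> n" "h \<in> pball n" for n x h
  proof (cases "x \<in> pball N")
    case True
    then obtain U where U: "U \<in> G" "ball x e \<subseteq> U" using e(2) by blast
    have "h \<in> pball (N + int m)" using nh by (rule pball_mono)
    then have "x + h \<in> ball x e" using m by (simp add: dist_absp pball_iff)
    moreover have "x \<in> ball x e" using e by simp
    ultimately have xU: "x + h \<in> U" "x \<in> U" using U(2) by blast+
    obtain y where "\<forall>z\<in>U. \<phi> z = \<phi> y" using U(1) unfolding G_def by blast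
    then show ?thesis using xU by simp
  next
    case False
    have "h \<in> pball N" using nh(2) by (rule pball_mono[rotated]) (use nh in simp)
    then have "x + h \<notin> pball N" using False pball_add_cancel by blast
    then show ?thesis using False N by simp
  qed
  then show ?thesis using that[of N "N + int m"] N by blast
qed

lemma indicator_coset_schwartz: "(indicator (coset r n) :: 'a \<Rightarrow> complex) \<in> schwartz"
proof -
  have op: "open (- coset r n)"
    unfolding open_contains_ball
  proof
    fix x assume x: "x \<in> - coset r n"
    have "ball x (real p powi (- n)) \<subseteq> - coset r n"
    proof
      fix y assume "y \<in> ball x (real p powi (- n))"
      then have "x - y \<in> pball n" by (simp add: dist_absp pball_iff)
      then have "y \<in> coset r n \<Longrightarrow> (x - y) + (y - r) \<in> pball n" by (intro pball_add) (simp_all add: coset_def)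
      then show "y \<in> - coset r n" using x by (auto simp: coset_def)
    qed
    then show "\<exists>e>0. ball x e \<subseteq> - coset r n" using powi_pos by blast
  qed
  have "coset r n = (+) r ` pball n" by (rule coset_image)
  moreover have "continuous_on (pball n) ((+) r)"
    unfolding continuous_on_iff by (auto simp: dist_absp)
  ultimately have "compact (coset r n)" using compact_continuous_image compact_pball by metis
  moreover have "{x. (indicator (coset r n) x :: complex) \<noteq> 0} = coset r n" by (auto simp: indicator_def)
  moreover have "closure (coset r n) = coset r n" using op by (simp add: closed_def)
  ultimately have "compact (closure {x. (indicator (coset r n) x :: complex) \<noteq> 0})" by simp
  moreover have "\<exists>U. open U \<and> x \<in> U \<and> (\<forall>y\<in>U. (indicator (coset r n) y :: complex) = indicator (coset r n) x)" for x
  proof (cases "x \<in> coset r n")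
    case True
    then show ?thesis using open_coset by (intro exI[of _ "coset r n"]) auto
  next
    case False
    then show ?thesis using op by (intro exI[of _ "- coset r n"]) auto
  qed
  ultimately show ?thesis by (simp add: schwartz_def)
qed

end

text \<open>The requirements survive positive rescaling, because the definition of the Weil index
  passes to a multiple of the given measure.\<close>

locale padic_haar = padic p ty for p and ty :: "'a::{field_char_0,complete_space} itself" +
  fixes M :: "'a measure"
  assumes sets_M: "sets M = sets borel"
    and emeasure_translate: "\<And>a S. S \<in> sets borel \<Longrightarrow> emeasure M ((+) a ` S) = emeasure M S"
    and emeasure_pball_0: "emeasure M (pball 0) \<noteq> 0" "emeasure M (pball 0) \<noteq> \<infinity>"
begin

lemma space_M [simp]: "space M = UNIV"
  using sets_eq_imp_space_eq[OF sets_M] by simp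

lemma coset_in_sets [simp]: "coset r n \<in> sets M"
  using open_coset sets_M by auto

lemma pball_coset: "pball n = coset 0 n"
  by (simp add: coset_def)

lemma pball_in_sets [simp]: "pball n \<in> sets M"
  unfolding pball_coset by simp

lemma emeasure_coset: "emeasure M (coset r n) = emeasure M (pball n)"
  unfolding coset_image using pball_in_sets sets_M by (intro emeasure_translate) simp

lemma emeasure_pball_split: "emeasure M (pball N) = ennreal (real p ^ m) * emeasure M (pball (N + int m))"
proof -
  have "emeasure M (pball N) = (\<Sum>j\<in>{0..<int p ^ m}. emeasure M (coset (rep N j) (N + int m)))"
    unfolding pball_eq_cosets[of N m] by (intro sum_emeasure[symmetric] disjoint_coset_rep) auto
  also have "\<dots> = of_nat (p ^ m) * emeasure M (pball (N + int m))" by (simp add: emeasure_coset nat_power_eq)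
  also have "(of_nat (p ^ m) :: ennreal) = ennreal (real p ^ m)"
    unfolding ennreal_of_nat_eq_real_of_nat by simp
  finally show ?thesis .
qed

text \<open>Enlarging the unit ball by \<open>k\<close> digits multiplies its measure by p^k, so the
  large balls are finite, and every ball lies in one of them.\<close>

lemma emeasure_pball_finite: "emeasure M (pball n) < \<infinity>"
proof -
  have "emeasure M (pball (- int k)) < \<infinity>" for k
    using emeasure_pball_split[of "- int k" k] emeasure_pball_0(2)
    by (simp add: ennreal_mult_less_top less_top)
  moreover have "emeasure M (pball n) \<le> emeasure M (pball (- int (nat (- n))))"
  proof (intro emeasure_mono subsetI)
    fix x assume x: "x \<in> pball n"
    show "x \<in> pball (- int (nat (- n)))" by (rule pball_mono[OF _ x]) linarith
  qed simp
  ultimately show ?thesis using order_le_less_trans by blast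
qed

definition V :: real where "V = measure M (pball 0)"

lemma V_pos: "V > 0"
  unfolding V_def using emeasure_pball_0 emeasure_pball_finite[of 0]
  by (simp add: measure_def enn2real_positive_iff zero_less_iff_neq_zero)

lemma measure_pball_split: "measure M (pball N) = real p ^ m * measure M (pball (N + int m))"
  unfolding measure_def emeasure_pball_split[of N m] by (simp add: enn2real_mult)

lemma measure_pball: "measure M (pball n) = V * real p powi (- n)"
proof (cases "0 \<le> n")
  case True
  then obtain k where k: "n = int k" using nonneg_int_cases by blast
  have "V = real p ^ k * measure M (pball n)" using measure_pball_split[of 0 k] by (simp add: V_def k)
  then show ?thesis by (simp add: k power_int_minus)
next
  case False
  then have "0 \<le> - n" by simp
  then obtain k where k: "- n = int k" using nonneg_int_cases by blast
  then have "n + int k = 0" by simp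
  then have "measure M (pball n) = real p ^ k * V" using measure_pball_split[of n k] by (simp add: V_def)
  then show ?thesis by (simp add: k)
qed

lemma measure_coset: "measure M (coset r n) = V * real p powi (- n)"
  using measure_pball by (simp add: measure_def emeasure_coset)

lemma emeasure_coset_finite: "emeasure M (coset r n) < \<infinity>"
  unfolding emeasure_coset by (rule emeasure_pball_finite)

lemma has_integral_step:
  fixes f :: "'a \<Rightarrow> complex"
  assumes supp: "\<And>x. x \<notin> pball N \<Longrightarrow> f x = 0"
    and const: "\<And>x h. x \<in> pball N \<Longrightarrow> h \<in> pball (N + int m) \<Longrightarrow> f (x + h) = f x"
  shows "has_bochner_integral M f (of_real (V * real p powi (- (N + int m))) * (\<Sum>j\<in>{0..<int p ^ m}. f (rep N j)))"
proof -
  have "has_bochner_integral M f (\<Sum>j\<in>{0..<int p ^ m}. measure M (coset (rep N j) (N + int m)) *\<^sub>R f (rep N j))"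
  proof (rule has_bochner_integral_finite_partition)
    show "emeasure M (coset (rep N j) (N + int m)) < \<infinity>" for j by (rule emeasure_coset_finite)
    show "f x = f (rep N j)" if "x \<in> coset (rep N j) (N + int m)" for j x
      using const[OF rep_in_pball[of N j], of "x - rep N j"] that by (simp add: coset_def)
    show "f x = 0" if "x \<notin> (\<Union>j\<in>{0..<int p ^ m}. coset (rep N j) (N + int m))" for x
      using that supp unfolding pball_eq_cosets[of N m, symmetric] by blast
  qed (simp_all add: disjoint_coset_rep)
  then show ?thesis by (simp add: measure_coset scaleR_conv_of_real sum_distrib_left)
qed

lemma translate_measurable: "(\<lambda>x. a + x) \<in> measurable borel (borel :: 'a measure)"
proof (rule borel_measurable_continuous_onI)
  show "continuous_on UNIV ((+) a)" unfolding continuous_on_iff by (auto simp: dist_absp)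
qed

lemma distr_translate: "distr M borel ((+) a) = M"
proof (rule measure_eqI)
  fix S assume "S \<in> sets (distr M borel ((+) a))"
  then have S: "S \<in> sets borel" by simp
  have m: "(+) a \<in> measurable M borel" using translate_measurable measurable_cong_sets[OF sets_M] by blast
  have "(+) a -` S = (+) (- a) ` S"
  proof (intro equalityI subsetI)
    fix x assume "x \<in> (+) a -` S"
    then show "x \<in> (+) (- a) ` S" by (intro image_eqI[of _ _ "a + x"]) auto
  qed auto
  then show "emeasure (distr M borel ((+) a)) S = emeasure M S"
    using emeasure_distr[OF m S] emeasure_translate[OF S, of "- a"] by (simp only: space_M Int_UNIV_right)
qed (simp add: sets_M)

lemma integral_translate:
  fixes f :: "'a \<Rightarrow> complex"
  assumes "f \<in> borel_measurable borel"
  shows "(LINT x|M. f (a + x)) = (LINT x|M. f x)"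
proof -
  have "(+) a \<in> measurable M borel" using translate_measurable measurable_cong_sets[OF sets_M] by blast
  from integral_distr[OF this assms] show ?thesis by (simp add: distr_translate)
qed

end

subsection \<open>Fourier transform of step functions\<close>

lemma sum_int_atLeastLessThan: "(\<Sum>j\<in>{0..<int n}. g j) = (\<Sum>j<n. g (int j))"
  by (rule sum.reindex_bij_witness[of _ int nat]) auto

context padic
begin

text \<open>Schwartz functions in quantitative form, with support and periods controlled by explicit
  balls.\<close>

definition step :: "('a \<Rightarrow> complex) \<Rightarrow> bool" where
  "step f \<longleftrightarrow> (\<exists>N. \<forall>x. x \<notin> pball N \<longrightarrow> f x = 0) \<and> (\<exists>n. \<forall>x. \<forall>h\<in>pball n. f (x + h) = f x)"

text \<open>Constancy that is uniform on each ball only. This suffices for products with a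
  \<open>step\<close> function and includes characters of second degree, whose radius of constancy
  shrinks at infinity.\<close>

definition locally_const :: "('a \<Rightarrow> complex) \<Rightarrow> bool" where
  "locally_const g \<longleftrightarrow> (\<forall>N. \<exists>n. \<forall>x\<in>pball N. \<forall>h\<in>pball n. g (x + h) = g x)"

lemma step_mult:
  assumes "step f" "locally_const g" shows "step (\<lambda>x. f x * g x)"
proof -
  obtain N n where N: "\<And>x. x \<notin> pball N \<Longrightarrow> f x = 0" and n: "\<And>x h. h \<in> pball n \<Longrightarrow> f (x + h) = f x"
    using assms(1) unfolding step_def by blast
  obtain n' where n': "\<And>x h. x \<in> pball N \<Longrightarrow> h \<in> pball n' \<Longrightarrow> g (x + h) = g x"
    using assms(2) unfolding locally_const_def by blast
  have "f (x + h) * g (x + h) = f x * g x" if h: "h \<in> pball (max n n')" for x h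
  proof (cases "x \<in> pball N")
    case True
    have "h \<in> pball n" "h \<in> pball n'" using h by (auto intro: pball_mono[rotated])
    then show ?thesis using True n n' by simp
  next
    case False
    have "h \<in> pball n" using h by (auto intro: pball_mono[rotated])
    then have "f (x + h) = f x" by (rule n)
    then show ?thesis using N[OF False] by simp
  qed
  then show ?thesis unfolding step_def using N by (metis mult_zero_left)
qed

lemma step_indicator_pball: "step (indicator (pball n))"
  unfolding step_def using pball_add_cancel by (auto simp: indicator_def)

lemma step_indicator_coset: "step (indicator (coset r n))"
proof -
  have "x + h \<in> coset r n \<longleftrightarrow> x \<in> coset r n" if "h \<in> pball n" for x h
    using pball_add_cancel[OF that, of "x - r"] by (simp add: coset_def algebra_simps)
  moreover obtain m where "r \<in> pball m" by (rule in_pball_large)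
  have "x \<in> pball (min m n)" if "x \<in> coset r n" for x
  proof -
    have "x - r \<in> pball (min m n)" "r \<in> pball (min m n)"
      using that \<open>r \<in> pball m\<close> by (auto simp: coset_def intro: pball_mono[rotated])
    from pball_add[OF this] show ?thesis by simp
  qed
  ultimately show ?thesis unfolding step_def by (auto simp: indicator_def)
qed

lemma step_measurable:
  assumes "step f" shows "f \<in> borel_measurable borel"
proof -
  obtain n where n: "\<And>x h. h \<in> pball n \<Longrightarrow> f (x + h) = f x"
    using assms unfolding step_def by blast
  have "continuous_on UNIV f"
    unfolding continuous_on_iff
  proof (intro ballI allI impI)
    fix x :: 'a and e :: real assume "e > 0"
    have "f y = f x" if "dist y x < real p powi (- n)" for y
      using n[of "y - x" x] that by (simp add: dist_absp pball_iff)
    then show "\<exists>d>0. \<forall>y\<in>UNIV. dist y x < d \<longrightarrow> dist (f y) (f x) < e"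
      using \<open>e > 0\<close> powi_pos by (metis dist_self)
  qed
  then show ?thesis by (rule borel_measurable_continuous_onI)
qed

end

context padic_haar
begin

lemma step_integrable:
  assumes "step f" shows "integrable M f"
proof -
  obtain N n where N: "\<And>x. x \<notin> pball N \<Longrightarrow> f x = 0" and n: "\<And>x h. h \<in> pball n \<Longrightarrow> f (x + h) = f x"
    using assms unfolding step_def by blast
  have "has_bochner_integral M f (of_real (V * real p powi (- (N + int (nat (n - N))))) *
      (\<Sum>j\<in>{0..<int p ^ nat (n - N)}. f (rep N j)))"
    by (rule has_integral_step[OF N]) (auto intro!: n intro: pball_mono[rotated])
  then show ?thesis by (rule integrable.intros)
qed

end

section \<open>Additive characters and Fourier inversion\<close>

locale padic_char = padic_haar p ty M for p and ty :: "'a::{field_char_0,complete_space} itself" and M +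
  fixes \<xi> :: "'a \<Rightarrow> complex" and k :: int
  assumes char_add: "\<xi> (x + y) = \<xi> x * \<xi> y" and norm_char: "norm (\<xi> x) = 1"
    and conductor: "(\<forall>x\<in>pball q. \<xi> x = 1) \<longleftrightarrow> k \<le> q"
begin

lemma char_nonzero [simp]: "\<xi> x \<noteq> 0"
  using norm_char[of x] by auto

lemma char_0 [simp]: "\<xi> 0 = 1"
  using char_add[of 0 0] by simp

lemma char_of_nat_mult: "\<xi> (of_nat n * x) = \<xi> x ^ n"
  by (induction n) (simp_all add: char_add distrib_right)

lemma char_pball: "x \<in> pball k \<Longrightarrow> \<xi> x = 1"
  using conductor[of k] by simp

text \<open>The conductor only promises some element of \<open>pball (k - 1)\<close> with nontrivial
  value. Modulo \<open>pball k\<close> every such element is an integer multiple of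
  \<open>t\<close>, so triviality at \<open>t\<close> would spread to all of them.\<close>

lemma char_nontrivial:
  assumes "absp t = real p powi (- (k - 1))" shows "\<xi> t \<noteq> 1"
proof
  assume t: "\<xi> t = 1"
  have t0: "t \<noteq> 0"
  proof
    assume "t = 0"
    then show False using assms powi_pos[of "- (k - 1)"] by (simp del: zero_less_power_int)
  qed
  have "\<xi> x = 1" if x: "x \<in> pball (k - 1)" for x
  proof -
    have "t * (x / t) \<in> pball (k - 1)" using x t0 by simp
    then have "x / t \<in> pball 0" using mult_in_pball_iff[OF assms, of "x / t" "k - 1"] by simp
    then obtain j where j: "0 \<le> j" "j < int p ^ 1" "x / t - rep 0 j \<in> pball (0 + int 1)" by (rule rep_ex)
    have "t * (x / t - rep 0 j) \<in> pball k" using j(3) by (simp add: mult_in_pball_iff[OF assms])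
    then have "\<xi> (x - of_nat (nat j) * t) = 1" using t0 j(1) by (intro char_pball) (simp add: rep_def algebra_simps)
    moreover have "\<xi> x = \<xi> (x - of_nat (nat j) * t) * \<xi> (of_nat (nat j) * t)" by (simp flip: char_add)
    ultimately show ?thesis using t by (simp add: char_of_nat_mult)
  qed
  then show False using conductor[of "k - 1"] by simp
qed

lemma char_sum_zero:
  assumes t: "absp t = real p powi (- (k - 1))"
  shows "(\<Sum>j<p. \<xi> (of_nat j * t)) = 0"
proof -
  have "of_nat p * t \<in> pball k"
    using t p_powi_in_pball[of 1] pball_mult[of "of_nat p" 1 t "k - 1"] by (simp add: pball_iff)
  then have "\<xi> t ^ p = 1" using char_pball char_of_nat_mult by metis
  then show ?thesis using char_nontrivial[OF t] by (simp add: char_of_nat_mult geometric_sum)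
qed

lemma locally_const_linear: "locally_const (\<lambda>x. \<xi> (x * y))"
  unfolding locally_const_def
proof
  fix N :: int
  obtain o' where y: "y \<in> pball o'" by (rule in_pball_large)
  have "\<xi> ((x + h) * y) = \<xi> (x * y)" if "h \<in> pball (k - o')" for x h
    using char_pball[of "h * y"] pball_mult[OF that y] by (simp add: distrib_right char_add)
  then show "\<exists>n. \<forall>x\<in>pball N. \<forall>h\<in>pball n. \<xi> ((x + h) * y) = \<xi> (x * y)" by blast
qed

lemma char_square_const:
  assumes "c \<in> pball s" "x \<in> pball N" "h \<in> pball n" "k \<le> s + N + n" "k \<le> s + 2 * n"
  shows "\<xi> (c * (x + h)\<^sup>2) = \<xi> (c * x\<^sup>2)"
proof -
  have "c * (x * h) \<in> pball (s + (N + n))" using assms by (intro pball_mult)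
  then have 1: "c * (x * h) \<in> pball k" by (rule pball_mono[rotated]) (use assms in simp)
  have "c * (h * h) \<in> pball (s + (n + n))" using assms by (intro pball_mult)
  then have 2: "c * (h * h) \<in> pball k" by (rule pball_mono[rotated]) (use assms in simp)
  have "c * (x + h)\<^sup>2 = c * x\<^sup>2 + (c * (x * h) + c * (x * h) + c * (h * h))"
    by (simp add: power2_eq_square algebra_simps)
  moreover have "\<xi> (c * (x * h) + c * (x * h) + c * (h * h)) = 1"
    using 1 2 by (intro char_pball pball_add)
  ultimately show ?thesis by (simp only: char_add mult_1_right)
qed

lemma locally_const_square: "locally_const (\<lambda>x. \<xi> (c * x\<^sup>2))"
  unfolding locally_const_def
proof
  fix N :: int
  obtain s where s: "c \<in> pball s" by (rule in_pball_large)
  define n where "n = max (k - s - N) (max (k - s) 0)"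
  have "k \<le> s + N + n" "k \<le> s + 2 * n" by (auto simp: n_def max_def)
  then show "\<exists>n. \<forall>x\<in>pball N. \<forall>h\<in>pball n. \<xi> (c * (x + h)\<^sup>2) = \<xi> (c * x\<^sup>2)"
    by (intro exI[of _ n] ballI char_square_const[OF s])
qed

text \<open>Orthogonality: if some \<open>z\<close> in the ball has
  \<open>\<xi> (z * y) \<noteq> 1\<close>, translation by \<open>z\<close> multiplies the integral
  by that value.\<close>

lemma char_integral_pball:
  "(LINT x|M. indicator (pball n) x * \<xi> (x * y)) = (if y \<in> pball (k - n) then of_real (V * real p powi (- n)) else 0)"
proof (cases "y \<in> pball (k - n)")
  case True
  have "indicator (pball n) x * \<xi> (x * y) = indicator (pball n) x *\<^sub>R 1" for x
    using char_pball[of "x * y"] pball_mult[OF _ True, of x n] by (auto simp: indicator_def)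
  then have "(LINT x|M. indicator (pball n) x * \<xi> (x * y)) = measure M (pball n) *\<^sub>R 1"
    by (simp only:) (intro has_bochner_integral_integral_eq has_bochner_integral_indicator pball_in_sets emeasure_pball_finite)
  then show ?thesis using True by (simp add: measure_pball scaleR_conv_of_real)
next
  case False
  then have "y \<noteq> 0" by auto
  then have ay: "absp y = real p powi (- ordp p y)" by (rule absp_ordp)
  have "\<not> k \<le> n + ordp p y" using False ay by (simp add: pball_iff powi_le_iff)
  then obtain w where w: "w \<in> pball (n + ordp p y)" "\<xi> w \<noteq> 1" using conductor by blast
  define z where "z = w / y"
  have z: "z \<in> pball n"
    using mult_in_pball_iff[OF ay, of z "n + ordp p y"] w \<open>y \<noteq> 0\<close> by (simp add: z_def)
  have zy: "z * y = w" using \<open>y \<noteq> 0\<close> by (simp add: z_def)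
  define f where "f x = indicator (pball n) x * \<xi> (x * y)" for x
  have "step f" unfolding f_def by (intro step_mult step_indicator_pball locally_const_linear)
  then have "(LINT x|M. f (z + x)) = (LINT x|M. f x)" by (intro integral_translate step_measurable)
  moreover have "f (z + x) = \<xi> w * f x" for x
    using pball_add_cancel[OF z, of x] by (simp add: f_def indicator_def add.commute[of z] distrib_right char_add zy)
  ultimately have "\<xi> w * (LINT x|M. f x) = (LINT x|M. f x)" by simp
  then have "(LINT x|M. f x) = 0" using w(2) by simp
  then show ?thesis using False by (simp add: f_def)
qed

lemma char_integral_coset:
  "(LINT x|M. indicator (coset r n) x * \<xi> (x * y)) =
    \<xi> (r * y) * (if y \<in> pball (k - n) then of_real (V * real p powi (- n)) else 0)"
proof -
  define f where "f x = indicator (coset r n) x * \<xi> (x * y)" for x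
  have "step f" unfolding f_def by (intro step_mult step_indicator_coset locally_const_linear)
  then have "(LINT x|M. f x) = (LINT x|M. f (r + x))" by (intro integral_translate[symmetric] step_measurable)
  also have "(\<lambda>x. f (r + x)) = (\<lambda>x. \<xi> (r * y) * (indicator (pball n) x * \<xi> (x * y)))"
  proof
    fix x
    have "indicator (coset r n) (r + x) = (indicator (pball n) x :: complex)"
      by (simp add: coset_def indicator_def)
    then show "f (r + x) = \<xi> (r * y) * (indicator (pball n) x * \<xi> (x * y))"
      by (simp add: f_def distrib_right char_add)
  qed
  also have "(LINT x|M. \<xi> (r * y) * (indicator (pball n) x * \<xi> (x * y))) =
      \<xi> (r * y) * (LINT x|M. indicator (pball n) x * \<xi> (x * y))" by (rule integral_mult_right_zero)
  finally show ?thesis by (simp add: f_def char_integral_pball)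
qed

lemma step_decompose:
  fixes f :: "'a \<Rightarrow> complex"
  assumes supp: "\<And>x. x \<notin> pball N \<Longrightarrow> f x = 0" and const: "\<And>x h. h \<in> pball (N + int m) \<Longrightarrow> f (x + h) = f x"
  shows "f x = (\<Sum>j\<in>{0..<int p ^ m}. f (rep N j) * indicator (coset (rep N j) (N + int m)) x)"
proof (cases "x \<in> pball N")
  case True
  then obtain i where i: "0 \<le> i" "i < int p ^ m" "x - rep N i \<in> pball (N + int m)" by (rule rep_ex)
  have "f (rep N j) * indicator (coset (rep N j) (N + int m)) x = (if j = i then f x else 0)"
    if j: "j \<in> {0..<int p ^ m}" for j
  proof (cases "j = i")
    case True
    then show ?thesis using const[OF i(3), of "rep N i"] i(3) by (simp add: coset_def)
  next
    case False
    then have "x \<notin> coset (rep N j) (N + int m)"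
      using disjoint_coset_rep[of N m] i j unfolding disjoint_family_on_def by (fastforce simp: coset_def)
    then show ?thesis using False by simp
  qed
  then show ?thesis using i by (simp add: sum.delta)
next
  case False
  then have "x \<notin> (\<Union>j\<in>{0..<int p ^ m}. coset (rep N j) (N + int m))" unfolding pball_eq_cosets[of N m, symmetric] .
  then have "indicator (coset (rep N j) (N + int m)) x = (0::complex)" if "j \<in> {0..<int p ^ m}" for j
    using that by (auto simp: indicator_def)
  then show ?thesis using supp[OF False] by simp
qed

lemma fourier_step:
  assumes supp: "\<And>x. x \<notin> pball N \<Longrightarrow> f x = 0" and const: "\<And>x h. h \<in> pball (N + int m) \<Longrightarrow> f (x + h) = f x"
  shows "fourier \<xi> M f y = (\<Sum>j\<in>{0..<int p ^ m}. f (rep N j) * of_real (V * real p powi (- (N + int m))) *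
    (indicator (pball (k - (N + int m))) y * \<xi> (y * rep N j)))"
proof -
  have "(\<lambda>x. f x * \<xi> (x * y)) =
      (\<lambda>x. \<Sum>j\<in>{0..<int p ^ m}. f (rep N j) * (indicator (coset (rep N j) (N + int m)) x * \<xi> (x * y)))"
  proof
    fix x
    have "f x = (\<Sum>j\<in>{0..<int p ^ m}. f (rep N j) * indicator (coset (rep N j) (N + int m)) x)"
      by (rule step_decompose[OF supp const])
    then show "f x * \<xi> (x * y) =
        (\<Sum>j\<in>{0..<int p ^ m}. f (rep N j) * (indicator (coset (rep N j) (N + int m)) x * \<xi> (x * y)))"
      by (simp only: sum_distrib_right mult.assoc)
  qed
  then have "fourier \<xi> M f y =
      (\<Sum>j\<in>{0..<int p ^ m}. LINT x|M. f (rep N j) * (indicator (coset (rep N j) (N + int m)) x * \<xi> (x * y)))"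
    unfolding fourier_def
    by (simp only:) (intro Bochner_Integration.integral_sum integrable_mult_right step_integrable step_mult
        step_indicator_coset locally_const_linear)
  also have "\<dots> = (\<Sum>j\<in>{0..<int p ^ m}. f (rep N j) * of_real (V * real p powi (- (N + int m))) *
    (indicator (pball (k - (N + int m))) y * \<xi> (y * rep N j)))"
    unfolding integral_mult_right_zero char_integral_coset
    by (intro sum.cong) (simp_all add: indicator_def mult_ac)
  finally show ?thesis .
qed

text \<open>Inversion up to the factor by which the measure fails to be self-dual. The volumes
  p^(-n) and p^(n-k) of a coset and of the dual ball combine to p^(-k), whatever the fineness
  \<open>n\<close>.\<close>

lemma fourier_fourier:
  assumes "f \<in> schwartz"
  shows "fourier \<xi> M (fourier \<xi> M f) x = of_real (V * V * real p powi (- k)) * f (- x)"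
proof -
  obtain N n0 where supp: "\<And>x. x \<notin> pball N \<Longrightarrow> f x = 0"
    and n0: "\<And>n x h. n0 \<le> n \<Longrightarrow> h \<in> pball n \<Longrightarrow> f (x + h) = f x"
    using assms by (rule schwartzE) blast
  define m where "m = nat (n0 - N)"
  define n where "n = N + int m"
  have "n0 \<le> n" by (simp add: n_def m_def)
  then have const: "\<And>x h. h \<in> pball (N + int m) \<Longrightarrow> f (x + h) = f x" using n0 by (simp add: n_def)
  let ?c = "complex_of_real (V * real p powi (- n))"
  let ?J = "{0..<int p ^ m}"
  have F: "fourier \<xi> M f = (\<lambda>y. \<Sum>j\<in>?J. f (rep N j) * ?c * (indicator (pball (k - n)) y * \<xi> (y * rep N j)))"
    unfolding n_def by (rule ext) (rule fourier_step[OF supp const])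
  have "(\<lambda>y. fourier \<xi> M f y * \<xi> (y * x)) =
      (\<lambda>y. \<Sum>j\<in>?J. f (rep N j) * ?c * (indicator (pball (k - n)) y * \<xi> (y * (rep N j + x))))"
    unfolding F by (simp add: sum_distrib_right distrib_left char_add mult.assoc)
  then have "fourier \<xi> M (fourier \<xi> M f) x =
      (\<Sum>j\<in>?J. LINT y|M. f (rep N j) * ?c * (indicator (pball (k - n)) y * \<xi> (y * (rep N j + x))))"
    unfolding fourier_def[of \<xi> M "fourier \<xi> M f"]
    by (simp only:) (intro Bochner_Integration.integral_sum integrable_mult_right step_integrable step_mult
        step_indicator_pball locally_const_linear)
  also have "\<dots> = (\<Sum>j\<in>?J. f (rep N j) * ?c *
      (if rep N j + x \<in> pball n then of_real (V * real p powi (- (k - n))) else 0))"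
    unfolding integral_mult_right_zero char_integral_pball by simp
  also have "\<dots> = (\<Sum>j\<in>?J. of_real (V * V * real p powi (- k)) * (f (rep N j) * indicator (coset (rep N j) n) (- x)))"
  proof (intro sum.cong refl)
    fix j
    have "- x - rep N j = - (rep N j + x)" by simp
    then have "rep N j + x \<in> pball n \<longleftrightarrow> - x \<in> coset (rep N j) n"
      unfolding coset_def mem_Collect_eq by (simp only: pball_minus_iff)
    moreover have "real p powi (- n) * real p powi (- (k - n)) = real p powi (- k)"
      using powi_add[of "- n" "- (k - n)"] by simp
    then have "?c * of_real (V * real p powi (- (k - n))) = of_real (V * V * real p powi (- k))"
      unfolding of_real_mult[symmetric] by (simp only: mult_ac)
    ultimately show "f (rep N j) * ?c * (if rep N j + x \<in> pball n then of_real (V * real p powi (- (k - n))) else 0) =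
        of_real (V * V * real p powi (- k)) * (f (rep N j) * indicator (coset (rep N j) n) (- x))"
      by (simp add: indicator_def mult.assoc)
  qed
  also have "\<dots> = of_real (V * V * real p powi (- k)) * f (- x)"
  proof -
    have d: "f (- x) = (\<Sum>j\<in>?J. f (rep N j) * indicator (coset (rep N j) n) (- x))"
      unfolding n_def by (rule step_decompose[OF supp const])
    show ?thesis by (subst d) (rule sum_distrib_left[symmetric])
  qed
  finally show ?thesis .
qed

text \<open>One value of one test function, the indicator of the unit ball at 0, already fixes the
  constant.\<close>

lemma self_dual_iff: "self_dual \<xi> M \<longleftrightarrow> V * V * real p powi (- k) = 1"
proof
  assume "self_dual \<xi> M"
  moreover have s: "(indicator (coset 0 0) :: 'a \<Rightarrow> complex) \<in> schwartz" by (rule indicator_coset_schwartz)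
  ultimately have "fourier \<xi> M (fourier \<xi> M (indicator (coset 0 0))) 0 = indicator (coset 0 0) (- 0)"
    unfolding self_dual_def by blast
  then have "complex_of_real (V * V * real p powi (- k)) = 1"
    unfolding fourier_fourier[OF s] by (simp add: coset_def)
  then show "V * V * real p powi (- k) = 1" by (simp only: of_real_eq_1_iff)
next
  assume "V * V * real p powi (- k) = 1"
  then show "self_dual \<xi> M" unfolding self_dual_def using fourier_fourier by simp
qed

text \<open>Truncation to \<open>pball q\<close> of the integral of the Gaussian
  \<open>\<xi> (- ((y / 2)\<^sup>2))\<close>, which does not converge absolutely; the truncations
  become constant as \<open>q\<close> tends to minus infinity.\<close>

definition gauss :: "int \<Rightarrow> complex" where
  "gauss q = (LINT y|M. indicator (pball q) y * \<xi> (- (1 / 4) * y\<^sup>2))"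

text \<open>Completing the square: \<open>r y - (y / 2)\<^sup>2 = r\<^sup>2 - (y / 2 - r)\<^sup>2\<close>.\<close>
lemma gauss_translate:
  assumes r: "r \<in> pball q"
  shows "(LINT y|M. indicator (pball q) y * \<xi> (y * r) * \<xi> (- ((y / 2)\<^sup>2))) = \<xi> (r\<^sup>2) * gauss q"
proof -
  define f where "f y = indicator (pball q) y * \<xi> (- (1 / 4) * y\<^sup>2)" for y
  have "step f" unfolding f_def by (intro step_mult step_indicator_pball locally_const_square)
  then have "gauss q = (LINT y|M. f (- (2 * r) + y))"
    unfolding gauss_def f_def[symmetric] by (intro integral_translate[symmetric] step_measurable)
  moreover have "indicator (pball q) y * \<xi> (y * r) * \<xi> (- ((y / 2)\<^sup>2)) = \<xi> (r\<^sup>2) * f (- (2 * r) + y)" for y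
  proof -
    have "- (2 * r) \<in> pball q" using r by (simp add: pball_iff absp_mult)
    then have "indicator (pball q) (- (2 * r) + y) = (indicator (pball q) y :: complex)"
      using pball_add_cancel[of "- (2 * r)" q y] by (simp add: indicator_def add.commute)
    moreover have "y * r + - ((y / 2)\<^sup>2) = r\<^sup>2 + - (1 / 4) * (- (2 * r) + y)\<^sup>2"
      by (simp add: power2_eq_square field_simps)
    then have "\<xi> (y * r) * \<xi> (- ((y / 2)\<^sup>2)) = \<xi> (r\<^sup>2) * \<xi> (- (1 / 4) * (- (2 * r) + y)\<^sup>2)"
      unfolding char_add[symmetric] by (rule arg_cong)
    ultimately show ?thesis by (simp add: f_def mult.assoc mult.left_commute[of "\<xi> (r\<^sup>2)"])
  qed
  ultimately show ?thesis by (simp only: integral_mult_right_zero)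
qed

text \<open>Decompose \<open>f\<close> into indicators of cosets of \<open>pball n\<close>. Their
  transforms live on \<open>pball (k - n)\<close>, and completing the square there splits off the
  common factor \<open>gauss (k - n)\<close>. The fineness has to be large enough for all
  \<open>rep N j\<close> to lie in \<open>pball (k - n)\<close>, so that the translation preserves
  this ball.\<close>

lemma weil_identity:
  assumes "f \<in> schwartz"
  shows "\<exists>n1. \<forall>n\<ge>n1. \<exists>S. (LINT x|M. f x * \<xi> (x\<^sup>2)) = S \<and>
    (LINT y|M. fourier \<xi> M f y * \<xi> (- ((y / 2)\<^sup>2))) = S * gauss (k - n)"
proof -
  obtain N n0 where supp: "\<And>x. x \<notin> pball N \<Longrightarrow> f x = 0"
    and n0: "\<And>n x h. n0 \<le> n \<Longrightarrow> h \<in> pball n \<Longrightarrow> f (x + h) = f x"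
    using assms by (rule schwartzE) blast
  have one: "1 \<in> pball 0" by (simp add: pball_0_iff)
  define n1 where "n1 = max (max n0 N) (max (k - N) (max k 0))"
  have "\<exists>S. (LINT x|M. f x * \<xi> (x\<^sup>2)) = S \<and>
      (LINT y|M. fourier \<xi> M f y * \<xi> (- ((y / 2)\<^sup>2))) = S * gauss (k - n)" if n: "n1 \<le> n" for n
  proof -
    have nb: "n0 \<le> n" "N \<le> n" "k \<le> N + n" "k \<le> n" "0 \<le> n" using n unfolding n1_def by linarith+
    define m where "m = nat (n - N)"
    have nm: "n = N + int m" using nb by (simp add: m_def)
    have const: "\<And>x h. h \<in> pball (N + int m) \<Longrightarrow> f (x + h) = f x" using n0[OF nb(1)] by (simp add: nm)
    let ?c = "complex_of_real (V * real p powi (- n))"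
    let ?J = "{0..<int p ^ m}"
    define S where "S = ?c * (\<Sum>j\<in>?J. f (rep N j) * \<xi> ((rep N j)\<^sup>2))"
    have "has_bochner_integral M (\<lambda>x. f x * \<xi> (x\<^sup>2)) S"
      unfolding S_def nm
    proof (rule has_integral_step)
      fix x h assume "x \<in> pball N" and h: "h \<in> pball (N + int m)"
      then have "\<xi> (1 * (x + h)\<^sup>2) = \<xi> (1 * x\<^sup>2)"
        using nb by (intro char_square_const[OF one, of x N h n]) (auto simp: nm)
      then show "f (x + h) * \<xi> ((x + h)\<^sup>2) = f x * \<xi> (x\<^sup>2)" using const[OF h] by simp
    qed (simp add: supp)
    then have 1: "(LINT x|M. f x * \<xi> (x\<^sup>2)) = S" by (rule has_bochner_integral_integral_eq)
    have sq: "\<xi> (- ((y / 2)\<^sup>2)) = \<xi> (- (1 / 4) * y\<^sup>2)" for y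
      by (rule arg_cong[of _ _ \<xi>]) (simp add: power2_eq_square)
    have st: "integrable M (\<lambda>y. indicator (pball q) y * \<xi> (y * r) * \<xi> (- ((y / 2)\<^sup>2)))" for q r
      unfolding sq by (intro step_integrable step_mult step_indicator_pball locally_const_linear locally_const_square)
    have F: "fourier \<xi> M f y = (\<Sum>j\<in>?J. f (rep N j) * ?c * (indicator (pball (k - n)) y * \<xi> (y * rep N j)))" for y
      unfolding nm by (rule fourier_step[OF supp const])
    have "(\<lambda>y. fourier \<xi> M f y * \<xi> (- ((y / 2)\<^sup>2))) =
       (\<lambda>y. \<Sum>j\<in>?J. f (rep N j) * ?c * (indicator (pball (k - n)) y * \<xi> (y * rep N j) * \<xi> (- ((y / 2)\<^sup>2))))"
      by (simp only: F sum_distrib_right mult.assoc)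
    then have "(LINT y|M. fourier \<xi> M f y * \<xi> (- ((y / 2)\<^sup>2))) =
       (\<Sum>j\<in>?J. LINT y|M. f (rep N j) * ?c * (indicator (pball (k - n)) y * \<xi> (y * rep N j) * \<xi> (- ((y / 2)\<^sup>2))))"
      by (simp only:) (intro Bochner_Integration.integral_sum integrable_mult_right st)
    also have "\<dots> = (\<Sum>j\<in>?J. f (rep N j) * ?c * (\<xi> ((rep N j)\<^sup>2) * gauss (k - n)))"
    proof (intro sum.cong refl)
      fix j
      have "rep N j \<in> pball (k - n)" by (rule pball_mono[OF _ rep_in_pball]) (use nb in simp)
      then show "(LINT y|M. f (rep N j) * ?c * (indicator (pball (k - n)) y * \<xi> (y * rep N j) * \<xi> (- ((y / 2)\<^sup>2)))) =
          f (rep N j) * ?c * (\<xi> ((rep N j)\<^sup>2) * gauss (k - n))"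
        by (simp only: integral_mult_right_zero gauss_translate)
    qed
    also have "\<dots> = S * gauss (k - n)"
      unfolding S_def by (simp add: sum_distrib_left sum_distrib_right mult_ac)
    finally show ?thesis using 1 by blast
  qed
  then show ?thesis by blast
qed

text \<open>Both integrals are proportional with ratio \<Gamma>, so the functional equation for all
  \<open>f\<close> reduces to a single \<open>f\<close> with nonzero integral. The modulus factor is
  1 because 2 is a unit.\<close>

lemma weil_factor_iff:
  assumes stable: "\<And>q. q \<le> q0 \<Longrightarrow> gauss q = \<Gamma>"
  shows "(\<forall>f\<in>schwartz. (LINT x|M. f x * \<xi> (x\<^sup>2)) =
      \<gamma> * complex_of_real (1 / sqrt (absp (2 :: 'a))) * (LINT y|M. fourier \<xi> M f y * \<xi> (- ((y / 2)\<^sup>2))))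
    \<longleftrightarrow> \<gamma> * \<Gamma> = 1"
proof -
  have eq: "(LINT y|M. fourier \<xi> M f y * \<xi> (- ((y / 2)\<^sup>2))) = (LINT x|M. f x * \<xi> (x\<^sup>2)) * \<Gamma>"
    if f: "f \<in> schwartz" for f
  proof -
    obtain n1 where "\<forall>n\<ge>n1. \<exists>S. (LINT x|M. f x * \<xi> (x\<^sup>2)) = S \<and>
        (LINT y|M. fourier \<xi> M f y * \<xi> (- ((y / 2)\<^sup>2))) = S * gauss (k - n)"
      using weil_identity[OF f] by blast
    moreover have "n1 \<le> max n1 (k - q0)" by simp
    ultimately have "(LINT y|M. fourier \<xi> M f y * \<xi> (- ((y / 2)\<^sup>2))) =
        (LINT x|M. f x * \<xi> (x\<^sup>2)) * gauss (k - max n1 (k - q0))" by blast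
    moreover have "k - max n1 (k - q0) \<le> q0" by simp
    ultimately show ?thesis using stable by simp
  qed
  \<comment> \<open>On this ball \<open>x\<^sup>2\<close> lies in \<open>pball k\<close>, so the
    integrand is just the indicator.\<close>
  define n where "n = max k 0"
  have "has_bochner_integral M (\<lambda>x. indicator (pball n) x * \<xi> (x\<^sup>2)) (measure M (pball n) *\<^sub>R 1)"
  proof -
    have "indicator (pball n) x * \<xi> (x\<^sup>2) = indicator (pball n) x *\<^sub>R 1" for x
    proof (cases "x \<in> pball n")
      case True
      from pball_mult[OF this this] have "x\<^sup>2 \<in> pball k"
        unfolding power2_eq_square by (rule pball_mono[rotated]) (simp add: n_def)
      then show ?thesis using True char_pball by simp
    qed simp
    then show ?thesis
      by (simp only:) (intro has_bochner_integral_indicator pball_in_sets emeasure_pball_finite)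
  qed
  then have nz: "(LINT x|M. indicator (coset 0 n) x * \<xi> (x\<^sup>2)) \<noteq> 0"
    using V_pos by (simp add: has_bochner_integral_integral_eq measure_pball pball_coset[symmetric])
  show ?thesis
  proof
    assume *: "\<forall>f\<in>schwartz. (LINT x|M. f x * \<xi> (x\<^sup>2)) =
      \<gamma> * complex_of_real (1 / sqrt (absp (2 :: 'a))) * (LINT y|M. fourier \<xi> M f y * \<xi> (- ((y / 2)\<^sup>2)))"
    have s: "(indicator (coset 0 n) :: 'a \<Rightarrow> complex) \<in> schwartz" by (rule indicator_coset_schwartz)
    from bspec[OF * s] show "\<gamma> * \<Gamma> = 1" using nz unfolding eq[OF s] by simp
  next
    assume "\<gamma> * \<Gamma> = 1"
    then show "\<forall>f\<in>schwartz. (LINT x|M. f x * \<xi> (x\<^sup>2)) =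
      \<gamma> * complex_of_real (1 / sqrt (absp (2 :: 'a))) * (LINT y|M. fourier \<xi> M f y * \<xi> (- ((y / 2)\<^sup>2)))"
      using eq by (simp add: mult.left_commute[of \<gamma>])
  qed
qed

end

subsection \<open>Gauss integrals and the Weil index\<close>

text \<open>An affine map with slope prime to \<open>p\<close> permutes the residues. This is the
  reindexing behind the Gauss sums, the autocorrelation of the Legendre symbol and the convolution
  identities for \<open>W\<close>.\<close>

lemma sum_periodic_affine:
  fixes F :: "int \<Rightarrow> 'b::comm_monoid_add"
  assumes per: "\<And>n. F (n mod int p) = F n" and r: "coprime r (int p)" and p: "p > 0"
  shows "(\<Sum>n\<in>{0..<int p}. F (r * n + a)) = (\<Sum>n\<in>{0..<int p}. F n)"
proof -
  let ?h = "\<lambda>n. (r * n + a) mod int p"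
  have "inj_on ?h {0..<int p}"
  proof (rule inj_onI)
    fix m n assume mn: "m \<in> {0..<int p}" "n \<in> {0..<int p}" "?h m = ?h n"
    then have "[r * m + a = r * n + a] (mod int p)" by (simp add: cong_def)
    then have "[r * m = r * n] (mod int p)" by (simp add: cong_add_rcancel)
    then have "[m = n] (mod int p)" using r by (simp add: cong_mult_lcancel)
    then show "m = n" using mn by (simp add: cong_def)
  qed
  moreover have "?h ` {0..<int p} \<subseteq> {0..<int p}" using p by auto
  ultimately have "bij_betw ?h {0..<int p} {0..<int p}"
    by (simp add: bij_betw_def endo_inj_surj)
  then have "(\<Sum>n\<in>{0..<int p}. F (?h n)) = (\<Sum>n\<in>{0..<int p}. F n)"
    by (rule sum.reindex_bij_betw)
  then show ?thesis by (simp add: per)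
qed

lemma (in padic) absp_4 [simp]: "absp (4 :: 'a) = 1"
  using absp_mult[of 2 2] by simp

context padic_char
begin

text \<open>The shell between the two balls contributes nothing: averaging over translates by
  \<open>rep s j\<close> multiplies the integrand there by a complete sum of a nontrivial character
  modulo \<open>p\<close>.\<close>

lemma gauss_Suc:
  assumes q: "2 * q \<le> k - 2"
  shows "gauss q = gauss (q + 1)"
proof -
  \<comment> \<open>With this choice the cross term has valuation exactly \<open>k - 1\<close> on
    the shell, while the square of the translation already lies in \<open>pball k\<close>.\<close>
  define s where "s = k - 1 - q"
  have s: "q + 1 \<le> s" "k \<le> 2 * s" "q + s = k - 1" using q by (auto simp: s_def)
  define c where "c = (- (1 / 4) :: 'a)"
  have c: "absp c = 1" by (simp add: c_def absp_divide)
  define f where "f y = indicator (pball q) y * \<xi> (c * y\<^sup>2) - indicator (pball (q + 1)) y * \<xi> (c * y\<^sup>2)" for y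
  have st: "step (\<lambda>y. indicator (pball q) y * \<xi> (c * y\<^sup>2))" for q
    by (intro step_mult step_indicator_pball locally_const_square)
  have fm: "f \<in> borel_measurable borel"
    unfolding f_def by (intro borel_measurable_diff step_measurable st)
  have fi: "integrable M f" unfolding f_def by (intro Bochner_Integration.integrable_diff step_integrable st)
  have "gauss q - gauss (q + 1) = (LINT y|M. f y)"
    unfolding gauss_def f_def c_def[symmetric]
    by (intro Bochner_Integration.integral_diff[symmetric] step_integrable st)
  moreover have "(LINT y|M. f y) = 0"
  proof -
    define t where "t y = 2 * c * y * of_nat p powi s" for y
    have tr: "f (rep s (int j) + y) = f y * \<xi> (of_nat j * t y)" for j y
    proof -
      let ?w = "rep s (int j)"
      have w: "?w \<in> pball s" by (rule rep_in_pball)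
      have ws: "?w \<in> pball q" "?w \<in> pball (q + 1)" by (rule pball_mono[OF _ w]; use s in simp)+
      have i: "indicator (pball q) (?w + y) = (indicator (pball q) y :: complex)"
        "indicator (pball (q + 1)) (?w + y) = (indicator (pball (q + 1)) y :: complex)"
        using pball_add_cancel[OF ws(1), of y] pball_add_cancel[OF ws(2), of y]
        by (simp_all add: indicator_def add.commute)
      have "c * (?w * ?w) \<in> pball (0 + (s + s))" using c w by (intro pball_mult) (simp_all add: pball_0_iff)
      then have "c * (?w * ?w) \<in> pball k" by (rule pball_mono[rotated]) (use s in simp)
      then have "\<xi> (c * (?w * ?w)) = 1" by (rule char_pball)
      moreover have "c * (?w + y)\<^sup>2 = c * y\<^sup>2 + of_nat j * t y + c * (?w * ?w)"
        by (simp add: rep_def t_def power2_eq_square algebra_simps)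
      ultimately have "\<xi> (c * (?w + y)\<^sup>2) = \<xi> (c * y\<^sup>2) * \<xi> (of_nat j * t y)"
        by (simp only: char_add mult_1_right)
      then show ?thesis unfolding f_def i by (simp add: algebra_simps)
    qed
    have "of_nat p * (LINT y|M. f y) = (\<Sum>j<p. LINT y|M. f (rep s (int j) + y))"
      using integral_translate[OF fm] by simp
    also have "\<dots> = (LINT y|M. (\<Sum>j<p. f (rep s (int j) + y)))"
    proof (rule Bochner_Integration.integral_sum[symmetric])
      fix j
      have "step (\<lambda>y. indicator (pball q) y * \<xi> (c * y\<^sup>2) * \<xi> (y * (of_nat j * (2 * c * of_nat p powi s))))" for q
        by (intro step_mult step_indicator_pball locally_const_square locally_const_linear)
      then have "integrable M (\<lambda>y. f y * \<xi> (y * (of_nat j * (2 * c * of_nat p powi s))))"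
        unfolding f_def left_diff_distrib by (intro Bochner_Integration.integrable_diff step_integrable)
      moreover have "y * (of_nat j * (2 * c * of_nat p powi s)) = of_nat j * t y" for y
        by (simp add: t_def mult_ac)
      ultimately show "integrable M (\<lambda>y. f (rep s (int j) + y))" by (simp only: tr)
    qed
    also have "(\<lambda>y. \<Sum>j<p. f (rep s (int j) + y)) = (\<lambda>y. 0)"
    proof
      fix y
      show "(\<Sum>j<p. f (rep s (int j) + y)) = 0"
      proof (cases "y \<in> pball q \<and> y \<notin> pball (q + 1)")
        case True
        have "absp y = real p powi (- q)"
          using True absp_less_powi[of y "- q"] by (auto simp: pball_iff)
        then have "absp (t y) = real p powi (- q + - s)"
          using c unfolding t_def absp_mult absp_p_powi powi_add by simp
        also have "- q + - s = - (k - 1)" using s by simp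
        finally have "(\<Sum>j<p. \<xi> (of_nat j * t y)) = 0" by (rule char_sum_zero)
        then show ?thesis unfolding tr by (simp flip: sum_distrib_left)
      next
        case False
        have "y \<in> pball (q + 1) \<Longrightarrow> y \<in> pball q" using pball_mono[of q "q + 1" y] by simp
        then have "f y = 0" using False by (auto simp: f_def indicator_def)
        then show ?thesis unfolding tr by simp
      qed
    qed
    finally show ?thesis by simp
  qed
  ultimately show ?thesis by simp
qed

lemma gauss_stable:
  assumes e: "2 * e \<le> k" and q: "q \<le> e"
  shows "gauss q = gauss e"
  using q
proof (induction q rule: int_le_induct)
  case (step i)
  have "gauss (i - 1) = gauss (i - 1 + 1)" by (rule gauss_Suc) (use step e in simp)
  then show ?case using step by simp
qed simp

lemma gauss_even:
  assumes k: "k = 2 * e"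
  shows "gauss e = of_real (V * real p powi (- e))"
proof -
  have c: "absp (- (1 / 4) :: 'a) = 1"
    by (simp add: absp_divide)
  have "indicator (pball e) y * \<xi> (- (1 / 4) * y\<^sup>2) = indicator (pball e) y *\<^sub>R 1" for y
  proof (cases "y \<in> pball e")
    case True
    have "- (1 / 4) * (y * y) \<in> pball (0 + (e + e))"
      using c True by (intro pball_mult) (simp_all add: pball_0_iff)
    then have "- (1 / 4) * y\<^sup>2 \<in> pball k" by (simp add: k power2_eq_square)
    then have "\<xi> (- (1 / 4) * y\<^sup>2) = 1" by (rule char_pball)
    then show ?thesis using True by (simp only: indicator_simps mult_1_right scaleR_one)
  qed simp
  then have "gauss e = measure M (pball e) *\<^sub>R 1"
    unfolding gauss_def
    by (simp only:) (intro has_bochner_integral_integral_eq has_bochner_integral_indicator pball_in_sets emeasure_pball_finite)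
  then show ?thesis by (simp add: measure_pball scaleR_conv_of_real)
qed

text \<open>For odd conductor one nontrivial layer survives: on \<open>pball (e - 1)\<close> the
  integrand has periods \<open>pball e\<close>, which leaves a Gauss sum of \<open>p\<close>
  terms.\<close>

lemma gauss_odd:
  assumes k: "k = 2 * e - 1"
  shows "gauss (e - 1) = of_real (V * real p powi (- e)) *
    (\<Sum>j<p. \<xi> (- (1 / 4) * (of_nat p powi (e - 1) * of_nat j)\<^sup>2))"
proof -
  have c: "(- (1 / 4) :: 'a) \<in> pball 0" by (simp add: pball_0_iff absp_divide)
  define f where "f y = indicator (pball (e - 1)) y * \<xi> (- (1 / 4) * y\<^sup>2)" for y
  have "has_bochner_integral M f (of_real (V * real p powi (- (e - 1 + int 1))) * (\<Sum>j\<in>{0..<int p ^ 1}. f (rep (e - 1) j)))"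
  proof (rule has_integral_step)
    fix x h assume x: "x \<in> pball (e - 1)" and h: "h \<in> pball (e - 1 + int 1)"
    have "x + h \<in> pball (e - 1)" using x pball_mono[OF _ h, of "e - 1"] pball_add by simp
    moreover have "\<xi> (- (1 / 4) * (x + h)\<^sup>2) = \<xi> (- (1 / 4) * x\<^sup>2)"
      using h by (intro char_square_const[OF c x, of h e]) (simp_all add: k)
    ultimately show "f (x + h) = f x" using x by (simp only: f_def indicator_simps)
  qed (simp add: f_def)
  then have "gauss (e - 1) = of_real (V * real p powi (- e)) * (\<Sum>j\<in>{0..<int p}. f (rep (e - 1) j))"
    unfolding gauss_def f_def[symmetric] by (simp add: has_bochner_integral_integral_eq)
  moreover have "f (rep (e - 1) (int j)) = \<xi> (- (1 / 4) * (of_nat p powi (e - 1) * of_nat j)\<^sup>2)" for j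
    using rep_in_pball[of "e - 1" "int j"]
    by (simp only: f_def indicator_simps mult_1_left rep_def of_int_of_nat_eq)
  ultimately show ?thesis unfolding sum_int_atLeastLessThan by simp
qed

end

section \<open>The Weil index from its definition\<close>

context padic
begin

lemma padic_haar_scale:
  assumes "padic_haar p ty M" and c: "c > 0"
  shows "padic_haar p ty (scale_measure (ennreal c) M)"
proof -
  interpret padic_haar p ty M by fact
  show ?thesis
  proof unfold_locales
    show "emeasure (scale_measure (ennreal c) M) (pball 0) \<noteq> 0"
      "emeasure (scale_measure (ennreal c) M) (pball 0) \<noteq> \<infinity>"
      using emeasure_pball_0 c by (auto simp: ennreal_mult_eq_top_iff)
  qed (simp_all add: sets_M emeasure_translate)
qed

lemma padic_char_scale:
  assumes "padic_char p ty M \<xi> k" and "c > 0"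
  shows "padic_char p ty (scale_measure (ennreal c) M) \<xi> k"
proof -
  interpret padic_char p ty M \<xi> k by fact
  interpret H: padic_haar p ty "scale_measure (ennreal c) M"
    by (rule padic_haar_scale) (unfold_locales, rule assms)
  show ?thesis by unfold_locales (rule char_add norm_char conductor)+
qed

text \<open>Self-duality admits exactly one scaling of the measure, and for this scaling the stable
  Gaussian integral is 1. Together these make the definite description unique.\<close>

lemma weil_index_even:
  assumes "padic_char p ty M \<xi> (2 * e)"
  shows "weil_index M \<xi> = 1"
proof -
  interpret padic_char p ty M \<xi> "2 * e" by fact
  \<comment> \<open>The scaling that gives \<open>pball e\<close> volume 1.\<close>
  define d where "d = real p powi e / V"
  have d: "d > 0" using V_pos powi_pos[of e] by (simp add: d_def del: zero_less_power_int)
  have Ve: "real p powi (- e) * real p powi (- e) = real p powi (- (2 * e))"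
    using powi_add[of "- e" "- e"] by simp
  have iff: "self_dual \<xi> (scale_measure (ennreal c) M) \<and> (\<forall>\<phi>\<in>schwartz.
      (LINT x|scale_measure (ennreal c) M. \<phi> x * \<xi> (x\<^sup>2)) = \<gamma> * complex_of_real (1 / sqrt (absp (2 :: 'a))) *
        (LINT y|scale_measure (ennreal c) M. fourier \<xi> (scale_measure (ennreal c) M) \<phi> y * \<xi> (- ((y / 2)\<^sup>2))))
      \<longleftrightarrow> c = d \<and> \<gamma> = 1" if c: "c > 0" for c \<gamma>
  proof -
    interpret H: padic_char p ty "scale_measure (ennreal c) M" \<xi> "2 * e"
      by (rule padic_char_scale[OF assms c])
    have HV: "H.V = c * V" using c by (simp add: H.V_def V_def)
    define r where "r = c * V * real p powi (- e)"
    have r: "r > 0" using c V_pos powi_pos[of "- e"] by (simp add: r_def del: zero_less_power_int)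
    have "H.V * H.V * real p powi (- (2 * e)) = r * r"
      unfolding HV Ve[symmetric] r_def by (simp only: mult_ac)
    moreover have "r * r = 1 \<longleftrightarrow> r = 1"
      using r by (simp add: square_eq_1_iff)
    moreover have "r = 1 \<longleftrightarrow> c = d"
      using V_pos unfolding r_def d_def by (auto simp: power_int_minus field_simps)
    moreover have "H.gauss q = of_real r" if "q \<le> e" for q
      using H.gauss_stable[of e q] H.gauss_even[of e] that unfolding HV r_def by simp
    note weil = H.weil_factor_iff[OF this, of e \<gamma>]
    ultimately show ?thesis unfolding H.self_dual_iff weil by auto
  qed
  have "(\<exists>c>0. let N = scale_measure (ennreal c) M in self_dual \<xi> N \<and> (\<forall>\<phi>\<in>schwartz.
      (LINT x|N. \<phi> x * \<xi> (x\<^sup>2)) = \<gamma> * complex_of_real (1 / sqrt (absp (2 :: 'a))) *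
        (LINT y|N. fourier \<xi> N \<phi> y * \<xi> (- ((y / 2)\<^sup>2))))) \<longleftrightarrow> \<gamma> = 1" for \<gamma>
    unfolding Let_def using iff d by blast
  then show ?thesis unfolding weil_index_def by simp
qed

text \<open>As for even conductor, except that the self-dual volume of \<open>pball e\<close> is now
  1 / sqrt p, which normalises the Gauss sum.\<close>

lemma weil_index_odd:
  assumes "padic_char p ty M \<xi> (2 * e - 1)"
    and G: "G = (\<Sum>j<p. \<xi> (- (1 / 4) * (of_nat p powi (e - 1) * of_nat j)\<^sup>2))" and "G \<noteq> 0"
  shows "weil_index M \<xi> = of_real (sqrt (real p)) / G"
proof -
  interpret padic_char p ty M \<xi> "2 * e - 1" by fact
  define d where "d = real p powi e / (V * sqrt (real p))"
  have d: "d > 0" using V_pos powi_pos[of e] p_gt_0 by (simp add: d_def del: zero_less_power_int)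
  have Ve: "real p powi (- e) * real p powi (- e) * real p = real p powi (- (2 * e - 1))"
    using powi_add[of "- e" "- e"] powi_add[of "- e + - e" 1] by simp
  have iff: "self_dual \<xi> (scale_measure (ennreal c) M) \<and> (\<forall>\<phi>\<in>schwartz.
      (LINT x|scale_measure (ennreal c) M. \<phi> x * \<xi> (x\<^sup>2)) = \<gamma> * complex_of_real (1 / sqrt (absp (2 :: 'a))) *
        (LINT y|scale_measure (ennreal c) M. fourier \<xi> (scale_measure (ennreal c) M) \<phi> y * \<xi> (- ((y / 2)\<^sup>2))))
      \<longleftrightarrow> c = d \<and> \<gamma> = of_real (sqrt (real p)) / G" if c: "c > 0" for c \<gamma>
  proof -
    interpret H: padic_char p ty "scale_measure (ennreal c) M" \<xi> "2 * e - 1"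
      by (rule padic_char_scale[OF assms(1) c])
    have HV: "H.V = c * V" using c by (simp add: H.V_def V_def)
    define r where "r = c * V * real p powi (- e)"
    have r: "r > 0" using c V_pos powi_pos[of "- e"] by (simp add: r_def del: zero_less_power_int)
    have "H.V * H.V * real p powi (- (2 * e - 1)) = (r * sqrt (real p)) * (r * sqrt (real p))"
      unfolding HV Ve[symmetric] r_def by simp
    moreover have "(r * sqrt (real p)) * (r * sqrt (real p)) = 1 \<longleftrightarrow> r * sqrt (real p) = 1"
    proof -
      have "r * sqrt (real p) > 0" using r p_gt_0 by simp
      then show ?thesis by (simp only: square_eq_1_iff) linarith
    qed
    moreover have "r * sqrt (real p) = 1 \<longleftrightarrow> c = d"
      using V_pos p_gt_0 unfolding r_def d_def by (auto simp: power_int_minus field_simps)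
    moreover have "H.gauss q = of_real r * G" if "q \<le> e - 1" for q
      using H.gauss_stable[of "e - 1" q] H.gauss_odd[of e] that G unfolding HV r_def by simp
    note weil = H.weil_factor_iff[OF this, of "e - 1" \<gamma>]
    moreover have "\<gamma> * (of_real r * G) = 1 \<longleftrightarrow> \<gamma> = of_real (sqrt (real p)) / G" if "r * sqrt (real p) = 1"
    proof -
      have sr: "complex_of_real (sqrt (real p)) * of_real r = 1" using that by (simp add: mult.commute flip: of_real_mult)
      have "\<gamma> * (of_real r * G) = 1 \<longleftrightarrow> (\<gamma> * G) * of_real r = of_real (sqrt (real p)) * of_real r"
        unfolding sr by (simp add: mult_ac)
      also have "\<dots> \<longleftrightarrow> \<gamma> * G = of_real (sqrt (real p))" using r by simp
      also have "\<dots> \<longleftrightarrow> \<gamma> = of_real (sqrt (real p)) / G" using \<open>G \<noteq> 0\<close> by (simp add: nonzero_eq_divide_eq)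
      finally show ?thesis .
    qed
    ultimately show ?thesis unfolding H.self_dual_iff weil by auto
  qed
  have "(\<exists>c>0. let N = scale_measure (ennreal c) M in self_dual \<xi> N \<and> (\<forall>\<phi>\<in>schwartz.
      (LINT x|N. \<phi> x * \<xi> (x\<^sup>2)) = \<gamma> * complex_of_real (1 / sqrt (absp (2 :: 'a))) *
        (LINT y|N. fourier \<xi> N \<phi> y * \<xi> (- ((y / 2)\<^sup>2))))) \<longleftrightarrow> \<gamma> = of_real (sqrt (real p)) / G" for \<gamma>
    unfolding Let_def using iff d by blast
  then show ?thesis unfolding weil_index_def by simp
qed

end

section \<open>Quadratic Gauss sums modulo \<open>p\<close>\<close>

lemma card_square_roots_mod:
  assumes p: "prime p" "2 < p" and i: "i \<in> {0..<int p}"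
  shows "int (card {n \<in> {0..<int p}. n\<^sup>2 mod int p = i}) = 1 + Legendre i (int p)"
proof -
  have pi: "prime (int p)" using p by simp
  have i': "[i = 0] (mod int p) \<longleftrightarrow> i = 0" using i by (simp add: cong_def)
  have roots: "n = t \<or> n = int p - t"
    if n: "n \<in> {0..<int p}" and t: "t \<in> {0..<int p}" "t \<noteq> 0" and eq: "n\<^sup>2 mod int p = t\<^sup>2 mod int p" for n t
  proof -
    have "int p dvd n\<^sup>2 - t\<^sup>2" using eq by (simp add: mod_eq_dvd_iff)
    then have "int p dvd (n - t) * (n + t)" by (simp add: power2_eq_square algebra_simps)
    then have "int p dvd n - t \<or> int p dvd n + t" using prime_dvd_mult_iff[OF pi] by blast
    then show ?thesis
    proof
      assume "int p dvd n - t"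
      then have "n mod int p = t mod int p" by (simp add: mod_eq_dvd_iff)
      then show ?thesis using n t by simp
    next
      assume "int p dvd n + t"
      then have "int p dvd n + t - int p" by simp
      moreover have "\<bar>n + t - int p\<bar> < int p" using n t unfolding atLeastLessThan_iff by linarith
      ultimately have "n + t - int p = 0" using dvd_imp_le_int[of "n + t - int p" "int p"] by linarith
      then show ?thesis by simp
    qed
  qed
  show ?thesis
  proof (cases "i = 0")
    case True
    have "{n \<in> {0..<int p}. n\<^sup>2 mod int p = i} = {0}"
    proof (intro equalityI subsetI)
      fix n assume "n \<in> {n \<in> {0..<int p}. n\<^sup>2 mod int p = i}"
      then have n: "0 \<le> n" "n < int p" "int p dvd n\<^sup>2" using True by (auto simp: dvd_eq_mod_eq_0)
      then have "int p dvd n" using pi prime_dvd_power by blast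
      then show "n \<in> {0}" using n zdvd_imp_le[of "int p" n] by (cases "n = 0") auto
    qed (use True p in auto)
    then show ?thesis using True by (simp add: Legendre_def cong_def)
  next
    case False
    show ?thesis
    proof (cases "QuadRes (int p) i")
      case True
      then obtain t0 where t0: "[t0\<^sup>2 = i] (mod int p)" unfolding QuadRes_def by blast
      define t where "t = t0 mod int p"
      have t: "t \<in> {0..<int p}" using p by (simp add: t_def)
      have ti: "t\<^sup>2 mod int p = i" using t0 i by (simp add: t_def power_mod cong_def)
      have tn0: "t \<noteq> 0" using ti False by auto
      have "{n \<in> {0..<int p}. n\<^sup>2 mod int p = i} = {t, int p - t}"
      proof (intro equalityI subsetI)
        fix n assume "n \<in> {n \<in> {0..<int p}. n\<^sup>2 mod int p = i}"
        then show "n \<in> {t, int p - t}" using roots[of n t] t tn0 ti by auto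
      next
        fix n assume "n \<in> {t, int p - t}"
        moreover have "(int p - t)\<^sup>2 mod int p = i"
        proof -
          have "(int p - t)\<^sup>2 = t\<^sup>2 + int p * (int p - 2 * t)" by (simp add: power2_eq_square algebra_simps)
          then show ?thesis using ti by simp
        qed
        ultimately show "n \<in> {n \<in> {0..<int p}. n\<^sup>2 mod int p = i}" using t tn0 ti by auto
      qed
      moreover have "t \<noteq> int p - t"
      proof
        assume "t = int p - t"
        then have "int p = 2 * t" by simp
        then have "even p" by (metis dvd_triv_left even_of_nat)
        then show False using prime_odd_nat[OF p] by simp
      qed
      ultimately show ?thesis using True False i' by (simp add: Legendre_def)
    next
      case nq: False
      have e: "{n \<in> {0..<int p}. n\<^sup>2 mod int p = i} = {}"
      proof (rule ccontr)
        assume "\<not> ?thesis"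
        then obtain n where "n\<^sup>2 mod int p = i" by blast
        then have "[n\<^sup>2 = i] (mod int p)" using i by (simp add: cong_def)
        then show False using nq unfolding QuadRes_def by blast
      qed
      show ?thesis unfolding e using False nq i' by (simp add: Legendre_def)
    qed
  qed
qed

lemma sum_squares_mod:
  fixes F :: "int \<Rightarrow> complex"
  assumes p: "prime p" "2 < p" and per: "\<And>n. F (n mod int p) = F n"
  shows "(\<Sum>n\<in>{0..<int p}. F (n\<^sup>2)) = (\<Sum>i\<in>{0..<int p}. of_int (1 + Legendre i (int p)) * F i)"
proof -
  have "(\<Sum>n\<in>{0..<int p}. F (n\<^sup>2)) =
      (\<Sum>i\<in>{0..<int p}. \<Sum>n\<in>{n \<in> {0..<int p}. n\<^sup>2 mod int p = i}. F (n\<^sup>2))"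
    using p by (intro sum.group[symmetric]) auto
  also have "\<dots> = (\<Sum>i\<in>{0..<int p}. \<Sum>n\<in>{n \<in> {0..<int p}. n\<^sup>2 mod int p = i}. F i)"
    by (intro sum.cong refl) (auto simp: per)
  also have "\<dots> = (\<Sum>i\<in>{0..<int p}. of_int (1 + Legendre i (int p)) * F i)"
  proof (intro sum.cong refl)
    fix i assume i: "i \<in> {0..<int p}"
    have "(of_int (1 + Legendre i (int p)) :: complex) =
        of_nat (card {n \<in> {0..<int p}. n\<^sup>2 mod int p = i})"
      unfolding card_square_roots_mod[OF p i, symmetric] by simp
    then show "(\<Sum>n\<in>{n \<in> {0..<int p}. n\<^sup>2 mod int p = i}. F i) = of_int (1 + Legendre i (int p)) * F i"
      by simp
  qed
  finally show ?thesis .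
qed

locale padic_psi = padic_haar p ty dx for p and ty :: "'a::{field_char_0,complete_space} itself" and dx +
  fixes \<psi> :: "'a \<Rightarrow> complex"
  assumes psi: "additive_character \<psi>" "conductor_zero p \<psi>"
begin

lemma psi_add: "\<psi> (x + y) = \<psi> x * \<psi> y"
  using psi(1) by (simp add: additive_character_def)

lemma psi_conductor: "(\<forall>x\<in>pball q. \<psi> x = 1) \<longleftrightarrow> 0 \<le> q"
proof
  assume "0 \<le> q"
  then have "x \<in> Zp" if "x \<in> pball q" for x
    using pball_mono[OF _ that, of 0] by (simp add: Zp_def pball_0_iff)
  then show "\<forall>x\<in>pball q. \<psi> x = 1" using psi(2) unfolding conductor_zero_def by blast
next
  assume h: "\<forall>x\<in>pball q. \<psi> x = 1"
  obtain x where x: "x \<in> Zp" "\<psi> (x / of_nat p) \<noteq> 1" using psi(2) unfolding conductor_zero_def by blast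
  show "0 \<le> q"
  proof (rule ccontr)
    assume "\<not> 0 \<le> q"
    moreover have "x / of_nat p \<in> pball (- 1)"
      using x(1) p_gt_0 by (simp add: pball_iff Zp_def absp_divide)
    ultimately have "x / of_nat p \<in> pball q" by (intro pball_mono[of q "- 1"]) auto
    then show False using h x(2) by blast
  qed
qed

lemma psi_twist:
  assumes a: "a \<noteq> 0"
  shows "padic_char p ty dx (\<lambda>x. \<psi> (a * x)) (- ordp p a)"
proof unfold_locales
  show "\<psi> (a * (x + y)) = \<psi> (a * x) * \<psi> (a * y)" for x y
    by (simp add: distrib_left psi_add)
  show "norm (\<psi> (a * x)) = 1" for x
    using psi(1) by (simp add: additive_character_def)
  show "(\<forall>x\<in>pball q. \<psi> (a * x) = 1) \<longleftrightarrow> - ordp p a \<le> q" for q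
  proof -
    have "(\<forall>x\<in>pball q. \<psi> (a * x) = 1) \<longleftrightarrow> (\<forall>x\<in>pball (q + ordp p a). \<psi> x = 1)"
    proof (intro iffI ballI)
      fix x assume h: "\<forall>x\<in>pball q. \<psi> (a * x) = 1" and x: "x \<in> pball (q + ordp p a)"
      have "x / a \<in> pball q"
        using mult_in_pball_iff[OF absp_ordp[OF a], of "x / a" "q + ordp p a"] a x by simp
      from bspec[OF h this] show "\<psi> x = 1" using a by simp
    next
      fix x assume h: "\<forall>x\<in>pball (q + ordp p a). \<psi> x = 1" and x: "x \<in> pball q"
      have "a * x \<in> pball (q + ordp p a)"
        using mult_in_pball_iff[OF absp_ordp[OF a], of x "q + ordp p a"] x by simp
      then show "\<psi> (a * x) = 1" using h by blast
    qed
    then show ?thesis unfolding psi_conductor by linarith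
  qed
qed

text \<open>The additive character of the integers modulo \<open>p\<close> induced by
  \<open>\<psi>\<close>.\<close>

definition ez :: "int \<Rightarrow> complex" where
  "ez n = \<psi> (of_int n / of_nat p)"

lemma psi_Zp: "absp x \<le> 1 \<Longrightarrow> \<psi> x = 1"
  using psi_conductor[of 0] by (simp add: pball_0_iff)

lemma ez_add: "ez (m + n) = ez m * ez n"
  by (simp add: ez_def add_divide_distrib psi_add)

lemma ez_mod: "ez (n mod int p) = ez n"
proof -
  have "ez n = ez (n mod int p) * ez (int p * (n div int p))"
    by (simp flip: ez_add)
  moreover have "ez (int p * (n div int p)) = 1"
    unfolding ez_def by (intro psi_Zp) (simp add: absp_of_int_le)
  ultimately show ?thesis by simp
qed

lemma ez_neq_1:
  assumes "\<not> int p dvd a" shows "ez a \<noteq> 1"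
proof -
  interpret padic_char p ty dx \<psi> 0
    using psi_twist[of 1] ordp_unit[of 1] by simp
  have "absp (of_int a / of_nat p :: 'a) = real p powi (- (0 - 1))"
    using absp_of_int_eq_1[OF assms] by (simp add: absp_divide)
  then show ?thesis unfolding ez_def by (rule char_nontrivial)
qed

lemma ez_mod_mult: "ez (a * (n mod int p)) = ez (a * n)"
  using ez_mod[of "a * (n mod int p)"] ez_mod[of "a * n"] by (simp add: mod_mult_right_eq)

lemma ez_0 [simp]: "ez 0 = 1"
  unfolding ez_def by (rule psi_Zp) simp

lemma sum_ez: "(\<Sum>n\<in>{0..<int p}. ez (a * n)) = (if int p dvd a then of_nat p else 0)"
proof (cases "int p dvd a")
  case True
  then have "ez (a * n) = 1" for n
    using ez_mod[of "a * n"] by (metis dvd_eq_mod_eq_0 dvd_mult2 ez_0)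
  then show ?thesis using True by simp
next
  case False
  have "(\<Sum>n\<in>{0..<int p}. ez (a * (1 * n + 1))) = (\<Sum>n\<in>{0..<int p}. ez (a * n))"
    using p_gt_0 by (intro sum_periodic_affine[of "\<lambda>n. ez (a * n)"] ez_mod_mult) auto
  then have "(\<Sum>n\<in>{0..<int p}. ez (a * n)) * ez a = (\<Sum>n\<in>{0..<int p}. ez (a * n))"
    by (simp add: distrib_left ez_add sum_distrib_right)
  then show ?thesis using False ez_neq_1 by simp
qed

definition gsum :: "int \<Rightarrow> complex" where
  "gsum u = (\<Sum>n\<in>{0..<int p}. ez (u * n\<^sup>2))"

lemma p_gt_2: "2 < p"
  using p_ge_3 by simp

text \<open>Counting square roots turns the sum over squares into one twisted by the Legendre
  symbol, from which the substitution of u i for i extracts the symbol of \<open>u\<close>.\<close>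

lemma gsum_eq_Legendre:
  assumes u: "\<not> int p dvd u"
  shows "gsum u = of_int (Legendre u (int p)) * gsum 1"
proof -
  define T where "T u = (\<Sum>i\<in>{0..<int p}. of_int (Legendre i (int p)) * ez (u * i))" for u
  have L: "Legendre (i mod int p) (int p) = Legendre i (int p)" for i
    by (rule Legendre_cong) (simp add: cong_def)
  have gT: "gsum u = T u" if "\<not> int p dvd u" for u
  proof -
    have "gsum u = (\<Sum>i\<in>{0..<int p}. ez (u * i)) + T u"
      unfolding gsum_def T_def
      by (subst sum_squares_mod[OF prime_p p_gt_2, of "\<lambda>n. ez (u * n)"])
        (simp_all add: ez_mod_mult distrib_right sum.distrib)
    then show ?thesis using sum_ez[of u] that by simp
  qed
  have cop: "coprime u (int p)"
    using u prime_p by (metis coprime_commute prime_imp_coprime prime_nat_int_transfer)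
  have LL: "Legendre u (int p) * Legendre u (int p) = 1"
    using u by (auto simp: Legendre_def cong_0_iff)
  have "T 1 = (\<Sum>i\<in>{0..<int p}. of_int (Legendre (u * i + 0) (int p)) * ez (1 * (u * i + 0)))"
    unfolding T_def using p_gt_0 cop L ez_mod_mult[of 1]
    by (intro sum_periodic_affine[of "\<lambda>i. of_int (Legendre i (int p)) * ez (1 * i)", symmetric]) auto
  also have "\<dots> = of_int (Legendre u (int p)) * T u"
    unfolding T_def by (simp add: Legendre_mult[OF prime_p p_gt_2] sum_distrib_left mult.assoc)
  finally have "of_int (Legendre u (int p)) * T 1 = of_int (Legendre u (int p) * Legendre u (int p)) * T u"
    by simp
  then show ?thesis using gT[OF u] gT[of 1] LL p_gt_1 by simp
qed

text \<open>The product with \<open>gsum (- 1)\<close> takes the place of the squared absolute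
  value. After shifting one variable, orthogonality leaves only \<open>i = 0\<close>, of value
  \<open>p\<close>; and \<open>gsum (- 1)\<close> is \<open>gsum 1\<close> up to the symbol of -
  1.\<close>

lemma gsum_sq: "gsum 1 * gsum 1 = of_int (Legendre (- 1) (int p)) * of_nat p"
proof -
  have two: "int p dvd 2 * n \<longleftrightarrow> n = 0" if "n \<in> {0..<int p}" for n
  proof
    assume "int p dvd 2 * n"
    moreover have "\<not> int p dvd 2" using p_gt_2 by (auto dest: zdvd_imp_le)
    ultimately have "int p dvd n" using prime_p by (meson prime_dvd_mult_iff prime_nat_int_transfer)
    then show "n = 0" using that zdvd_imp_le[of "int p" n] by (cases "n = 0") auto
  qed simp
  have "gsum 1 * gsum (- 1) = (\<Sum>j\<in>{0..<int p}. ez (- (j\<^sup>2)) * (\<Sum>i\<in>{0..<int p}. ez (i\<^sup>2)))"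
    by (simp add: gsum_def sum_distrib_left sum_distrib_right mult.commute)
  also have "\<dots> = (\<Sum>j\<in>{0..<int p}. ez (- (j\<^sup>2)) * (\<Sum>i\<in>{0..<int p}. ez ((1 * i + j)\<^sup>2)))"
  proof -
    have "(\<Sum>i\<in>{0..<int p}. ez ((1 * i + j)\<^sup>2)) = (\<Sum>i\<in>{0..<int p}. ez (i\<^sup>2))" for j
    proof (rule sum_periodic_affine[of "\<lambda>i. ez (i\<^sup>2)"])
      show "ez ((n mod int p)\<^sup>2) = ez (n\<^sup>2)" for n
        using ez_mod[of "(n mod int p)\<^sup>2"] ez_mod[of "n\<^sup>2"] by (simp add: power_mod)
    qed (use p_gt_0 in auto)
    then show ?thesis by simp
  qed
  also have "\<dots> = (\<Sum>j\<in>{0..<int p}. \<Sum>i\<in>{0..<int p}. ez (i\<^sup>2) * ez (2 * i * j))"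
  proof -
    have "ez (- (j\<^sup>2)) * ez ((1 * i + j)\<^sup>2) = ez (i\<^sup>2) * ez (2 * i * j)" for i j
    proof -
      have "- (j\<^sup>2) + (1 * i + j)\<^sup>2 = i\<^sup>2 + 2 * i * j" by (simp add: power2_eq_square algebra_simps)
      then show ?thesis by (metis ez_add)
    qed
    then show ?thesis by (simp only: sum_distrib_left)
  qed
  also have "\<dots> = (\<Sum>i\<in>{0..<int p}. ez (i\<^sup>2) * (\<Sum>j\<in>{0..<int p}. ez (2 * i * j)))"
    by (subst sum.swap) (simp only: sum_distrib_left)
  also have "\<dots> = (\<Sum>i\<in>{0..<int p}. if i = 0 then of_nat p else 0)"
    by (intro sum.cong refl) (simp add: sum_ez two)
  also have "\<dots> = of_nat p" using p_gt_0 by (simp add: sum.delta)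
  finally have 1: "gsum 1 * gsum (- 1) = of_nat p" .
  have np: "\<not> int p dvd - 1" using p_gt_1 by simp
  then have LL: "Legendre (- 1) (int p) * Legendre (- 1) (int p) = 1"
    by (auto simp: Legendre_def cong_0_iff)
  have "of_int (Legendre (- 1) (int p)) * (gsum 1 * gsum 1) = of_nat p"
    using 1 gsum_eq_Legendre[OF np] by (simp add: mult_ac)
  then have "of_int (Legendre (- 1) (int p) * Legendre (- 1) (int p)) * (gsum 1 * gsum 1) =
      of_int (Legendre (- 1) (int p)) * of_nat p" by simp
  then show ?thesis unfolding LL by simp
qed

lemma gsum_nonzero: "gsum 1 \<noteq> 0"
proof
  assume "gsum 1 = 0"
  then have "of_int (Legendre (- 1) (int p)) * (of_nat p :: complex) = 0" using gsum_sq by simp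
  moreover have "Legendre (- 1) (int p) \<noteq> 0" using p_gt_1 by (auto simp: Legendre_def cong_0_iff)
  ultimately show False by simp
qed

lemma psi_square_sum:
  assumes u: "absp u = 1"
  shows "(\<Sum>j<p. \<psi> (u / of_nat p * (of_nat j)\<^sup>2)) = of_int (lg u) * gsum 1"
proof -
  define r where "r = residue_mod p u"
  have r: "absp (u - of_int r) < 1" using residue_mod(3)[of u] u by (simp add: r_def)
  have "\<psi> (u / of_nat p * (of_nat j)\<^sup>2) = ez (r * (int j)\<^sup>2)" for j
  proof -
    have "absp ((u - of_int r) / of_nat p * (of_nat j)\<^sup>2) \<le> 1"
    proof -
      have "absp ((u - of_int r) / of_nat p) \<le> 1" using r p_gt_0 unfolding absp_lt_1 by (simp add: absp_divide field_simps)
      moreover have "absp ((of_nat j)\<^sup>2 :: 'a) \<le> 1" using absp_of_nat_le[of "j\<^sup>2"] by simp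
      ultimately show ?thesis unfolding absp_mult by (intro mult_le_one) auto
    qed
    then have "\<psi> ((u - of_int r) / of_nat p * (of_nat j)\<^sup>2) = 1" by (rule psi_Zp)
    moreover have "u / of_nat p * (of_nat j)\<^sup>2 =
        of_int (r * (int j)\<^sup>2) / of_nat p + (u - of_int r) / of_nat p * (of_nat j)\<^sup>2"
      by (simp add: field_simps)
    ultimately show ?thesis by (simp only: psi_add ez_def mult_1_right)
  qed
  then have "(\<Sum>j<p. \<psi> (u / of_nat p * (of_nat j)\<^sup>2)) = gsum r"
    unfolding gsum_def sum_int_atLeastLessThan by simp
  moreover have "\<not> int p dvd r" using residue_mod_cong_0[OF u] by (simp add: r_def cong_0_iff)
  ultimately show ?thesis using gsum_eq_Legendre[of r] by (simp add: lg_def r_def)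
qed

text \<open>For odd valuation, writing \<open>ordp p a = 1 - 2 * e\<close> brings the Gauss sum to
  the shape of a unit over \<open>p\<close>. The factor -1/4 of the Gaussian contributes only
  \<open>lg (- 1)\<close>, as 1/4 is a square; the sign is its own inverse, so it may stay in the
  numerator.\<close>

lemma weil_index_psi:
  assumes a: "a \<noteq> 0"
  shows "weil_index dx (\<lambda>x. \<psi> (a * x)) =
    (if even (ordp p a) then 1 else of_int (lg (- 1) * lg (upart a)) * (of_real (sqrt (real p)) / gsum 1))"
proof (cases "even (ordp p a)")
  case True
  then obtain e where "ordp p a = 2 * e" by blast
  then have "padic_char p ty dx (\<lambda>x. \<psi> (a * x)) (2 * (- e))" using psi_twist[OF a] by simp
  from weil_index_even[OF this] True show ?thesis by simp
next
  case False
  then obtain e' where "ordp p a = 2 * e' + 1" by (rule oddE)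
  define e where "e = - e'"
  have e: "ordp p a = 1 - 2 * e" using \<open>ordp p a = 2 * e' + 1\<close> by (simp add: e_def)
  then have pc: "padic_char p ty dx (\<lambda>x. \<psi> (a * x)) (2 * e - 1)" using psi_twist[OF a] by simp
  define G where "G = (\<Sum>j<p. \<psi> (a * (- (1 / 4) * (of_nat p powi (e - 1) * of_nat j)\<^sup>2)))"
  define u where "u = - 1 * ((1 / 2)\<^sup>2 * upart a)"
  have ua: "absp (upart a) = 1" using a by (rule absp_upart)
  then have u: "absp u = 1" by (simp add: u_def absp_mult absp_power absp_divide)
  have h: "absp (1 / 2 :: 'a) = 1" by (simp add: absp_divide)
  have "a * (- (1 / 4) * (of_nat p powi (e - 1) * of_nat j)\<^sup>2) = u / of_nat p * (of_nat j)\<^sup>2" for j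
  proof -
    have "a = upart a * of_nat p powi (1 - 2 * e)" using upart_ordp[of a] e by simp
    moreover have "of_nat p powi (1 - 2 * e) * ((of_nat p powi (e - 1))\<^sup>2) = (inverse (of_nat p) :: 'a)"
    proof -
      have "of_nat p powi (1 - 2 * e) * ((of_nat p powi (e - 1))\<^sup>2) =
          (of_nat p powi ((1 - 2 * e) + ((e - 1) + (e - 1))) :: 'a)"
        unfolding power2_eq_square by (subst power_int_add, simp)+ simp
      then show ?thesis by (simp add: power_int_minus)
    qed
    then have "upart a * of_nat p powi (1 - 2 * e) * (- (1 / 4) * (of_nat p powi (e - 1) * of_nat j)\<^sup>2) =
        upart a * (- (1 / 4)) * inverse (of_nat p) * (of_nat j)\<^sup>2"
      by (simp add: power_mult_distrib mult_ac)
    ultimately have "a * (- (1 / 4) * (of_nat p powi (e - 1) * of_nat j)\<^sup>2) =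
        upart a * (- (1 / 4)) * inverse (of_nat p) * (of_nat j)\<^sup>2" by simp
    moreover have "u = upart a * (- (1 / 4))" by (simp add: u_def power2_eq_square)
    ultimately show ?thesis by (simp only: divide_inverse[of "upart a * (- (1 / 4))" "of_nat p"])
  qed
  then have "G = of_int (lg u) * gsum 1" unfolding G_def by (simp only: psi_square_sum[OF u])
  moreover have "lg u = lg (- 1) * lg (upart a)"
  proof -
    have "lg u = lg (- 1) * lg ((1 / 2)\<^sup>2 * upart a)"
      unfolding u_def using ua h by (intro lg_mult) (simp_all add: absp_mult absp_power)
    also have "lg ((1 / 2)\<^sup>2 * upart a) = lg ((1 / 2)\<^sup>2) * lg (upart a)"
      using ua h by (intro lg_mult) (simp_all add: absp_power)
    also have "lg ((1 / 2)\<^sup>2) = 1" using h by (rule lg_square)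
    finally show ?thesis by simp
  qed
  ultimately have G: "G = of_int (lg (- 1) * lg (upart a)) * gsum 1" by simp
  have l: "lg (- 1) * lg (upart a) = 1 \<or> lg (- 1) * lg (upart a) = - 1"
    using lg_cases[OF ua] lg_cases[of "- 1"] by auto
  then have "G \<noteq> 0" using G gsum_nonzero by auto
  then have "weil_index dx (\<lambda>x. \<psi> (a * x)) = of_real (sqrt (real p)) / G"
    by (rule weil_index_odd[OF pc G_def])
  then have w: "weil_index dx (\<lambda>x. \<psi> (a * x)) =
      of_real (sqrt (real p)) / (of_int (lg (- 1) * lg (upart a)) * gsum 1)" unfolding G .
  define s where "s = lg (- 1) * lg (upart a)"
  have "s = 1 \<or> s = - 1" using l by (simp add: s_def)
  then show ?thesis using False w unfolding s_def[symmetric] by auto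
qed

lemma weil_gamma_formula:
  assumes a: "a \<noteq> 0"
  shows "weil_gamma dx \<psi> a =
    (if even (ordp p a) then 1 else of_int (lg (- 1) * lg (upart a)) * (of_real (sqrt (real p)) / gsum 1))"
proof -
  have "weil_index dx \<psi> = 1" using weil_index_psi[of 1] ordp_unit[of 1] by simp
  then show ?thesis using weil_index_psi[OF a] by (simp add: weil_gamma_def)
qed

lemma weil_gamma_unit: "absp u = 1 \<Longrightarrow> weil_gamma dx \<psi> u = 1"
  using weil_gamma_formula[of u] ordp_unit[of u] by fastforce

lemma sqrt_gsum_sq:
  "(of_real (sqrt (real p)) / gsum 1) * (of_real (sqrt (real p)) / gsum 1) = (of_int (lg (- 1)) :: complex)"
proof -
  have l: "lg (- 1) = Legendre (- 1) (int p)" using lg_of_int[of "- 1"] by simp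
  have "of_real (sqrt (real p)) * of_real (sqrt (real p)) = (of_nat p :: complex)"
    by (simp flip: of_real_mult)
  then have "(of_real (sqrt (real p)) / gsum 1) * (of_real (sqrt (real p)) / gsum 1) =
      of_nat p / (of_int (lg (- 1)) * of_nat p)"
    using gsum_sq l by (simp add: times_divide_times_eq)
  moreover have "lg (- 1) = 1 \<or> lg (- 1) = - 1" by (rule lg_cases) simp
  ultimately show ?thesis by auto
qed

text \<open>Times \<open>p\<close>, this says that \<open>sqrt_pstar\<close> squares to p*, with the
  sign of the Gauss sum left open.\<close>

lemma weil_gamma_p_sq: "weil_gamma dx \<psi> (of_nat p) * weil_gamma dx \<psi> (of_nat p) = of_int (lg (- 1))"
proof -
  have "weil_gamma dx \<psi> (of_nat p) = of_int (lg (- 1)) * (of_real (sqrt (real p)) / gsum 1)"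
    using weil_gamma_formula[of "of_nat p"] by (simp add: ordp_p upart_p)
  then have "weil_gamma dx \<psi> (of_nat p) * weil_gamma dx \<psi> (of_nat p) =
      of_int (lg (- 1) * lg (- 1)) * ((of_real (sqrt (real p)) / gsum 1) * (of_real (sqrt (real p)) / gsum 1))"
    by simp
  moreover have "lg (- 1) * lg (- 1) = 1" by (rule lg_square_eq_1) simp
  ultimately show ?thesis by (simp only: sqrt_gsum_sq of_int_1 mult_1_left)
qed

text \<open>If both valuations are odd, the two normalised Gauss sums multiply to
  \<open>lg (- 1)\<close>, the same sign that the tame symbol of two such elements carries. In the
  other cases the unit parts match directly.\<close>

lemma weil_gamma_mult:
  assumes a: "a \<noteq> 0" and b: "b \<noteq> 0"
  shows "weil_gamma dx \<psi> (a * b) = weil_gamma dx \<psi> a * weil_gamma dx \<psi> b * of_int (hilbert a b)"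
proof -
  have ab: "a * b \<noteq> 0" using a b by simp
  define w where "w = of_real (sqrt (real p)) / gsum 1"
  have ww: "w * w = of_int (lg (- 1))" unfolding w_def by (rule sqrt_gsum_sq)
  have u: "absp (upart a) = 1" "absp (upart b) = 1" using a b by (simp_all add: absp_upart)
  have m: "lg (upart a * upart b) = lg (upart a) * lg (upart b)" using u by (intro lg_mult) auto
  have q: "lg (upart a) * lg (upart a) = 1" "lg (upart b) * lg (upart b) = 1" "lg (- 1) * lg (- 1) = 1"
    using lg_square_eq_1 u by auto
  have "weil_gamma dx \<psi> (a * b) = weil_gamma dx \<psi> a * weil_gamma dx \<psi> b * of_int (hilbert a b)"
    if "odd (ordp p a)" "odd (ordp p b)"
  proof -
    have "of_int (lg (- 1) * lg (upart a)) * w * (of_int (lg (- 1) * lg (upart b)) * w) *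
        of_int (lg (- 1) * lg (upart a) * lg (upart b)) =
      (w * w) * of_int (lg (- 1) * (lg (- 1) * lg (- 1)) * (lg (upart a) * lg (upart a)) * (lg (upart b) * lg (upart b)))"
      by (simp add: mult_ac)
    also have "\<dots> = of_int (lg (- 1)) * of_int (lg (- 1))" unfolding ww q by simp
    also have "\<dots> = 1" unfolding of_int_mult[symmetric] q by simp
    finally show ?thesis
      unfolding weil_gamma_formula[OF a] weil_gamma_formula[OF b] weil_gamma_formula[OF ab]
        hilbert_formula[OF a b] w_def[symmetric]
      using that by (simp add: ordp_mult[OF a b])
  qed
  moreover have "of_int (lg (upart a)) * of_int (lg (upart a)) = (1 :: complex)"
    "of_int (lg (upart b)) * of_int (lg (upart b)) = (1 :: complex)"
    unfolding of_int_mult[symmetric] q by simp_all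
  ultimately show ?thesis
    unfolding weil_gamma_formula[OF a] weil_gamma_formula[OF b] weil_gamma_formula[OF ab]
      hilbert_formula[OF a b] w_def[symmetric] ordp_mult[OF a b] upart_mult[OF a b] m
    by (cases "even (ordp p a)"; cases "even (ordp p b)") (simp_all add: mult_ac)
qed

end

subsection \<open>The metaplectic group\<close>

text \<open>Associativity, and with it the cocycle identity, is supplied by the group structure
  contained in the Haar measure hypothesis.\<close>

locale metaplectic = padic p ty for p and ty :: "'a::{field_char_0,complete_space} itself" +
  assumes group_Mp: "group (Mp p :: 'a mp monoid)"
begin

sublocale G: group "Mp p :: 'a mp monoid"
  by (rule group_Mp)

abbreviation mp_mult :: "'a mp \<Rightarrow> 'a mp \<Rightarrow> 'a mp" (infixl "\<odot>" 70) where
  "g \<odot> h \<equiv> g \<otimes>\<^bsub>Mp p\<^esub> h"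

abbreviation mp_inv :: "'a mp \<Rightarrow> 'a mp" where
  "mp_inv g \<equiv> inv\<^bsub>Mp p\<^esub> g"

lemma carrier_Mp: "(A, e) \<in> carrier (Mp p) \<longleftrightarrow> A \<in> SL2 \<and> (e = 1 \<or> e = - 1)"
  by (auto simp: Mp_def full_preimage_def)

lemma mult_Mp: "(A, e) \<odot> (B, f) = (A ** B, e * f * cocycle p A B)"
  by (simp add: Mp_def)

lemma one_Mp: "\<one>\<^bsub>Mp p\<^esub> = (mat 1, 1)"
  by (simp add: Mp_def)

lemma fst_mult_Mp: "fst (g \<odot> h) = fst g ** fst h"
  by (cases g; cases h) (simp add: mult_Mp)

lemma Kbar_iff: "(A, e) \<in> Kbar p m \<longleftrightarrow> A \<in> K0 p m \<and> (e = 1 \<or> e = - 1)"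
  by (auto simp: Kbar_def full_preimage_def)

lemma Bbar_iff: "(A, e) \<in> Bbar \<longleftrightarrow> A \<in> borel_subgroup \<and> (e = 1 \<or> e = - 1)"
  by (auto simp: Bbar_def full_preimage_def)

lemma Kbar_carrier: "(k :: 'a mp) \<in> Kbar p m \<Longrightarrow> k \<in> carrier (Mp p)"
  using K0_subset_SL2 by (cases k) (auto simp: Kbar_iff carrier_Mp)

lemma Bbar_carrier: "(b :: 'a mp) \<in> Bbar \<Longrightarrow> b \<in> carrier (Mp p)"
  by (cases b) (auto simp: Bbar_iff carrier_Mp borel_subgroup_def)

lemma Kbar_mono: "n \<le> m \<Longrightarrow> k \<in> Kbar p m \<Longrightarrow> k \<in> (Kbar p n :: 'a mp set)"
  using K0_mono by (cases k) (auto simp: Kbar_iff)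

lemma mult_Kbar_1:
  "(A, e) \<in> Kbar p 1 \<Longrightarrow> (B, f) \<in> Kbar p 1 \<Longrightarrow> (A, e) \<odot> (B, f) = (A ** B, e * f)"
  by (simp add: mult_Mp Kbar_iff cocycle_K0)

lemma K0_mult:
  assumes m: "m \<ge> 1" and A: "A \<in> K0 p m" and B: "B \<in> (K0 p m :: ('a^2^2) set)"
  shows "A ** B \<in> K0 p m"
proof -
  have A1: "A \<in> K0 p 1" and B1: "B \<in> K0 p 1" using K0_mono[OF m] A B by auto
  obtain a b c d where A': "A = mat2 a b c d" by (rule mat2_cases)
  obtain a' b' c' d' where B': "B = mat2 a' b' c' d'" by (rule mat2_cases)
  have AB: "A ** B \<in> K0 p 1" using cocycle_K0(2)[OF A1 B1] .
  have "absp (x * y) \<le> 1 / real p ^ m" if "absp x \<le> 1" "absp y \<le> 1 / real p ^ m" for x y :: 'a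
    using mult_mono[OF that] by (simp add: absp_mult)
  then have "absp (a' * c + d * c') \<le> 1 / real p ^ m"
    using A B unfolding A' B' mat2_in_K0 by (intro absp_add_le) blast+
  then show ?thesis using AB unfolding A' B' mat2_mult mat2_in_K0 by (simp add: mult.commute)
qed

lemma Kbar_mult:
  assumes m: "m \<ge> 1" and k: "k \<in> Kbar p m" "k' \<in> Kbar p m"
  shows "k \<odot> k' \<in> Kbar p m"
proof -
  obtain A e B f where kk: "k = (A, e)" "k' = (B, f)" by (cases k; cases k')
  have "k \<odot> k' = (A ** B, e * f)"
    unfolding kk using Kbar_mono[OF m k(1)] Kbar_mono[OF m k(2)] by (intro mult_Kbar_1) (simp_all add: kk)
  then show ?thesis using k K0_mult[OF m, of A B] by (auto simp: kk Kbar_iff)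
qed

lemma fst_inv_Mp:
  assumes "(mat2 a b c d, e) \<in> carrier (Mp p)"
  shows "fst (mp_inv (mat2 a b c d, e)) = mat2 d (- b) (- c) a"
proof -
  let ?g = "(mat2 a b c d, e)"
  have det: "a * d - b * c = 1" using assms by (simp add: carrier_Mp)
  have "mp_inv ?g \<odot> ?g = \<one>\<^bsub>Mp p\<^esub>" using assms by (rule G.l_inv)
  then have "fst (mp_inv ?g) ** mat2 a b c d = mat 1" using fst_mult_Mp[of "mp_inv ?g" ?g] by (simp add: one_Mp)
  then have "fst (mp_inv ?g) ** mat2 a b c d ** mat2 d (- b) (- c) a = mat 1 ** mat2 d (- b) (- c) a" by simp
  moreover have "mat2 a b c d ** mat2 d (- b) (- c) a = mat 1"
    using det by (simp add: mat2_mult mat_1_eq_mat2 mult.commute)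
  ultimately show ?thesis by (simp add: matrix_mul_assoc[symmetric])
qed

lemma sign_inv_Mp: "g \<in> carrier (Mp p) \<Longrightarrow> snd (mp_inv g) = 1 \<or> snd (mp_inv g) = - 1"
  using G.inv_closed[of g] carrier_Mp[of "fst (mp_inv g)" "snd (mp_inv g)"] by simp

lemma Kbar_inv:
  assumes k: "k \<in> Kbar p m" shows "mp_inv k \<in> Kbar p m"
proof -
  obtain a b c d e where k': "k = (mat2 a b c d, e)" by (metis mat2_eta prod.collapse)
  have g: "k \<in> carrier (Mp p)" using k by (rule Kbar_carrier)
  have "fst (mp_inv k) = mat2 d (- b) (- c) a" using fst_inv_Mp[of a b c d e] g k' by simp
  then have "fst (mp_inv k) \<in> K0 p m" using k unfolding k' Kbar_iff mat2_in_K0 by (simp add: mat2_in_K0 mult.commute)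
  then show ?thesis using sign_inv_Mp[OF g] Kbar_iff[of "fst (mp_inv k)" "snd (mp_inv k)"] by simp
qed

lemma Bbar_cases:
  assumes "b \<in> Bbar"
  obtains a x d :: 'a and e where "b = (mat2 a x 0 d, e)" "a * d = 1" "e = 1 \<or> e = - 1"
  using assms by (cases b, cases "fst b" rule: mat2_cases) (auto simp: Bbar_iff)

lemma Bbar_mult:
  assumes "b \<in> Bbar" "b' \<in> Bbar" shows "b \<odot> b' \<in> Bbar"
proof -
  obtain a x d e where b: "b = (mat2 a x 0 d, e)" "a * d = 1" "e = 1 \<or> e = - 1"
    using assms(1) by (rule Bbar_cases)
  obtain a' x' d' e' where b': "b' = (mat2 a' x' 0 d', e')" "a' * d' = 1" "e' = 1 \<or> e' = - 1"
    using assms(2) by (rule Bbar_cases)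
  have "a * a' * (d * d') = 1" using b(2) b'(2) by (metis mult.assoc mult.commute mult_1)
  then show ?thesis using b(3) b'(3) cocycle_cases[of "mat2 a x 0 d" "mat2 a' x' 0 d'"]
    by (auto simp: b(1) b'(1) mult_Mp Bbar_iff mat2_mult)
qed

lemma Bbar_inv:
  assumes b: "b \<in> Bbar" shows "mp_inv b \<in> Bbar"
proof -
  obtain a x d e where b': "b = (mat2 a x 0 d, e)" "a * d = 1" "e = 1 \<or> e = - 1"
    using b by (rule Bbar_cases)
  have g: "b \<in> carrier (Mp p)" using b by (rule Bbar_carrier)
  have "fst (mp_inv b) = mat2 d (- x) (- 0) a" using fst_inv_Mp[of a x 0 d e] g b' by simp
  then have "fst (mp_inv b) \<in> borel_subgroup" using b'(2) by (simp add: mult.commute)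
  then show ?thesis using sign_inv_Mp[OF g] Bbar_iff[of "fst (mp_inv b)" "snd (mp_inv b)"] by simp
qed

text \<open>Cosets of the Borel subgroup are points of the projective line, given by the bottom row.
  As \<open>Bbar\<close> contains both lifts of each matrix, the sign of the quotient can remain
  unknown.\<close>

lemma borel_factor:
  assumes g: "g \<in> carrier (Mp p)" and h: "h \<in> carrier (Mp p)"
    and row: "fst g $ 2 $ 1 * fst h $ 2 $ 2 = fst g $ 2 $ 2 * fst h $ 2 $ 1"
  obtains b where "b \<in> Bbar" "g = b \<odot> h"
proof -
  define b where "b = g \<odot> mp_inv h"
  have bc: "b \<in> carrier (Mp p)" using g h by (simp add: b_def)
  obtain a' b' c' d' e' where h': "h = (mat2 a' b' c' d', e')" by (metis mat2_eta prod.collapse)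
  have "fst b = fst g ** mat2 d' (- b') (- c') a'"
    using fst_inv_Mp[of a' b' c' d' e'] h by (simp add: b_def fst_mult_Mp h')
  then have "fst b $ 2 $ 1 = 0"
    using row by (cases "fst g" rule: mat2_cases) (simp add: mat2_mult h')
  then have "b \<in> Bbar" using bc by (cases b) (auto simp: Bbar_iff carrier_Mp borel_subgroup_def)
  moreover have "g = b \<odot> h" using g h by (simp add: b_def G.m_assoc)
  ultimately show ?thesis by (rule that)
qed

section \<open>Torus and unipotent elements\<close>

definition diag :: "'a \<Rightarrow> 'a mp" where
  "diag t = (mat2 t 0 0 (1 / t), 1)"

definition upper :: "'a \<Rightarrow> 'a mp" where
  "upper s = (mat2 1 s 0 1, 1)"

lemma diag_in_Kbar: "absp t = 1 \<Longrightarrow> diag t \<in> Kbar p m"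
  by (cases "t = 0") (auto simp: diag_def Kbar_iff mat2_in_K0 absp_divide)

lemma diag_in_Bbar: "t \<noteq> 0 \<Longrightarrow> diag t \<in> Bbar"
  by (auto simp: diag_def Bbar_iff)

lemma upper_in_Kbar: "absp s \<le> 1 \<Longrightarrow> upper s \<in> Kbar p m"
  by (auto simp: upper_def Kbar_iff mat2_in_K0)

lemma y_elt_in_Kbar: "absp (s :: 'a) \<le> 1 / real p ^ m \<Longrightarrow> y_elt s \<in> Kbar p m"
  by (auto simp: y_elt_def Kbar_iff mat2_in_K0)

lemma y_elt_in_Kbar_1: "absp (s :: 'a) < 1 \<Longrightarrow> y_elt s \<in> Kbar p 1"
  using y_elt_in_Kbar[of s 1] by (simp add: absp_lt_1)

lemma y_elt_carrier: "y_elt (s :: 'a) \<in> carrier (Mp p)"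
  by (simp add: y_elt_def carrier_Mp)

lemma w_elt_carrier: "(w_elt :: 'a mp) \<in> carrier (Mp p)"
  by (simp add: w_elt_def carrier_Mp)

lemma y_elt_0: "y_elt (0 :: 'a) = \<one>\<^bsub>Mp p\<^esub>"
  by (simp add: y_elt_def one_Mp mat_1_eq_mat2)

lemma y_elt_add: "absp (s :: 'a) < 1 \<Longrightarrow> absp t < 1 \<Longrightarrow> y_elt s \<odot> y_elt t = y_elt (s + t)"
  using mult_Kbar_1[OF y_elt_in_Kbar_1[of s, unfolded y_elt_def] y_elt_in_Kbar_1[of t, unfolded y_elt_def]]
  by (simp add: y_elt_def mat2_mult)

lemma y_elt_inv: "absp (s :: 'a) < 1 \<Longrightarrow> mp_inv (y_elt s) = y_elt (- s)"
  using y_elt_add[of "- s" s] by (intro G.inv_equality) (simp_all add: y_elt_0 y_elt_carrier)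

text \<open>All factors lie in \<open>Kbar p 1\<close>, so this is an identity of matrices. Up to
  the torus, y(jp) therefore depends on the square class of a unit \<open>j\<close> only.\<close>

lemma y_elt_conj:
  assumes s: "absp s < 1" and t: "absp t = 1"
  shows "y_elt (s * t\<^sup>2) = diag (1 / t) \<odot> y_elt s \<odot> diag t"
proof -
  have t0: "t \<noteq> 0" using t by auto
  have t': "absp (1 / t) = 1" using t by (simp add: absp_divide)
  have k: "diag (1 / t) \<in> Kbar p 1" "y_elt s \<in> Kbar p 1" "diag t \<in> Kbar p 1"
    using diag_in_Kbar[OF t'] diag_in_Kbar[OF t] y_elt_in_Kbar_1[OF s] by auto
  have "diag (1 / t) \<odot> y_elt s = (mat2 (1 / t) 0 (t * s) t, 1)"
    using mult_Kbar_1[OF k(1)[unfolded diag_def] k(2)[unfolded y_elt_def]] t0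
    by (simp add: diag_def y_elt_def mat2_mult)
  moreover have "diag (1 / t) \<odot> y_elt s \<in> Kbar p 1" using Kbar_mult[OF _ k(1,2)] by simp
  ultimately show ?thesis
    using mult_Kbar_1[of "mat2 (1 / t) 0 (t * s) t" 1 "mat2 t 0 0 (1 / t)" 1] k(3) t0
    by (simp add: diag_def y_elt_def mat2_mult power2_eq_square mult_ac)
qed

lemma diag_w:
  assumes t: "absp t = 1"
  shows "diag t \<odot> w_elt = w_elt \<odot> diag (1 / t)"
proof -
  have t': "absp (1 / t) = 1" using t by (simp add: absp_divide)
  have "mat2 t 0 0 (1 / t) \<in> K0 p 1" "mat2 (1 / t) 0 0 (1 / (1 / t)) \<in> K0 p 1"
    using diag_in_Kbar[OF t, of 1] diag_in_Kbar[OF t', of 1] unfolding diag_def Kbar_iff by blast+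
  from cocycle_K0_w(1)[OF this(1)] cocycle_K0_w(2)[OF this(2)] show ?thesis
    by (simp add: diag_def w_elt_def mult_Mp mat2_mult)
qed

text \<open>A point of the projective line has \<open>d / c\<close> integral or \<open>c / d\<close>
  in the maximal ideal.\<close>

lemma decomposition:
  assumes g: "g \<in> carrier (Mp p)"
  shows "(\<exists>b\<in>Bbar. \<exists>s. absp s \<le> 1 \<and> g = b \<odot> (w_elt \<odot> upper s)) \<or> (\<exists>b\<in>Bbar. \<exists>z. absp z < 1 \<and> g = b \<odot> y_elt z)"
proof -
  define c where "c = fst g $ 2 $ 1"
  define d where "d = fst g $ 2 $ 2"
  show ?thesis
  proof (cases "absp c < absp d")
    case True
    then have "d \<noteq> 0" by auto
    then have "fst g $ 2 $ 1 * fst (y_elt (c / d)) $ 2 $ 2 = fst g $ 2 $ 2 * fst (y_elt (c / d)) $ 2 $ 1"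
      unfolding c_def[symmetric] d_def[symmetric] by (simp add: y_elt_def)
    then obtain b where "b \<in> Bbar" "g = b \<odot> y_elt (c / d)"
      by (rule borel_factor[OF g y_elt_carrier])
    moreover have "absp (c / d) < 1" using True \<open>d \<noteq> 0\<close> by (simp add: absp_divide)
    ultimately show ?thesis by blast
  next
    case False
    have "c \<noteq> 0"
    proof
      assume "c = 0"
      then have "d = 0" using False by simp
      then show False using g \<open>c = 0\<close> unfolding c_def d_def
        by (cases g, cases "fst g" rule: mat2_cases) (auto simp: carrier_Mp)
    qed
    have s: "absp (d / c) \<le> 1" using False \<open>c \<noteq> 0\<close> by (simp add: absp_divide)
    have hc: "w_elt \<odot> upper (d / c) \<in> carrier (Mp p)"
      using w_elt_carrier Kbar_carrier[OF upper_in_Kbar[OF s, of 1]] by (rule G.m_closed)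
    have "fst g $ 2 $ 1 * fst (w_elt \<odot> upper (d / c)) $ 2 $ 2 = fst g $ 2 $ 2 * fst (w_elt \<odot> upper (d / c)) $ 2 $ 1"
      unfolding c_def[symmetric] d_def[symmetric]
      using \<open>c \<noteq> 0\<close> by (simp add: fst_mult_Mp w_elt_def upper_def mat2_mult)
    then obtain b where "b \<in> Bbar" "g = b \<odot> (w_elt \<odot> upper (d / c))"
      by (rule borel_factor[OF g hc])
    then show ?thesis using s by blast
  qed
qed

section \<open>The topology of the cover\<close>

lemma istopology_Mp:
  "istopology (\<lambda>W. W \<subseteq> carrier (Mp p) \<and>
     (\<forall>g\<in>W. \<exists>U. open U \<and> (mat 1 :: 'a^2^2) \<in> U \<and> (\<forall>u \<in> U \<inter> SL2_Zp. g \<odot> (u, 1) \<in> W)))"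
  unfolding istopology_def
proof (rule conjI; intro allI impI)
  fix S T assume S: "S \<subseteq> carrier (Mp p) \<and>
     (\<forall>g\<in>S. \<exists>U. open U \<and> (mat 1 :: 'a^2^2) \<in> U \<and> (\<forall>u \<in> U \<inter> SL2_Zp. g \<odot> (u, 1) \<in> S))"
    and T: "T \<subseteq> carrier (Mp p) \<and>
     (\<forall>g\<in>T. \<exists>U. open U \<and> (mat 1 :: 'a^2^2) \<in> U \<and> (\<forall>u \<in> U \<inter> SL2_Zp. g \<odot> (u, 1) \<in> T))"
  have "\<exists>U. open U \<and> (mat 1 :: 'a^2^2) \<in> U \<and> (\<forall>u \<in> U \<inter> SL2_Zp. g \<odot> (u, 1) \<in> S \<inter> T)"
    if g: "g \<in> S \<inter> T" for g
  proof -
    obtain U where "open U" "(mat 1 :: 'a^2^2) \<in> U" "\<forall>u \<in> U \<inter> SL2_Zp. g \<odot> (u, 1) \<in> S" using S g by blast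
    moreover obtain U' where "open U'" "(mat 1 :: 'a^2^2) \<in> U'" "\<forall>u \<in> U' \<inter> SL2_Zp. g \<odot> (u, 1) \<in> T" using T g by blast
    ultimately show ?thesis by (intro exI[of _ "U \<inter> U'"]) auto
  qed
  then show "S \<inter> T \<subseteq> carrier (Mp p) \<and>
     (\<forall>g\<in>S \<inter> T. \<exists>U. open U \<and> (mat 1 :: 'a^2^2) \<in> U \<and> (\<forall>u \<in> U \<inter> SL2_Zp. g \<odot> (u, 1) \<in> S \<inter> T))"
    using S by blast
next
  fix \<K> :: "'a mp set set" assume K: "\<forall>W\<in>\<K>. W \<subseteq> carrier (Mp p) \<and>
     (\<forall>g\<in>W. \<exists>U. open U \<and> (mat 1 :: 'a^2^2) \<in> U \<and> (\<forall>u \<in> U \<inter> SL2_Zp. g \<odot> (u, 1) \<in> W))"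
  show "\<Union>\<K> \<subseteq> carrier (Mp p) \<and>
     (\<forall>g\<in>\<Union>\<K>. \<exists>U. open U \<and> (mat 1 :: 'a^2^2) \<in> U \<and> (\<forall>u \<in> U \<inter> SL2_Zp. g \<odot> (u, 1) \<in> \<Union>\<K>))"
  proof (intro conjI ballI)
    fix g assume "g \<in> \<Union>\<K>"
    then obtain W where W: "W \<in> \<K>" "g \<in> W" by blast
    from bspec[OF K W(1)] have "\<forall>g\<in>W. \<exists>U. open U \<and> (mat 1 :: 'a^2^2) \<in> U \<and> (\<forall>u \<in> U \<inter> SL2_Zp. g \<odot> (u, 1) \<in> W)"
      by (rule conjunct2)
    from bspec[OF this W(2)] obtain U where U: "open U \<and> (mat 1 :: 'a^2^2) \<in> U \<and> (\<forall>u \<in> U \<inter> SL2_Zp. g \<odot> (u, 1) \<in> W)"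
      by (rule exE)
    then show "\<exists>U. open U \<and> (mat 1 :: 'a^2^2) \<in> U \<and> (\<forall>u \<in> U \<inter> SL2_Zp. g \<odot> (u, 1) \<in> \<Union>\<K>)"
      using W(1) by (intro exI[of _ U]) blast
  qed (use K in blast)
qed

lemma openin_Mp:
  "openin (Mp_topology p) W \<longleftrightarrow> W \<subseteq> carrier (Mp p) \<and>
     (\<forall>g\<in>W. \<exists>U. open U \<and> (mat 1 :: 'a^2^2) \<in> U \<and> (\<forall>u \<in> U \<inter> SL2_Zp. g \<odot> (u, 1) \<in> W))"
  unfolding Mp_topology_def topology_inverse'[OF istopology_Mp] by (rule refl)

definition near_1 :: "nat \<Rightarrow> ('a^2^2) set" where
  "near_1 m = {A. \<forall>i j. A $ i $ j - mat 1 $ i $ j \<in> pball (int m)}"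

lemma open_near_1: "open (near_1 m)"
proof -
  have "near_1 m = (\<Inter>i. \<Inter>j. (\<lambda>A. A $ i) -` ((\<lambda>v. v $ j) -` coset (mat 1 $ i $ j) (int m)))"
    by (auto simp: near_1_def coset_def)
  also have "open \<dots>" by (intro open_INT ballI finite open_vimage_vec_nth open_coset)
  finally show ?thesis .
qed

lemma mat_1_near_1: "mat 1 \<in> near_1 m"
  by (simp add: near_1_def)

lemma near_1_Kbar:
  assumes "u \<in> near_1 m \<inter> SL2_Zp"
  shows "(u, 1) \<in> Kbar p m" and "absp (u $ 2 $ 2 - 1) \<le> 1 / real p ^ m"
proof -
  obtain a b c d where u: "u = mat2 a b c d" by (rule mat2_cases)
  have h: "mat2 a b c d $ i $ j - mat2 1 0 0 1 $ i $ j \<in> pball (int m)" for i j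
    using assms unfolding u near_1_def mat_1_eq_mat2 by blast
  have "c - 0 \<in> pball (int m)" "d - 1 \<in> pball (int m)" using h[of 2 1] h[of 2 2] by simp_all
  then have "absp c \<le> 1 / real p ^ m" "absp (d - 1) \<le> 1 / real p ^ m"
    by (simp_all add: pball_iff power_int_minus inverse_eq_divide)
  then show "(u, 1) \<in> Kbar p m" "absp (u $ 2 $ 2 - 1) \<le> 1 / real p ^ m"
    using assms by (simp_all add: u Kbar_iff K0_def pow_ideal_iff)
qed

text \<open>The condition on \<open>u\<close> describes an open subgroup on which eta is going to be
  trivial. Every preimage under an equivariant function is invariant under it, hence open; this
  yields local constancy and measurability at once.\<close>

lemma openin_Mp_invariant:
  assumes W: "W \<subseteq> carrier (Mp p)"
    and inv: "\<And>g u. g \<in> W \<Longrightarrow> (u, 1) \<in> Kbar p 2 \<Longrightarrow> absp (u $ 2 $ 2 - 1) < 1 \<Longrightarrow> g \<odot> (u, 1) \<in> W"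
  shows "openin (Mp_topology p) W"
  unfolding openin_Mp
proof (intro conjI W ballI)
  fix g assume g: "g \<in> W"
  have lt: "1 / real p ^ 2 < 1" using p_gt_1 by simp
  have "g \<odot> (u, 1) \<in> W" if "u \<in> near_1 2 \<inter> SL2_Zp" for u
    using near_1_Kbar(1)[OF that] order_le_less_trans[OF near_1_Kbar(2)[OF that] lt] by (rule inv[OF g])
  then show "\<exists>U. open U \<and> (mat 1 :: 'a^2^2) \<in> U \<and> (\<forall>u \<in> U \<inter> SL2_Zp. g \<odot> (u, 1) \<in> W)"
    using open_near_1 mat_1_near_1 by (intro exI[of _ "near_1 2"]) blast
qed

end

subsection \<open>Equivariant functions of the principal series\<close>

text \<open>Conductor exponent 1 enters as triviality of \<mu> near 1. The trivial and the quadratic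
  \<eta> are treated alike, as characters of the residues with values 1 and -1.\<close>

locale principal = padic_psi p ty dx \<psi> + metaplectic p ty
  for p and ty :: "'a::{field_char_0,complete_space} itself" and dx \<psi> +
  fixes \<mu> \<eta> :: "'a \<Rightarrow> complex"
  assumes mu: "mult_character \<mu>"
    and mu_near_1: "\<And>u. absp (u - 1) < 1 \<Longrightarrow> \<mu> u = 1"
    and eta_cases: "\<And>u. absp u = 1 \<Longrightarrow> \<eta> u = 1 \<or> \<eta> u = - 1"
    and eta_mult: "\<And>u v. absp u = 1 \<Longrightarrow> absp v = 1 \<Longrightarrow> \<eta> (u * v) = \<eta> u * \<eta> v"
    and eta_cong: "\<And>u v. absp u = 1 \<Longrightarrow> absp (u - v) < 1 \<Longrightarrow> \<eta> u = \<eta> v"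
    and eta_mu: "\<exists>u. absp u = 1 \<and> \<eta> u * \<mu> u \<noteq> 1"
begin

abbreviation muB :: "'a mp \<Rightarrow> complex" where "muB \<equiv> mu_B dx \<psi> \<mu>"
abbreviation eta' :: "'a mp \<Rightarrow> complex" where "eta' \<equiv> eta_ext \<eta>"
abbreviation VE :: "nat \<Rightarrow> ('a mp \<Rightarrow> complex) set" where "VE \<equiv> V_eta p dx \<psi> \<mu> \<eta>"

lemma mu_mult: "x \<noteq> 0 \<Longrightarrow> y \<noteq> 0 \<Longrightarrow> \<mu> (x * y) = \<mu> x * \<mu> y"
  using mu by (simp add: mult_character_def)

lemma mu_1 [simp]: "\<mu> 1 = 1"
  by (rule mu_near_1) simp

lemma eta_1 [simp]: "\<eta> 1 = 1"
  using eta_cases[of 1] eta_mult[of 1 1] by auto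

lemma eta_sq: "absp u = 1 \<Longrightarrow> \<eta> u * \<eta> u = 1"
  using eta_cases by fastforce

lemma eta_inverse: "absp u = 1 \<Longrightarrow> \<eta> (1 / u) = \<eta> u"
proof -
  assume u: "absp u = 1"
  then have u0: "u \<noteq> 0" by auto
  have "\<eta> u * \<eta> (1 / u) = 1" using eta_mult[OF u, of "1 / u"] u u0 by (simp add: absp_divide)
  then have "\<eta> u * (\<eta> u * \<eta> (1 / u)) = \<eta> u" by simp
  then show ?thesis using eta_sq[OF u] by (simp flip: mult.assoc)
qed

lemma eta'_mult:
  assumes "k \<in> Kbar p 1" "k' \<in> Kbar p 1"
  shows "eta' (k \<odot> k') = eta' k * eta' k'"
proof -
  obtain A e B f where kk: "k = (A, e)" "k' = (B, f)" by (cases k; cases k')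
  have K: "A \<in> K0 p 1" "B \<in> K0 p 1" using assms by (simp_all add: kk Kbar_iff)
  obtain a b c d where A: "A = mat2 a b c d" "absp d = 1" "absp c < 1" using K(1) by (rule K0_1_cases)
  obtain a' b' c' d' where B: "B = mat2 a' b' c' d'" "absp d' = 1" "absp b' \<le> 1" using K(2) by (rule K0_1_cases)
  have "absp (c * b') \<le> absp c * 1" unfolding absp_mult using B by (intro mult_left_mono) auto
  then have "absp (d * d' - (c * b' + d * d')) < 1" using A(3) by simp
  then have "\<eta> (c * b' + d * d') = \<eta> (d * d')"
    using A(2) B(2) by (intro eta_cong[symmetric]) (simp_all add: absp_mult)
  also have "\<dots> = \<eta> d * \<eta> d'" using A(2) B(2) by (rule eta_mult)
  finally show ?thesis
    using mult_Kbar_1[of A e B f] assms by (simp add: kk eta_ext_def A(1) B(1) mat2_mult)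
qed

lemma eta'_cases:
  assumes "k \<in> Kbar p 1" shows "eta' k = 1 \<or> eta' k = - 1"
proof -
  obtain A e where kk: "k = (A, e)" by (cases k)
  have K: "A \<in> K0 p 1" and e: "e = 1 \<or> e = - 1" using assms by (simp_all add: kk Kbar_iff)
  obtain a b c d where A: "A = mat2 a b c d" "absp d = 1" using K by (rule K0_1_cases)
  show ?thesis using e eta_cases[OF A(2)] by (auto simp: kk A eta_ext_def)
qed

lemma cnj_eta': "k \<in> Kbar p 1 \<Longrightarrow> cnj (eta' k) = eta' k"
  using eta'_cases by fastforce

lemma eta'_sq: "k \<in> Kbar p 1 \<Longrightarrow> eta' k * eta' k = 1"
  using eta'_cases by fastforce

lemma eta'_inv:
  assumes k: "k \<in> Kbar p 1" shows "eta' (mp_inv k) = eta' k"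
proof -
  have k': "mp_inv k \<in> Kbar p 1" using k by (rule Kbar_inv)
  have "eta' (mp_inv k \<odot> k) = 1"
    using Kbar_carrier[OF k] by (simp add: one_Mp mat_1_eq_mat2 eta_ext_def)
  then have "eta' (mp_inv k) * eta' k = 1" using eta'_mult[OF k' k] by simp
  then show ?thesis using eta'_cases[OF k] eta'_cases[OF k'] by auto
qed

lemma eta'_y_elt [simp]: "eta' (y_elt s) = 1"
  by (simp add: eta_ext_def y_elt_def)

lemma eta'_diag: "eta' (diag t) = \<eta> (1 / t)"
  by (simp add: eta_ext_def diag_def)

lemma muB_mult:
  assumes "b \<in> Bbar" "b' \<in> Bbar" shows "muB (b \<odot> b') = muB b * muB b'"
proof -
  obtain a x d e where b: "b = (mat2 a x 0 d, e)" "a * d = 1" "e = 1 \<or> e = - 1"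
    using assms(1) by (rule Bbar_cases)
  obtain a' x' d' e' where b': "b' = (mat2 a' x' 0 d', e')" "a' * d' = 1" "e' = 1 \<or> e' = - 1"
    using assms(2) by (rule Bbar_cases)
  have a0: "a \<noteq> 0" "a' \<noteq> 0" using b(2) b'(2) by auto
  have bb: "b \<odot> b' = (mat2 (a * a') (a * x' + x * d') 0 (d * d'), e * e' * hilbert a a')"
    using cocycle_borel[OF b(2) b'(2)] by (simp add: b(1) b'(1) mult_Mp mat2_mult)
  have h: "complex_of_int (hilbert a a') * inverse (of_int (hilbert a a')) = 1"
    using hilbert_cases[of a a'] by auto
  have "muB (b \<odot> b') = of_int (e * e' * hilbert a a') * of_real (absp a * absp a') * (\<mu> a * \<mu> a') *
      inverse (weil_gamma dx \<psi> a * weil_gamma dx \<psi> a' * of_int (hilbert a a'))"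
    unfolding bb by (simp add: mu_B_def Let_def absp_mult mu_mult[OF a0] weil_gamma_mult[OF a0])
  also have "\<dots> = muB b * muB b' * (of_int (hilbert a a') * inverse (of_int (hilbert a a')))"
    by (simp add: mu_B_def Let_def b(1) b'(1) inverse_mult_distrib mult_ac)
  finally show ?thesis unfolding h by simp
qed

lemma muB_diag: "absp t = 1 \<Longrightarrow> muB (diag t) = \<mu> t"
  by (simp add: mu_B_def diag_def weil_gamma_unit)

lemma VE_off: "v \<in> VE m \<Longrightarrow> g \<notin> carrier (Mp p) \<Longrightarrow> v g = 0"
  and VE_left: "v \<in> VE m \<Longrightarrow> b \<in> Bbar \<Longrightarrow> g \<in> carrier (Mp p) \<Longrightarrow> v (b \<odot> g) = muB b * v g"
  and VE_right: "v \<in> VE m \<Longrightarrow> g \<in> carrier (Mp p) \<Longrightarrow> k \<in> Kbar p m \<Longrightarrow> v (g \<odot> k) = v g * eta' k"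
  unfolding V_eta_def V_space_def by blast+

text \<open>Local constancy comes for free from right equivariance.\<close>

lemma VE_2_I:
  fixes v :: "'a mp \<Rightarrow> complex"
  assumes off: "\<And>g. g \<notin> carrier (Mp p) \<Longrightarrow> v g = 0"
    and left: "\<And>b g. b \<in> Bbar \<Longrightarrow> g \<in> carrier (Mp p) \<Longrightarrow> v (b \<odot> g) = muB b * v g"
    and right: "\<And>g k. g \<in> carrier (Mp p) \<Longrightarrow> k \<in> Kbar p 2 \<Longrightarrow> v (g \<odot> k) = v g * eta' k"
  shows "v \<in> VE 2"
proof -
  have "\<exists>W. openin (Mp_topology p) W \<and> g \<in> W \<and> (\<forall>h\<in>W. v h = v g)" if g: "g \<in> carrier (Mp p)" for g
  proof (intro exI conjI)
    let ?W = "{h \<in> carrier (Mp p). v h = v g}"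
    show "openin (Mp_topology p) ?W"
    proof (rule openin_Mp_invariant)
      fix h :: "'a mp" and u :: "'a^2^2"
      assume h: "h \<in> ?W" and u: "(u, 1) \<in> Kbar p 2" "absp (u $ 2 $ 2 - 1) < 1"
      have "\<eta> 1 = \<eta> (u $ 2 $ 2)" using u(2) by (intro eta_cong) (simp_all add: absp_diff_commute)
      then have "eta' (u, 1) = 1" by (simp add: eta_ext_def)
      then show "h \<odot> (u, 1) \<in> ?W" using h right[OF _ u(1), of h] Kbar_carrier[OF u(1)] by simp
    qed auto
  qed (use g in auto)
  then show ?thesis unfolding V_eta_def V_space_def using off left right by blast
qed

text \<open>The element \<open>diag u\<close> can be moved past 1 and past \<open>w(1)\<close>. It
  acts by mu(u) on the left and by eta(u) on the right, and these differ for some \<open>u\<close>.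
  At \<open>w(1)\<close> it comes out inverted, but eta is quadratic on units.\<close>

lemma VE_at_1_and_w:
  assumes v: "v \<in> VE m"
  shows "v \<one>\<^bsub>Mp p\<^esub> = 0" and "v w_elt = 0"
proof -
  obtain u where u: "absp u = 1" "\<eta> u * \<mu> u \<noteq> 1" using eta_mu by blast
  have u': "absp (1 / u) = 1" "u \<noteq> 0" using u by (auto simp: absp_divide)
  have ne: "\<mu> u \<noteq> \<eta> u" using u eta_sq by auto
  have kc: "diag u \<in> carrier (Mp p)" using Kbar_carrier[OF diag_in_Kbar[OF u(1)]] .
  have "v (diag u \<odot> \<one>\<^bsub>Mp p\<^esub>) = \<mu> u * v \<one>\<^bsub>Mp p\<^esub>"
    using VE_left[OF v diag_in_Bbar[OF u'(2)], of "\<one>\<^bsub>Mp p\<^esub>"] muB_diag[OF u(1)] by simp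
  moreover have "v (\<one>\<^bsub>Mp p\<^esub> \<odot> diag u) = v \<one>\<^bsub>Mp p\<^esub> * \<eta> u"
    using VE_right[OF v _ diag_in_Kbar[OF u(1)], of "\<one>\<^bsub>Mp p\<^esub>"] eta'_diag eta_inverse[OF u(1)] by simp
  ultimately have "(\<mu> u - \<eta> u) * v \<one>\<^bsub>Mp p\<^esub> = 0" using kc by (simp add: left_diff_distrib mult.commute)
  then show "v \<one>\<^bsub>Mp p\<^esub> = 0" using ne by simp
  have "v (diag u \<odot> w_elt) = \<mu> u * v w_elt"
    using VE_left[OF v diag_in_Bbar[OF u'(2)] w_elt_carrier] muB_diag[OF u(1)] by simp
  moreover have "v (w_elt \<odot> diag (1 / u)) = v w_elt * \<eta> u"
    using VE_right[OF v w_elt_carrier diag_in_Kbar[OF u'(1)]] by (simp add: eta'_diag)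
  ultimately have "(\<mu> u - \<eta> u) * v w_elt = 0" using diag_w[OF u(1)] by (auto simp: left_diff_distrib mult.commute)
  then show "v w_elt = 0" using ne by simp
qed

lemma VE_big_cell:
  assumes v: "v \<in> VE m" and b: "b \<in> Bbar" and s: "absp s \<le> 1"
  shows "v (b \<odot> (w_elt \<odot> upper s)) = 0"
proof -
  have k: "upper s \<in> Kbar p m" using s by (rule upper_in_Kbar)
  have "v (b \<odot> (w_elt \<odot> upper s)) = muB b * (v w_elt * eta' (upper s))"
    using VE_left[OF v b] VE_right[OF v w_elt_carrier k] w_elt_carrier Kbar_carrier[OF k] by simp
  then show ?thesis using VE_at_1_and_w[OF v] by simp
qed

text \<open>At level at most 1 each y(z) with z in the maximal ideal belongs to
  \<open>Kbar p m\<close>, so vanishing at 1 and at \<open>w(1)\<close> propagates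
  everywhere.\<close>

lemma VE_low_level:
  assumes v: "v \<in> VE m" and m: "m \<le> 1"
  shows "v = 0"
proof (rule ext)
  fix g :: "'a mp"
  show "v g = 0 g"
  proof (cases "g \<in> carrier (Mp p)")
    case True
    from decomposition[OF this] show ?thesis
    proof (elim disjE bexE exE conjE)
      fix b s assume "b \<in> Bbar" "absp s \<le> 1" "g = b \<odot> (w_elt \<odot> upper s)"
      then show ?thesis using VE_big_cell[OF v] by simp
    next
      fix b and z :: 'a assume b: "b \<in> Bbar" and z: "absp z < 1" and g: "g = b \<odot> y_elt z"
      have k: "y_elt z \<in> Kbar p m" using Kbar_mono[OF m y_elt_in_Kbar_1[OF z]] .
      have "v (\<one>\<^bsub>Mp p\<^esub> \<odot> y_elt z) = v \<one>\<^bsub>Mp p\<^esub> * eta' (y_elt z)"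
        by (rule VE_right[OF v _ k]) simp
      then show ?thesis using VE_left[OF v b y_elt_carrier] VE_at_1_and_w[OF v] y_elt_carrier
        by (simp add: g)
    qed
  qed (simp add: VE_off[OF v])
qed

text \<open>The central element \<open>diag (- 1)\<close> acts by mu(-1) from the left and by
  eta(-1) from the right.\<close>

lemma sign_condition:
  assumes v: "v \<in> VE m" and "v \<noteq> 0"
  shows "\<mu> (- 1) = \<eta> (- 1)"
proof -
  obtain g where g: "v g \<noteq> 0" using assms(2) by (auto simp: fun_eq_iff)
  then have gc: "g \<in> carrier (Mp p)" using VE_off[OF v] by blast
  have d: "diag (- 1) = (mat2 (- 1) 0 0 (- 1), 1)" by (simp add: diag_def)
  have a: "absp (- 1 :: 'a) = 1" by simp
  have "diag (- 1) \<odot> g = g \<odot> diag (- 1)"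
  proof -
    obtain A e where "g = (A, e)" by (cases g)
    moreover have "mat2 (- 1) 0 0 (- 1) ** A = A ** mat2 (- 1) 0 0 (- 1)"
      by (cases A rule: mat2_cases) (simp add: mat2_mult)
    ultimately show ?thesis by (simp add: d mult_Mp cocycle_minus_1)
  qed
  moreover have "v (diag (- 1) \<odot> g) = \<mu> (- 1) * v g"
    using VE_left[OF v diag_in_Bbar gc, of "- 1"] muB_diag[OF a] by simp
  moreover have "v (g \<odot> diag (- 1)) = v g * \<eta> (- 1)"
    using VE_right[OF v gc diag_in_Kbar[OF a]] by (simp add: eta'_diag)
  ultimately show ?thesis using g by simp
qed

text \<open>Values on the part of the projective line where a vector of level 2 can be nonzero; on
  integral \<open>z\<close> only the residue matters.\<close>

definition ph :: "('a mp \<Rightarrow> complex) \<Rightarrow> 'a \<Rightarrow> complex" where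
  "ph v z = v (y_elt (z * of_nat p))"

lemma mult_p_small: "absp (z :: 'a) \<le> 1 \<Longrightarrow> absp (z * of_nat p) < 1"
  unfolding absp_lt_1 using p_gt_0 by (simp add: absp_mult field_simps)

lemma mult_p_small': "absp (z :: 'a) < 1 \<Longrightarrow> absp (z * of_nat p) \<le> 1 / real p ^ 2"
  unfolding absp_lt_1 using p_gt_0 by (simp add: absp_mult power2_eq_square field_simps)

lemma ph_cong:
  assumes v: "v \<in> VE 2" and z: "absp z \<le> 1" and zz: "absp (z - z') < 1"
  shows "ph v z = ph v z'"
proof -
  have d: "absp (z' - z) < 1" using zz absp_diff_commute[of z z'] by simp
  have k: "y_elt ((z' - z) * of_nat p) \<in> Kbar p 2" using mult_p_small'[OF d] by (rule y_elt_in_Kbar)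
  have "y_elt (z * of_nat p) \<odot> y_elt ((z' - z) * of_nat p) = y_elt (z * of_nat p + (z' - z) * of_nat p)"
    using mult_p_small[OF z] mult_p_small[of "z' - z"] d by (intro y_elt_add) auto
  also have "z * of_nat p + (z' - z) * of_nat p = z' * of_nat p" by (simp add: algebra_simps)
  finally have "ph v z' = v (y_elt (z * of_nat p) \<odot> y_elt ((z' - z) * of_nat p))" by (simp add: ph_def)
  also have "\<dots> = ph v z" using VE_right[OF v y_elt_carrier k] by (simp add: ph_def)
  finally show ?thesis by simp
qed

lemma ph_0: "v \<in> VE m \<Longrightarrow> ph v 0 = 0"
  using VE_at_1_and_w by (simp add: ph_def y_elt_0)

definition chi :: "'a \<Rightarrow> complex" where
  "chi t = \<mu> (1 / t) * \<eta> t"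

lemma ph_square:
  assumes v: "v \<in> VE 2" and z: "absp z \<le> 1" and t: "absp t = 1"
  shows "ph v (z * t\<^sup>2) = chi t * ph v z"
proof -
  have t': "absp (1 / t) = 1" "t \<noteq> 0" using t by (auto simp: absp_divide)
  let ?y = "y_elt (z * of_nat p)"
  have kc: "diag t \<in> carrier (Mp p)" "diag (1 / t) \<in> carrier (Mp p)"
    using Kbar_carrier diag_in_Kbar t t' by blast+
  have "ph v (z * t\<^sup>2) = v (diag (1 / t) \<odot> ?y \<odot> diag t)"
    using y_elt_conj[OF mult_p_small[OF z] t] by (simp add: ph_def mult_ac)
  also have "\<dots> = v (diag (1 / t) \<odot> (?y \<odot> diag t))" using kc y_elt_carrier by (simp add: G.m_assoc)
  also have "\<dots> = \<mu> (1 / t) * (ph v z * \<eta> (1 / t))"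
    using VE_left[OF v diag_in_Bbar, of "1 / t" "?y \<odot> diag t"] VE_right[OF v y_elt_carrier diag_in_Kbar[OF t]]
      muB_diag[OF t'(1)] t' kc y_elt_carrier by (simp add: ph_def eta'_diag)
  finally show ?thesis by (simp add: chi_def eta_inverse[OF t] mult_ac)
qed

lemma chi_nontrivial: "\<exists>t. absp t = 1 \<and> chi t \<noteq> 1"
proof -
  obtain u where u: "absp u = 1" "\<eta> u * \<mu> u \<noteq> 1" using eta_mu by blast
  have "absp (1 / u) = 1" using u by (simp add: absp_divide)
  moreover have "chi (1 / u) = \<eta> u * \<mu> u" using eta_inverse[OF u(1)] by (simp add: chi_def mult.commute)
  ultimately show ?thesis using u by metis
qed

text \<open>By \<open>ph_square\<close> each of the two square classes of units is governed by one
  value; at all other points of the projective line the vector vanishes anyway.\<close>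

lemma VE_2_eq_0:
  assumes v: "v \<in> VE 2" and l: "absp l = 1" "lg l = - 1" and 1: "ph v 1 = 0" and 2: "ph v l = 0"
  shows "v = 0"
proof (rule ext)
  fix g :: "'a mp"
  show "v g = 0 g"
  proof (cases "g \<in> carrier (Mp p)")
    case True
    from decomposition[OF this] show ?thesis
    proof (elim disjE bexE exE conjE)
      fix b s assume "b \<in> Bbar" "absp s \<le> 1" "g = b \<odot> (w_elt \<odot> upper s)"
      then show ?thesis using VE_big_cell[OF v] by simp
    next
      fix b and z :: 'a assume b: "b \<in> Bbar" and z: "absp z < 1" and g: "g = b \<odot> y_elt z"
      define z' where "z' = z / of_nat p"
      have z': "z = z' * of_nat p" "absp z' \<le> 1"
        using z p_gt_0 unfolding absp_lt_1 by (simp_all add: z'_def absp_divide field_simps)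
      have "ph v z' = 0"
      proof (cases "absp z' < 1")
        case True
        then show ?thesis using ph_cong[OF v z'(2), of 0] ph_0[OF v] by simp
      next
        case False
        then have u: "absp z' = 1" using z' by simp
        from lg_cases[OF u] show ?thesis
        proof
          assume "lg z' = 1"
          then obtain t where t: "z' = 1 * t\<^sup>2" "absp t = 1"
            using nonresidue_square_class[of 1 z'] u by (metis absp_1 lg_1)
          then show ?thesis using ph_square[OF v, of 1 t] 1 by simp
        next
          assume "lg z' = - 1"
          then have "lg l = lg z'" using l by simp
          then obtain t where t: "z' = l * t\<^sup>2" "absp t = 1" by (rule nonresidue_square_class[OF l(1) u])
          then show ?thesis using ph_square[OF v, of l t] 2 l by simp
        qed
      qed
      then show ?thesis using VE_left[OF v b y_elt_carrier] by (simp add: g z'(1) ph_def)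
    qed
  qed (simp add: VE_off[OF v])
qed

end

section \<open>The functions supported on one double coset\<close>

locale principal_even = principal p ty dx \<psi> \<mu> \<eta>
  for p and ty :: "'a::{field_char_0,complete_space} itself" and dx \<psi> \<mu> \<eta> +
  assumes sign: "\<mu> (- 1) = \<eta> (- 1)"
begin

text \<open>If \<open>b (y(s),1) = (y(s),1) k\<close> with \<open>ord s = 1\<close>, then the diagonal entries of \<open>k\<close> agree modulo
  \<open>p\<close>, so they are \<open>1\<close> or \<open>- 1\<close> modulo \<open>p\<close>.\<close>
lemma muB_eq_eta':
  assumes b: "b \<in> Bbar" and k: "k \<in> Kbar p 2" and s: "absp s = 1 / real p"
    and eq: "b \<odot> y_elt s = y_elt s \<odot> k"
  shows "muB b = eta' k"
proof -
  obtain a x d e where b': "b = (mat2 a x 0 d, e)" "a * d = 1" "e = 1 \<or> e = - 1"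
    using b by (rule Bbar_cases)
  obtain K e' where k': "k = (K, e')" by (cases k)
  have k1: "k \<in> Kbar p 1" using Kbar_mono[OF _ k, of 1] by simp
  have KK: "K \<in> K0 p 2" "K \<in> K0 p 1" using k k1 by (simp_all add: k' Kbar_iff)
  obtain a' b'' c' d' where K: "K = mat2 a' b'' c' d'" "absp a' = 1" "absp b'' \<le> 1" "absp d' = 1"
    "absp (a' * d' - 1) < 1" using KK(2) by (rule K0_1_cases)
  have c': "absp c' \<le> 1 / real p ^ 2" using KK(1) by (simp add: K mat2_in_K0)
  have s1: "absp s < 1" "s \<noteq> 0" using s p_gt_1 by auto
  have sle: "absp (y * s) < 1" if "absp y \<le> 1" for y
    unfolding absp_mult using mult_right_mono[OF that absp_ge_0[of s]] s1(1) by linarith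
  have "mat2 (a + x * s) x (d * s) d = mat2 a' b'' (s * a' + c') (s * b'' + d')"
    using arg_cong[OF eq, of fst] by (simp add: fst_mult_Mp b'(1) k' K(1) y_elt_def mat2_mult del: mat2_eq_iff)
  then have m: "a + x * s = a'" "x = b''" "d * s = s * a' + c'" "d = s * b'' + d'"
    unfolding mat2_eq_iff by blast+
  have dd: "absp (d - d') < 1" using sle[OF K(3)] m(4) by (simp add: mult.commute)
  then have d1: "absp d = 1" using absp_eq_of_close[of d d'] K(4) by simp
  have "absp (a * d) = 1" using b'(2) by simp
  then have a1: "absp a = 1" using d1 by (simp add: absp_mult)
  have "mat2 a x 0 d \<in> K0 p 1"
    unfolding K0_1_iff using b'(2) a1 d1 K(3) m(2) by simp
  then have bK: "(mat2 a x 0 d, e) \<in> Kbar p 1" using b'(3) by (simp add: Kbar_iff)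
  have yK: "(mat2 1 0 s 1, 1) \<in> Kbar p 1" using y_elt_in_Kbar_1[OF s1(1)] by (simp add: y_elt_def)
  have ee: "e = e'"
    using eq mult_Kbar_1[OF bK yK] mult_Kbar_1[OF yK k1[unfolded k']] by (simp add: b'(1) k' y_elt_def)
  \<comment> \<open>The division costs one power of \<open>p\<close>; level 2 leaves one to
    spare.\<close>
  have "d - a' = c' / s" using m(3) s1 by (simp add: field_simps)
  then have "absp (d - a') = absp c' * real p" using s by (simp add: absp_divide)
  also have "\<dots> \<le> 1 / real p ^ 2 * real p" using c' by (intro mult_right_mono) auto
  also have "\<dots> < 1" using p_gt_1 by (simp add: power2_eq_square)
  finally have da: "absp (d - a') < 1" .
  \<comment> \<open>Now a' = d' modulo \<open>p\<close>, and a' d' = 1 modulo \<open>p\<close>, so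
    d' is a root of X^2 = 1.\<close>
  have "absp ((d - a') - (d - d')) < 1" using da dd by (rule absp_diff_less)
  then have "absp (d' * (d' - a')) < 1" using K(4) by (simp add: absp_mult)
  from absp_add_less[OF this K(5)] have "absp ((d' - 1) * (d' + 1)) < 1" by (simp add: algebra_simps)
  then have "absp (d' - 1) < 1 \<or> absp (d' + 1) < 1"
    unfolding absp_mult by (metis absp_ge_0 linorder_not_le mult_mono' mult_1 zero_le_one)
  \<comment> \<open>Near 1 both characters are trivial; near - 1 they agree by the sign
    condition.\<close>
  then have "\<mu> a = \<eta> d'"
  proof
    assume h: "absp (d' - 1) < 1"
    have "absp ((d - d') + (d' - 1)) < 1" using dd h by (rule absp_add_less)
    moreover have "a - 1 = - (a * ((d - d') + (d' - 1)))" using b'(2) by (simp add: algebra_simps)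
    ultimately have "absp (a - 1) < 1" using a1 by (simp add: absp_mult)
    then have "\<mu> a = 1" by (rule mu_near_1)
    moreover have "\<eta> d' = \<eta> 1" using K(4) h by (rule eta_cong)
    ultimately show ?thesis by simp
  next
    assume h: "absp (d' + 1) < 1"
    have "absp ((d - d') + (d' + 1)) < 1" using dd h by (rule absp_add_less)
    moreover have "- a - 1 = - (a * ((d - d') + (d' + 1)))" using b'(2) by (simp add: algebra_simps)
    ultimately have "absp (- a - 1) < 1" using a1 by (simp add: absp_mult)
    then have "\<mu> (- a) = 1" by (rule mu_near_1)
    moreover have "a \<noteq> 0" using a1 by auto
    then have "\<mu> a = \<mu> (- 1) * \<mu> (- a)" using mu_mult[of "- 1" "- a"] by simp
    moreover have "\<eta> d' = \<eta> (- 1)" using K(4) h by (intro eta_cong) simp_all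
    ultimately show ?thesis using sign by simp
  qed
  then show ?thesis
    using a1 ee by (simp add: mu_B_def b'(1) weil_gamma_unit eta_ext_def k' K(1))
qed

abbreviation ff :: "'a \<Rightarrow> 'a mp \<Rightarrow> complex" where
  "ff \<kappa> \<equiv> f_fun p dx \<psi> \<mu> \<eta> (\<kappa> * of_nat p)"

context
  fixes \<kappa> :: 'a
  assumes kappa: "absp \<kappa> = 1"
begin

text \<open>The description in \<open>f_fun\<close> has one value only: two factorisations differ by
  a pair \<open>B\<close>, \<open>K\<close> with \<open>B \<odot> y = y \<odot> K\<close>, on which
  \<open>muB\<close> and \<open>eta'\<close> agree.\<close>

lemma ff_eq:
  assumes b: "b \<in> Bbar" and k: "k \<in> Kbar p 2"
  shows "ff \<kappa> (b \<odot> y_elt (\<kappa> * of_nat p) \<odot> k) = muB b * eta' k"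
proof -
  let ?y = "y_elt (\<kappa> * of_nat p)"
  let ?g = "b \<odot> ?y \<odot> k"
  have "(THE z. \<exists>b'\<in>Bbar. \<exists>k'\<in>Kbar p 2. ?g = b' \<odot> ?y \<odot> k' \<and> z = muB b' * eta' k') = muB b * eta' k"
  proof (rule the_equality)
    fix z assume "\<exists>b'\<in>Bbar. \<exists>k'\<in>Kbar p 2. ?g = b' \<odot> ?y \<odot> k' \<and> z = muB b' * eta' k'"
    then obtain b' k' where b': "b' \<in> Bbar" and k': "k' \<in> Kbar p 2" and eq: "?g = b' \<odot> ?y \<odot> k'"
      and z: "z = muB b' * eta' k'" by blast
    note car = Bbar_carrier[OF b] Bbar_carrier[OF b'] Kbar_carrier[OF k] Kbar_carrier[OF k'] y_elt_carrier[of "\<kappa> * of_nat p"]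
    define B where "B = mp_inv b' \<odot> b"
    define K where "K = k' \<odot> mp_inv k"
    have BK: "B \<in> Bbar" "K \<in> Kbar p 2"
      unfolding B_def K_def using b b' k k' by (simp_all add: Bbar_mult Bbar_inv Kbar_mult Kbar_inv)
    have BKc: "B \<in> carrier (Mp p)" "K \<in> carrier (Mp p)" using BK Bbar_carrier Kbar_carrier by blast+
    have "B \<odot> ?y = mp_inv b' \<odot> ?g \<odot> mp_inv k"
      unfolding B_def using car by (simp add: G.m_assoc)
    also have "\<dots> = ?y \<odot> K"
      unfolding eq K_def using car by (simp add: G.m_assoc G.inv_solve_left')
    finally have "B \<odot> ?y = ?y \<odot> K" .
    then have mB: "muB B = eta' K"
      using kappa by (intro muB_eq_eta'[OF BK]) (simp_all add: absp_mult)
    have bB: "b = b' \<odot> B" unfolding B_def using car by (simp add: G.m_assoc[symmetric])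
    have kK: "k' = K \<odot> k" unfolding K_def using car by (simp add: G.m_assoc)
    have K1: "K \<in> Kbar p 1" "k \<in> Kbar p 1" using Kbar_mono[of 1 2] BK(2) k by simp_all
    show "z = muB b * eta' k"
      unfolding z by (subst bB, subst kK) (simp add: muB_mult[OF b' BK(1)] eta'_mult[OF K1] mB)
  qed (use b k in blast)
  moreover have "\<exists>b'\<in>Bbar. \<exists>k'\<in>Kbar p 2. ?g = b' \<odot> ?y \<odot> k'" using b k by blast
  ultimately show ?thesis unfolding f_fun_def by simp
qed

lemma ff_eq_0: fixes g :: "'a mp" shows "\<not> (\<exists>b\<in>Bbar. \<exists>k\<in>Kbar p 2. g = b \<odot> y_elt (\<kappa> * of_nat p) \<odot> k) \<Longrightarrow> ff \<kappa> g = 0"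
  unfolding f_fun_def by (rule if_not_P)

lemma ff_in_VE: "ff \<kappa> \<in> VE 2"
proof (rule VE_2_I)
  let ?y = "y_elt (\<kappa> * of_nat p)"
  let ?P = "\<lambda>g. \<exists>b\<in>Bbar. \<exists>k\<in>Kbar p 2. g = b \<odot> ?y \<odot> k"
  note yc = y_elt_carrier[of "\<kappa> * of_nat p"]
  fix g :: "'a mp"
  { assume g: "g \<notin> carrier (Mp p)"
    have "\<not> ?P g" using g Bbar_carrier Kbar_carrier yc by auto
    then show "ff \<kappa> g = 0" by (rule ff_eq_0) }
  { fix b :: "'a mp" assume b: "b \<in> Bbar" and g: "g \<in> carrier (Mp p)"
    show "ff \<kappa> (b \<odot> g) = muB b * ff \<kappa> g"
    proof (cases "?P g")
      case True
      then obtain b' k' where bk: "b' \<in> Bbar" "k' \<in> Kbar p 2" "g = b' \<odot> ?y \<odot> k'" by blast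
      have "b \<odot> g = (b \<odot> b') \<odot> ?y \<odot> k'"
        using Bbar_carrier[OF b] Bbar_carrier[OF bk(1)] Kbar_carrier[OF bk(2)] yc by (simp add: bk(3) G.m_assoc)
      then show ?thesis using ff_eq[OF Bbar_mult[OF b bk(1)] bk(2)] ff_eq[OF bk(1,2)] muB_mult[OF b bk(1)]
        by (simp add: bk(3))
    next
      case False
      have "\<not> ?P (b \<odot> g)"
      proof
        assume "?P (b \<odot> g)"
        then obtain b' k' where bk: "b' \<in> Bbar" "k' \<in> Kbar p 2" "b \<odot> g = b' \<odot> ?y \<odot> k'" by blast
        have "g = mp_inv b \<odot> (b \<odot> g)" using Bbar_carrier[OF b] g by (simp add: G.m_assoc[symmetric])
        also have "\<dots> = (mp_inv b \<odot> b') \<odot> ?y \<odot> k'"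
          using Bbar_carrier[OF b] Bbar_carrier[OF bk(1)] Kbar_carrier[OF bk(2)] yc by (simp add: bk(3) G.m_assoc)
        finally show False using False Bbar_mult[OF Bbar_inv[OF b] bk(1)] bk(2) by blast
      qed
      then show ?thesis using False ff_eq_0 by simp
    qed }
  { fix k :: "'a mp" assume g: "g \<in> carrier (Mp p)" and k: "k \<in> Kbar p 2"
    show "ff \<kappa> (g \<odot> k) = ff \<kappa> g * eta' k"
    proof (cases "?P g")
      case True
      then obtain b' k' where bk: "b' \<in> Bbar" "k' \<in> Kbar p 2" "g = b' \<odot> ?y \<odot> k'" by blast
      have "g \<odot> k = b' \<odot> ?y \<odot> (k' \<odot> k)"
        using Kbar_carrier[OF k] Bbar_carrier[OF bk(1)] Kbar_carrier[OF bk(2)] yc by (simp add: bk(3) G.m_assoc)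
      moreover have "k' \<odot> k \<in> Kbar p 2" using Kbar_mult bk(2) k by simp
      moreover have "eta' (k' \<odot> k) = eta' k' * eta' k"
        using Kbar_mono[of 1 2] bk(2) k by (intro eta'_mult) simp_all
      ultimately show ?thesis using ff_eq[OF bk(1)] bk(2) by (simp add: bk(3))
    next
      case False
      have "\<not> ?P (g \<odot> k)"
      proof
        assume "?P (g \<odot> k)"
        then obtain b' k' where bk: "b' \<in> Bbar" "k' \<in> Kbar p 2" "g \<odot> k = b' \<odot> ?y \<odot> k'" by blast
        have "g = (g \<odot> k) \<odot> mp_inv k" using Kbar_carrier[OF k] g by (simp add: G.m_assoc)
        also have "\<dots> = b' \<odot> ?y \<odot> (k' \<odot> mp_inv k)"
          using Kbar_carrier[OF k] Bbar_carrier[OF bk(1)] Kbar_carrier[OF bk(2)] yc by (simp add: bk(3) G.m_assoc)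
        finally show False using False Kbar_mult[OF _ bk(2) Kbar_inv[OF k]] bk(1) by fastforce
      qed
      then show ?thesis using False ff_eq_0 by simp
    qed }
qed

lemma ph_ff_same: "ph (ff \<kappa>) \<kappa> = 1"
proof -
  let ?y = "y_elt (\<kappa> * of_nat p)"
  have o: "\<one>\<^bsub>Mp p\<^esub> = diag 1" by (simp add: one_Mp diag_def mat_1_eq_mat2)
  have "diag 1 \<in> Bbar" "diag 1 \<in> Kbar p 2" by (simp_all add: diag_in_Bbar diag_in_Kbar)
  from ff_eq[OF this] have "ff \<kappa> ?y = muB (diag 1) * eta' (diag 1)" using y_elt_carrier by (simp add: o[symmetric])
  then show ?thesis using muB_diag[of 1] by (simp add: ph_def eta'_diag)
qed

text \<open>From the bottom row of y(jp) = b y(\<kappa>p) k one reads off that j = d \<kappa> a'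
  modulo \<open>p\<close>, where d and a' are both inverse to d'. So j and \<kappa> would lie in the
  same square class.\<close>

lemma ph_ff_other:
  assumes j: "absp j = 1" and ne: "lg j \<noteq> lg \<kappa>"
  shows "ph (ff \<kappa>) j = 0"
  unfolding ph_def
proof (rule ff_eq_0, rule notI)
  assume "\<exists>b\<in>Bbar. \<exists>k\<in>Kbar p 2. y_elt (j * of_nat p) = b \<odot> y_elt (\<kappa> * of_nat p) \<odot> k"
  then obtain b k where b: "b \<in> Bbar" and k: "k \<in> Kbar p 2"
    and eq: "y_elt (j * of_nat p) = b \<odot> y_elt (\<kappa> * of_nat p) \<odot> k" by blast
  have k1: "k \<in> Kbar p 1" using Kbar_mono[of 1 2] k by simp
  note small = mult_p_small[of j] mult_p_small[of \<kappa>]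
  note car = Bbar_carrier[OF b] Kbar_carrier[OF k] y_elt_carrier[of "\<kappa> * of_nat p"] y_elt_carrier[of "j * of_nat p"]
  obtain a x d e where b': "b = (mat2 a x 0 d, e)" "a * d = 1" "e = 1 \<or> e = - 1"
    using b by (rule Bbar_cases)
  obtain K e' where k': "k = (K, e')" by (cases k)
  have KK: "K \<in> K0 p 2" "K \<in> K0 p 1" using k k1 by (simp_all add: k' Kbar_iff)
  obtain a' b'' c' d' where K: "K = mat2 a' b'' c' d'" "a' * d' - b'' * c' = 1" "absp a' = 1" "absp b'' \<le> 1"
    "absp d' = 1" "absp (a' * d' - 1) < 1" using KK(2) by (rule K0_1_cases)
  have c': "absp c' \<le> 1 / real p ^ 2" using KK(1) by (simp add: K mat2_in_K0)
  have "fst (y_elt (j * of_nat p)) = mat2 a x 0 d ** mat2 1 0 (\<kappa> * of_nat p) 1 ** K"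
    unfolding eq by (simp add: fst_mult_Mp b'(1) k' y_elt_def)
  then have m: "j * of_nat p = d * (\<kappa> * of_nat p) * a' + d * c'" "1 = d * (\<kappa> * of_nat p) * b'' + d * d'"
    by (simp_all add: K(1) y_elt_def mat2_mult)
  define r where "r = c' / of_nat p"
  have c'r: "c' = r * of_nat p" by (simp add: r_def)
  have r: "absp r < 1"
    using c' p_gt_0 unfolding absp_lt_1 by (simp add: r_def absp_divide power2_eq_square field_simps)
  have "j * of_nat p = (d * (\<kappa> * a' + r)) * of_nat p" using m(1) unfolding c'r by (simp add: algebra_simps)
  then have jj: "j = d * (\<kappa> * a' + r)" by simp
  have ka: "absp (\<kappa> * a') = 1" using kappa K by (simp add: absp_mult)
  have kar: "absp (\<kappa> * a' + r) = 1" using absp_add_eq'[of r "\<kappa> * a'"] r ka by simp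
  have d1: "absp d = 1" using j kar unfolding jj by (simp add: absp_mult)
  have "absp (d * (\<kappa> * of_nat p) * b'') < 1"
    using small(2) K(4) kappa d1 mult_right_mono[of "absp b''" 1 "absp (of_nat p :: 'a)"] p_gt_1
    by (simp add: absp_mult mult.commute)
  moreover have "1 - d * d' = d * (\<kappa> * of_nat p) * b''" unfolding diff_eq_eq by (rule m(2))
  ultimately have dd: "absp (d * d' - 1) < 1" using absp_diff_commute[of 1 "d * d'"] by simp
  have "lg j = lg d * lg (\<kappa> * a' + r)" unfolding jj using d1 kar by (intro lg_mult) auto
  also have "lg (\<kappa> * a' + r) = lg (\<kappa> * a')" using kar r by (intro lg_close) auto
  also have "lg (\<kappa> * a') = lg \<kappa> * lg a'" using kappa K by (intro lg_mult) auto
  also have "lg a' * lg d' = lg 1"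
    using lg_mult[of a' d'] lg_close[of "a' * d'" 1] K by (simp add: absp_mult)
  then have "lg a' = lg d'" using lg_cases[OF K(3)] lg_cases[OF K(5)] by auto
  moreover have "lg d * lg d' = lg 1"
    using lg_mult[of d d'] lg_close[of "d * d'" 1] dd d1 K by (simp add: absp_mult)
  ultimately have "lg j = lg \<kappa>" by (simp add: mult.left_commute)
  then show False using ne by simp
qed

end

end

subsection \<open>Hecke operators\<close>

context principal
begin

lemma inv_mult_cancel: "k \<in> carrier (Mp p) \<Longrightarrow> g \<in> carrier (Mp p) \<Longrightarrow> mp_inv k \<odot> (k \<odot> g) = g"
  by (simp flip: G.m_assoc)

text \<open>The condition under which a function with the required equivariance can take the value 1
  at \<open>g0\<close>.\<close>

definition compatible :: "'a mp \<Rightarrow> bool" where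
  "compatible g0 \<longleftrightarrow> g0 \<in> carrier (Mp p) \<and>
    (\<forall>k\<in>Kbar p 2. \<forall>k'\<in>Kbar p 2. k \<odot> g0 = g0 \<odot> k' \<longrightarrow> eta' k = eta' k')"

lemma Kbar_2_1: "(k :: 'a mp) \<in> Kbar p 2 \<Longrightarrow> k \<in> Kbar p 1"
  by (rule Kbar_mono) simp_all

lemma eta'_mult_2: "k \<in> Kbar p 2 \<Longrightarrow> k' \<in> Kbar p 2 \<Longrightarrow> eta' (k \<odot> k') = eta' k * eta' k'"
  by (intro eta'_mult Kbar_2_1)

lemma eta'_inv_2: "k \<in> Kbar p 2 \<Longrightarrow> eta' (mp_inv k) = eta' k"
  by (intro eta'_inv Kbar_2_1)

lemma cnj_eta'_2: "k \<in> Kbar p 2 \<Longrightarrow> cnj (eta' k) = eta' k"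
  by (intro cnj_eta' Kbar_2_1)

lemma compatible_eq:
  assumes c: "compatible g0" and k: "k \<in> Kbar p 2" "k' \<in> Kbar p 2" "k1 \<in> Kbar p 2" "k1' \<in> Kbar p 2"
    and eq: "k \<odot> g0 \<odot> k' = k1 \<odot> g0 \<odot> k1'"
  shows "eta' k * eta' k' = eta' k1 * eta' k1'"
proof -
  have g0: "g0 \<in> carrier (Mp p)" using c by (simp add: compatible_def)
  note car = g0 k[THEN Kbar_carrier]
  define A where "A = mp_inv k1 \<odot> k"
  define B where "B = k1' \<odot> mp_inv k'"
  have AB: "A \<in> Kbar p 2" "B \<in> Kbar p 2"
    unfolding A_def B_def using k by (simp_all add: Kbar_mult Kbar_inv)
  have "A \<odot> g0 = mp_inv k1 \<odot> (k \<odot> g0 \<odot> k') \<odot> mp_inv k'"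
    unfolding A_def using car by (simp add: G.m_assoc)
  also have "\<dots> = g0 \<odot> B"
    unfolding eq B_def using car by (simp add: G.m_assoc G.inv_solve_left')
  finally have "eta' A = eta' B" using c AB unfolding compatible_def by blast
  moreover have "eta' A = eta' k1 * eta' k"
    unfolding A_def using k by (simp add: eta'_mult_2 eta'_inv_2 Kbar_inv)
  moreover have "eta' B = eta' k1' * eta' k'"
    unfolding B_def using k by (simp add: eta'_mult_2 eta'_inv_2 Kbar_inv)
  ultimately have e: "eta' k1 * eta' k = eta' k1' * eta' k'" by simp
  show ?thesis
    using e eta'_cases[OF Kbar_2_1[OF k(1)]] eta'_cases[OF Kbar_2_1[OF k(2)]]
      eta'_cases[OF Kbar_2_1[OF k(3)]] eta'_cases[OF Kbar_2_1[OF k(4)]]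
    by (elim disjE) simp_all
qed

lemma one_in_Kbar: "\<one>\<^bsub>Mp p\<^esub> \<in> (Kbar p m :: 'a mp set)"
proof -
  have "\<one>\<^bsub>Mp p\<^esub> = diag 1" by (simp add: one_Mp diag_def mat_1_eq_mat2)
  then show ?thesis by (simp add: diag_in_Kbar)
qed

lemma eta'_one [simp]: "eta' \<one>\<^bsub>Mp p\<^esub> = 1"
  by (simp add: one_Mp mat_1_eq_mat2 eta_ext_def)

definition hecke_spec :: "'a mp \<Rightarrow> ('a mp \<Rightarrow> complex) \<Rightarrow> bool" where
  "hecke_spec g0 F \<longleftrightarrow>
     (\<forall>k\<in>Kbar p 2. \<forall>k'\<in>Kbar p 2. \<forall>g\<in>carrier (Mp p). F (k \<odot> g \<odot> k') = cnj (eta' k) * cnj (eta' k') * F g) \<and>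
     (\<forall>g. g \<notin> {k \<odot> g0 \<odot> k' | k k'. k \<in> Kbar p 2 \<and> k' \<in> Kbar p 2} \<longrightarrow> F g = 0) \<and> F g0 = 1"

text \<open>Compatibility makes \<open>eta' k * eta' k'\<close> a function of the product k g0 k',
  which gives existence; support and equivariance give uniqueness. The conjugations are harmless
  since \<open>eta'\<close> is 1 or -1 here.\<close>

lemma hecke_spec_hecke_fun:
  assumes c: "compatible g0" shows "hecke_spec g0 (hecke_fun p \<eta> g0)"
proof -
  have g0: "g0 \<in> carrier (Mp p)" using c by (simp add: compatible_def)
  define D where "D = {k \<odot> g0 \<odot> k' | k k'. k \<in> Kbar p 2 \<and> k' \<in> Kbar p 2}"
  define R where "R g z \<longleftrightarrow> (\<exists>k\<in>Kbar p 2. \<exists>k'\<in>Kbar p 2. g = k \<odot> g0 \<odot> k' \<and> z = eta' k * eta' k')" for g z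
  define F where "F g = (if g \<in> D then THE z. R g z else 0)" for g
  have F: "F (k \<odot> g0 \<odot> k') = eta' k * eta' k'" if k: "k \<in> Kbar p 2" "k' \<in> Kbar p 2" for k k'
  proof -
    have "k \<odot> g0 \<odot> k' \<in> D" unfolding D_def using k by blast
    moreover have "(THE z. R (k \<odot> g0 \<odot> k') z) = eta' k * eta' k'"
    proof (rule the_equality)
      show "R (k \<odot> g0 \<odot> k') (eta' k * eta' k')" unfolding R_def using k by blast
      fix z assume "R (k \<odot> g0 \<odot> k') z"
      then obtain k1 k1' where k1: "k1 \<in> Kbar p 2" "k1' \<in> Kbar p 2" and e: "k \<odot> g0 \<odot> k' = k1 \<odot> g0 \<odot> k1'"
        and z: "z = eta' k1 * eta' k1'" unfolding R_def by blast
      show "z = eta' k * eta' k'" using compatible_eq[OF c k k1 e] z by simp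
    qed
    ultimately show ?thesis by (simp add: F_def)
  qed
  have D: "k \<odot> g \<odot> k' \<in> D" if k: "k \<in> Kbar p 2" "k' \<in> Kbar p 2" and g: "g \<in> D" for k k' g
  proof -
    obtain k1 k1' where k1: "k1 \<in> Kbar p 2" "k1' \<in> Kbar p 2" "g = k1 \<odot> g0 \<odot> k1'" using g unfolding D_def by blast
    have "k \<odot> g \<odot> k' = (k \<odot> k1) \<odot> g0 \<odot> (k1' \<odot> k')"
      using k[THEN Kbar_carrier] k1(1,2)[THEN Kbar_carrier] g0 by (simp add: k1(3) G.m_assoc)
    moreover have "k \<odot> k1 \<in> Kbar p 2" "k1' \<odot> k' \<in> Kbar p 2" using k k1 by (simp_all add: Kbar_mult)
    ultimately show ?thesis unfolding D_def by blast
  qed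
  have "hecke_spec g0 F"
    unfolding hecke_spec_def
  proof (intro conjI ballI allI impI)
    fix k k' g :: "'a mp" assume k: "k \<in> Kbar p 2" "k' \<in> Kbar p 2" and g: "g \<in> carrier (Mp p)"
    have cn: "cnj (eta' k) = eta' k" "cnj (eta' k') = eta' k'" using k by (simp_all add: cnj_eta'_2)
    show "F (k \<odot> g \<odot> k') = cnj (eta' k) * cnj (eta' k') * F g"
    proof (cases "g \<in> D")
      case True
      then obtain k1 k1' where k1: "k1 \<in> Kbar p 2" "k1' \<in> Kbar p 2" "g = k1 \<odot> g0 \<odot> k1'" unfolding D_def by blast
      have e: "k \<odot> g \<odot> k' = (k \<odot> k1) \<odot> g0 \<odot> (k1' \<odot> k')"
        using k[THEN Kbar_carrier] k1(1,2)[THEN Kbar_carrier] g0 by (simp add: k1(3) G.m_assoc)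
      have "F (k \<odot> g \<odot> k') = eta' (k \<odot> k1) * eta' (k1' \<odot> k')"
        unfolding e using k k1 by (intro F Kbar_mult) simp_all
      also have "\<dots> = eta' k * eta' k' * (eta' k1 * eta' k1')"
        using k k1 by (simp add: eta'_mult_2)
      finally show ?thesis using F[OF k1(1,2)] by (simp add: cn k1(3))
    next
      case False
      have "k \<odot> g \<odot> k' \<notin> D"
      proof
        assume "k \<odot> g \<odot> k' \<in> D"
        from D[OF Kbar_inv[OF k(1)] Kbar_inv[OF k(2)] this] have "g \<in> D"
          using k[THEN Kbar_carrier] g by (simp add: G.m_assoc inv_mult_cancel)
        then show False using False by simp
      qed
      then show ?thesis using False by (simp add: F_def)
    qed
  next
    fix g :: "'a mp" assume "g \<notin> {k \<odot> g0 \<odot> k' | k k'. k \<in> Kbar p 2 \<and> k' \<in> Kbar p 2}"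
    then show "F g = 0" unfolding D_def[symmetric] by (simp add: F_def)
  next
    show "F g0 = 1" using F[OF one_in_Kbar one_in_Kbar] g0 by simp
  qed
  moreover have "F' = F" if F': "hecke_spec g0 F'" for F'
  proof (rule ext)
    fix g
    show "F' g = F g"
    proof (cases "g \<in> D")
      case True
      then obtain k k' where k: "k \<in> Kbar p 2" "k' \<in> Kbar p 2" "g = k \<odot> g0 \<odot> k'" unfolding D_def by blast
      have "F' g = cnj (eta' k) * cnj (eta' k') * F' g0" using F' k g0 unfolding hecke_spec_def by blast
      also have "\<dots> = eta' k * eta' k'" using F' k unfolding hecke_spec_def by (simp add: cnj_eta'_2)
      finally show ?thesis using F k by simp
    next
      case False
      then have "F' g = 0" using F' unfolding hecke_spec_def D_def by blast
      then show ?thesis using False by (simp add: F_def)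
    qed
  qed
  ultimately have "hecke_spec g0 (THE F. hecke_spec g0 F)" by (rule theI[of "hecke_spec g0" F])
  then show ?thesis unfolding hecke_fun_def hecke_spec_def[symmetric] .
qed

lemma hecke_spec_left:
  assumes "hecke_spec g0 F" "k \<in> Kbar p 2" "g \<in> carrier (Mp p)"
  shows "F (k \<odot> g) = eta' k * F g"
proof -
  have "F (k \<odot> g \<odot> \<one>\<^bsub>Mp p\<^esub>) = cnj (eta' k) * cnj (eta' \<one>\<^bsub>Mp p\<^esub>) * F g"
    using assms one_in_Kbar unfolding hecke_spec_def by blast
  then show ?thesis using assms Kbar_carrier[OF assms(2)] by (simp add: cnj_eta'_2)
qed

lemma hecke_spec_right:
  assumes "hecke_spec g0 F" "k \<in> Kbar p 2" "g \<in> carrier (Mp p)"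
  shows "F (g \<odot> k) = F g * eta' k"
proof -
  have "F (\<one>\<^bsub>Mp p\<^esub> \<odot> g \<odot> k) = cnj (eta' \<one>\<^bsub>Mp p\<^esub>) * cnj (eta' k) * F g"
    using assms one_in_Kbar unfolding hecke_spec_def by blast
  then show ?thesis using assms by (simp add: cnj_eta'_2 mult.commute)
qed

text \<open>The element itself lies in \<open>Kbar p 1\<close>, on which \<open>eta'\<close> is
  multiplicative.\<close>

lemma compatible_y:
  assumes s: "absp s < 1" shows "compatible (y_elt s)"
  unfolding compatible_def
proof (intro conjI y_elt_carrier ballI impI)
  fix k k' :: "'a mp" assume k: "k \<in> Kbar p 2" "k' \<in> Kbar p 2" and eq: "k \<odot> y_elt s = y_elt s \<odot> k'"
  note k1 = k[THEN Kbar_2_1]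
  have y: "y_elt s \<in> Kbar p 1" using s by (rule y_elt_in_Kbar_1)
  have "eta' k * 1 = 1 * eta' k'"
    using eta'_mult[OF k1(1) y] eta'_mult[OF y k1(2)] eq by simp
  then show "eta' k = eta' k'" by simp
qed

text \<open>Conjugation by \<open>w(1)\<close> exchanges the diagonal entries. These are inverse
  modulo \<open>p\<close>, so the quadratic character eta agrees on them.\<close>

lemma compatible_w: "compatible w_elt"
  unfolding compatible_def
proof (intro conjI w_elt_carrier ballI impI)
  fix k k' :: "'a mp" assume k: "k \<in> Kbar p 2" "k' \<in> Kbar p 2" and eq: "k \<odot> w_elt = w_elt \<odot> k'"
  obtain A e where kA: "k = (A, e)" by (cases k)
  obtain B f where kB: "k' = (B, f)" by (cases k')
  have AB: "A \<in> K0 p 1" "B \<in> K0 p 1" using k[THEN Kbar_2_1] by (simp_all add: kA kB Kbar_iff)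
  obtain a b c d where A: "A = mat2 a b c d" using AB(1) by (rule K0_1_cases)
  obtain a' b' c' d' where B: "B = mat2 a' b' c' d'" "absp a' = 1" "absp d' = 1" "absp (a' * d' - 1) < 1"
    using AB(2) by (rule K0_1_cases)
  have "(A ** mat2 0 1 (- 1) 0, e) = (mat2 0 1 (- 1) 0 ** B, f)"
    using eq by (simp add: kA kB w_elt_def mult_Mp cocycle_K0_w[OF AB(1)] cocycle_K0_w[OF AB(2)])
  then have ef: "e = f" and da: "d = a'" by (simp_all add: A B(1) mat2_mult)
  have "\<eta> (a' * d') = \<eta> 1" using B by (intro eta_cong) (simp_all add: absp_mult)
  then have "\<eta> a' * \<eta> d' = 1" using eta_mult[OF B(2,3)] by simp
  then have "\<eta> a' = \<eta> d'" using eta_cases[OF B(2)] eta_cases[OF B(3)] by auto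
  then show "eta' k = eta' k'" by (simp add: eta_ext_def kA kB A B(1) ef da)
qed

text \<open>Dividing the lower left entries by \<open>p\<close> gives D z = a a' modulo
  \<open>p\<close>, where a' = A and A D = 1 modulo \<open>p\<close>. Hence z is a times a
  square.\<close>

lemma double_coset_y:
  assumes a: "absp a = 1" and z: "absp z \<le> 1" and k: "k \<in> Kbar p 2" "k' \<in> Kbar p 2"
    and eq: "y_elt (z * of_nat p) = k \<odot> y_elt (a * of_nat p) \<odot> k'"
  shows "absp z = 1" and "lg z = lg a"
proof -
  define \<kappa> where "\<kappa> = mp_inv k"
  have kap: "\<kappa> \<in> Kbar p 2" unfolding \<kappa>_def using k(1) by (rule Kbar_inv)
  note car = k[THEN Kbar_carrier] y_elt_carrier[of "z * of_nat p"] y_elt_carrier[of "a * of_nat p"]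
  have e: "\<kappa> \<odot> y_elt (z * of_nat p) = y_elt (a * of_nat p) \<odot> k'"
    unfolding \<kappa>_def eq using car by (simp add: G.m_assoc G.inv_solve_left')
  obtain M f where kM: "\<kappa> = (M, f)" by (cases \<kappa>)
  obtain N f' where kN: "k' = (N, f')" by (cases k')
  have MN: "M \<in> K0 p 1" "N \<in> K0 p 1" "M \<in> K0 p 2" "N \<in> K0 p 2"
    using Kbar_2_1[OF kap] Kbar_2_1[OF k(2)] kap k(2) by (simp_all add: kM kN Kbar_iff)
  obtain A B C D where M: "M = mat2 A B C D" "absp A = 1" "absp B \<le> 1" "absp D = 1" "absp (A * D - 1) < 1"
    using MN(1) by (rule K0_1_cases)
  obtain a' b' c' d' where N: "N = mat2 a' b' c' d'" "absp a' = 1"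
    using MN(2) by (rule K0_1_cases)
  have "mat2 (A + B * (z * of_nat p)) B (C + D * (z * of_nat p)) D =
      mat2 a' b' (a * of_nat p * a' + c') (a * of_nat p * b' + d')"
    using arg_cong[OF e, of fst] by (simp add: fst_mult_Mp kM kN M(1) N(1) y_elt_def mat2_mult del: mat2_eq_iff)
  then have m: "A + B * (z * of_nat p) = a'" "C + D * (z * of_nat p) = a * of_nat p * a' + c'"
    unfolding mat2_eq_iff by blast+
  have small: "absp (x / of_nat p) < 1" if "absp x \<le> 1 / real p ^ 2" for x :: 'a
    using that p_gt_0 unfolding absp_lt_1 by (simp add: absp_divide power2_eq_square field_simps)
  have C: "absp (C / of_nat p) < 1" "absp (c' / of_nat p) < 1"
    using MN(3,4) by (auto simp: M(1) N(1) mat2_in_K0 intro!: small)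
  define r where "r = c' / of_nat p - C / of_nat p"
  have r: "absp r < 1" unfolding r_def using C(2,1) by (rule absp_diff_less)
  have "(D * z) * of_nat p = (a * a' + r) * of_nat p"
    using m(2) by (simp add: r_def algebra_simps)
  then have Dz: "D * z = a * a' + r" by simp
  have aa: "absp (a * a') = 1" using a N by (simp add: absp_mult)
  have "absp (D * z) = 1" unfolding Dz using absp_add_eq'[of r "a * a'"] r aa by simp
  then show z1: "absp z = 1" using M by (simp add: absp_mult)
  have "lg D * lg z = lg (a * a' + r)" using lg_mult[of D z] M z1 Dz by simp
  also have "\<dots> = lg (a * a')" using r aa absp_add_eq'[of r "a * a'"] by (intro lg_close) auto
  also have "\<dots> = lg a * lg a'" using a N by (intro lg_mult) auto
  also have "lg a' = lg A"
  proof (rule lg_close)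
    have "absp (B * (z * of_nat p)) < 1"
      using mult_right_mono[OF M(3), of "absp (z * of_nat p)"] mult_p_small[OF z] by (simp add: absp_mult)
    then show "absp (a' - A) < 1" unfolding m(1)[symmetric] by simp
  qed (use N in simp)
  also have "lg A = lg D"
  proof -
    have "lg A * lg D = lg 1" using lg_mult[of A D] lg_close[of "A * D" 1] M by (simp add: absp_mult)
    then show ?thesis using lg_cases[OF M(2)] lg_cases[OF M(4)] by auto
  qed
  finally have "lg D * lg z = lg D * lg a" by (simp add: mult.commute)
  then show "lg z = lg a" using lg_cases[OF M(4)] by auto
qed

text \<open>On the elements y(zp) the Hecke function is the indicator of a square class: the two
  values of eta picked up by torus conjugation cancel.\<close>

lemma hecke_fun_y:
  assumes a: "absp a = 1" and z: "absp z \<le> 1"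
  shows "hecke_fun p \<eta> (y_elt (a * of_nat p)) (y_elt (z * of_nat p)) = (if absp z = 1 \<and> lg z = lg a then 1 else 0)"
proof -
  let ?y = "y_elt (a * of_nat p)"
  have as: "absp (a * of_nat p) < 1" using a by (intro mult_p_small) simp
  have spec: "hecke_spec ?y (hecke_fun p \<eta> ?y)"
    using compatible_y[OF as] by (rule hecke_spec_hecke_fun)
  show ?thesis
  proof (cases "absp z = 1 \<and> lg z = lg a")
    case True
    then have "lg a = lg z" by simp
    with a True obtain t where t: "z = a * t\<^sup>2" "absp t = 1" using nonresidue_square_class by blast
    have t': "absp (1 / t) = 1" using t by (simp add: absp_divide)
    have kc: "diag t \<in> Kbar p 2" "diag (1 / t) \<in> Kbar p 2" using t t' by (simp_all add: diag_in_Kbar)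
    have "y_elt (z * of_nat p) = diag (1 / t) \<odot> ?y \<odot> diag t"
      using y_elt_conj[OF as t(2)] by (simp add: t(1) mult_ac)
    then have "hecke_fun p \<eta> ?y (y_elt (z * of_nat p)) = eta' (diag (1 / t)) * hecke_fun p \<eta> ?y ?y * eta' (diag t)"
      using hecke_spec_right[OF spec kc(1), of "diag (1 / t) \<odot> ?y"] hecke_spec_left[OF spec kc(2) y_elt_carrier]
        Kbar_carrier[OF kc(2)] y_elt_carrier by simp
    moreover have "hecke_fun p \<eta> ?y ?y = 1" using spec by (simp add: hecke_spec_def)
    ultimately show ?thesis using True eta_sq[OF t(2)] eta_inverse[OF t(2)] by (simp add: eta'_diag)
  next
    case False
    then have "y_elt (z * of_nat p) \<notin> {k \<odot> ?y \<odot> k' | k k'. k \<in> Kbar p 2 \<and> k' \<in> Kbar p 2}"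
      using double_coset_y[OF a z] by blast
    moreover have "hecke_fun p \<eta> ?y g = 0" if "g \<notin> {k \<odot> ?y \<odot> k' | k k'. k \<in> Kbar p 2 \<and> k' \<in> Kbar p 2}" for g
      using spec that unfolding hecke_spec_def by blast
    ultimately have "hecke_fun p \<eta> ?y (y_elt (z * of_nat p)) = 0" by blast
    then show ?thesis unfolding if_not_P[OF False] .
  qed
qed

text \<open>The lower left entry of k w(1) is a unit, so the element lies in the big cell with
  integral coordinate - c / d.\<close>

lemma VE_Kbar_w:
  assumes v: "v \<in> VE m" and k: "k \<in> Kbar p 1"
  shows "v (k \<odot> w_elt) = 0"
proof -
  obtain M f where kM: "k = (M, f)" by (cases k)
  have "M \<in> K0 p 1" using k by (simp add: kM Kbar_iff)
  then obtain a b c d where M: "M = mat2 a b c d" "absp d = 1" "absp c < 1" by (rule K0_1_cases)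
  have s: "absp (- c / d) \<le> 1" using M by (simp add: absp_divide)
  have d0: "d \<noteq> 0" using M by auto
  have kc: "k \<odot> w_elt \<in> carrier (Mp p)" "w_elt \<odot> upper (- c / d) \<in> carrier (Mp p)"
    using Kbar_carrier[OF k] w_elt_carrier Kbar_carrier[OF upper_in_Kbar[OF s, of 1]] by simp_all
  obtain B where "B \<in> Bbar" "k \<odot> w_elt = B \<odot> (w_elt \<odot> upper (- c / d))"
  proof (rule borel_factor[OF kc])
    show "fst (k \<odot> w_elt) $ 2 $ 1 * fst (w_elt \<odot> upper (- c / d)) $ 2 $ 2 =
        fst (k \<odot> w_elt) $ 2 $ 2 * fst (w_elt \<odot> upper (- c / d)) $ 2 $ 1"
      using d0 by (simp add: fst_mult_Mp kM M(1) w_elt_def upper_def mat2_mult)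
  qed
  then show ?thesis using VE_big_cell[OF v _ s] by simp
qed

text \<open>The digit \<open>j\<close> is the residue of c / (p a): left multiplication by y(-jp)
  then moves the lower left entry into the ideal of p^2.\<close>

lemma Kbar_1_coset:
  assumes k: "k \<in> Kbar p 1"
  obtains j k' where "j \<in> {0..<int p}" "k' \<in> Kbar p 2" "k = y_elt (of_int j * of_nat p) \<odot> k'"
proof -
  obtain M f where kM: "k = (M, f)" by (cases k)
  have "M \<in> K0 p 1" and f: "f = 1 \<or> f = - 1" using k by (simp_all add: kM Kbar_iff)
  then obtain a b c d where M: "M = mat2 a b c d" "absp a = 1" "absp b \<le> 1" "absp d = 1" "absp c < 1"
    using K0_1_cases[of M thesis] by metis
  have a0: "a \<noteq> 0" using M by auto
  define q where "q = c / (of_nat p * a)"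
  have q: "absp q \<le> 1" using M p_gt_0 unfolding absp_lt_1 by (simp add: q_def absp_divide absp_mult field_simps)
  define j where "j = residue_mod p q"
  note j = residue_mod[OF q, folded j_def]
  let ?s = "of_int j * of_nat p :: 'a"
  have s: "absp ?s < 1" by (intro mult_p_small absp_of_int_le)
  have yk: "y_elt (- ?s) \<in> Kbar p 1" using s by (intro y_elt_in_Kbar_1) simp
  define k' where "k' = y_elt (- ?s) \<odot> k"
  have k'1: "k' \<in> Kbar p 1" unfolding k'_def using yk k by (intro Kbar_mult) simp_all
  have "k' = (mat2 1 0 (- ?s) 1 ** mat2 a b c d, 1 * f)"
    unfolding k'_def y_elt_def kM M(1) using yk k by (intro mult_Kbar_1) (simp_all add: y_elt_def kM M(1))
  then have k'e: "k' = (mat2 a b (- ?s * a + c) (- ?s * b + d), f)" by (simp add: mat2_mult)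
  have "- ?s * a + c = (q - of_int j) * of_nat p * a" using a0 by (simp add: q_def field_simps)
  then have "absp (- ?s * a + c) = absp ((q - of_int j) * of_nat p)" using M by (simp only: absp_mult mult_1_right)
  also have "\<dots> \<le> 1 / real p ^ 2" using j(3) by (rule mult_p_small')
  finally have "k' \<in> Kbar p 2" using k'1 unfolding k'e Kbar_iff mat2_in_K0 by simp
  moreover have "y_elt ?s \<odot> k' = k"
    unfolding k'_def using y_elt_add[of ?s "- ?s"] s Kbar_carrier[OF k] y_elt_carrier
    by (simp add: G.m_assoc[symmetric] y_elt_0)
  ultimately show ?thesis using that[of j k'] j(1,2) by simp
qed

end

section \<open>Integration over the cover and the Hecke action\<close>

locale hecke = principal p ty dx \<psi> \<mu> \<eta>
  for p and ty :: "'a::{field_char_0,complete_space} itself" and dx \<psi> \<mu> \<eta> +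
  fixes dg :: "'a mp measure"
  assumes haar: "left_haar_measure (Mp p) (Mp_topology p) dg" and vol: "emeasure dg (Kbar p 2) = 1"
begin

lemma space_dg: "space dg = carrier (Mp p)"
  and sets_dg: "sets dg = sigma_sets (carrier (Mp p)) {U. openin (Mp_topology p) U}"
  and emeasure_left: "g \<in> carrier (Mp p) \<Longrightarrow> S \<in> sets dg \<Longrightarrow> emeasure dg ((\<lambda>h. g \<odot> h) ` S) = emeasure dg S"
  using haar by (simp_all add: left_haar_measure_def)

lemma openin_subset: "openin (Mp_topology p) W \<Longrightarrow> W \<subseteq> (carrier (Mp p) :: 'a mp set)"
  by (simp add: openin_Mp)

lemma openin_sets: "openin (Mp_topology p) W \<Longrightarrow> W \<in> sets dg"
  unfolding sets_dg by (intro sigma_sets.Basic) simp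

text \<open>Preimages of arbitrary sets are open, by invariance under an open subgroup.\<close>

lemma measurable_right_invariant:
  fixes f :: "'a mp \<Rightarrow> complex"
  assumes "\<And>g k. g \<in> carrier (Mp p) \<Longrightarrow> k \<in> Kbar p 2 \<Longrightarrow> f (g \<odot> k) = f g * eta' k"
  shows "f \<in> borel_measurable dg"
proof (rule measurableI)
  fix A :: "complex set"
  show "f -` A \<inter> space dg \<in> sets dg"
  proof (intro openin_sets openin_Mp_invariant)
    fix g u assume g: "g \<in> f -` A \<inter> space dg" and u: "(u, 1) \<in> Kbar p 2" "absp (u $ 2 $ 2 - 1 :: 'a) < 1"
    have "\<eta> 1 = \<eta> (u $ 2 $ 2)" using u(2) by (intro eta_cong) (simp_all add: absp_diff_commute)
    then have "eta' (u, 1) = 1" by (simp add: eta_ext_def)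
    then show "g \<odot> (u, 1) \<in> f -` A \<inter> space dg"
      using g assms[OF _ u(1), of g] Kbar_carrier[OF u(1)] by (simp add: space_dg)
  qed (auto simp: space_dg)
qed auto

text \<open>The topology is built from right multiplication by small elements, with which left
  translation commutes.\<close>

lemma left_translate_measurable:
  assumes h: "h \<in> carrier (Mp p)"
  shows "(\<lambda>g. h \<odot> g) \<in> measurable dg dg"
proof (rule measurable_sigma_sets[OF sets_dg])
  show "{U. openin (Mp_topology p) U} \<subseteq> Pow (carrier (Mp p) :: 'a mp set)" using openin_subset by blast
  show "(\<lambda>g. h \<odot> g) \<in> space dg \<rightarrow> carrier (Mp p)" using h by (auto simp: space_dg)
next
  fix W :: "'a mp set" assume "W \<in> {U. openin (Mp_topology p) U}"
  then have W: "openin (Mp_topology p) W" by simp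
  show "(\<lambda>g. h \<odot> g) -` W \<inter> space dg \<in> sets dg"
  proof (intro openin_sets, unfold openin_Mp, intro conjI ballI)
    show "(\<lambda>g. h \<odot> g) -` W \<inter> space dg \<subseteq> carrier (Mp p)" by (auto simp: space_dg)
    fix g assume g: "g \<in> (\<lambda>g. h \<odot> g) -` W \<inter> space dg"
    then have "h \<odot> g \<in> W" by simp
    with W obtain U where U: "open U" "(mat 1 :: 'a^2^2) \<in> U" "\<forall>u \<in> U \<inter> SL2_Zp. h \<odot> g \<odot> (u, 1) \<in> W"
      unfolding openin_Mp by blast
    have "g \<odot> (u, 1) \<in> (\<lambda>g. h \<odot> g) -` W \<inter> space dg" if u: "u \<in> U \<inter> SL2_Zp" for u
    proof -
      have uc: "(u, 1) \<in> carrier (Mp p)" using u by (simp add: carrier_Mp SL2_Zp_def)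
      have gc: "g \<in> carrier (Mp p)" using g by (simp add: space_dg)
      have "h \<odot> g \<odot> (u, 1) \<in> W" using U(3) u by blast
      then have "h \<odot> (g \<odot> (u, 1)) \<in> W" unfolding G.m_assoc[OF h gc uc] .
      then show ?thesis using gc uc by (simp add: space_dg)
    qed
    then show "\<exists>U. open U \<and> (mat 1 :: 'a^2^2) \<in> U \<and> (\<forall>u \<in> U \<inter> SL2_Zp. g \<odot> (u, 1) \<in> (\<lambda>g. h \<odot> g) -` W \<inter> space dg)"
      using U(1,2) by (intro exI[of _ U]) blast
  qed
qed

lemma integral_left_translate:
  fixes f :: "'a mp \<Rightarrow> complex"
  assumes h: "h \<in> carrier (Mp p)" and f: "f \<in> borel_measurable dg"
  shows "(LINT g|dg. f (h \<odot> g)) = (LINT g|dg. f g)"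
proof -
  note m = left_translate_measurable[OF h]
  have "distr dg dg (\<lambda>g. h \<odot> g) = dg"
  proof (rule measure_eqI)
    fix S assume "S \<in> sets (distr dg dg (\<lambda>g. h \<odot> g))"
    then have S: "S \<in> sets dg" by simp
    then have Sc: "S \<subseteq> carrier (Mp p)" using sets.sets_into_space space_dg by blast
    have "(\<lambda>g. h \<odot> g) -` S \<inter> space dg = (\<lambda>g. mp_inv h \<odot> g) ` S"
    proof (intro equalityI subsetI)
      fix g assume g: "g \<in> (\<lambda>g. h \<odot> g) -` S \<inter> space dg"
      then have "g = mp_inv h \<odot> (h \<odot> g)" using inv_mult_cancel[OF h, of g] by (simp add: space_dg)
      then show "g \<in> (\<lambda>g. mp_inv h \<odot> g) ` S" using g by blast
    next
      fix g assume "g \<in> (\<lambda>g. mp_inv h \<odot> g) ` S"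
      then obtain g' where g': "g' \<in> S" "g = mp_inv h \<odot> g'" by blast
      then have gc: "g' \<in> carrier (Mp p)" using Sc by blast
      then have "h \<odot> g = g'" using h unfolding g'(2) by (simp flip: G.m_assoc)
      then show "g \<in> (\<lambda>g. h \<odot> g) -` S \<inter> space dg" using g' gc h by (simp add: space_dg)
    qed
    then show "emeasure (distr dg dg (\<lambda>g. h \<odot> g)) S = emeasure dg S"
      using emeasure_distr[OF m S] emeasure_left[OF G.inv_closed[OF h] S] by simp
  qed simp
  then show ?thesis using integral_distr[OF m f] by simp
qed

text \<open>Left equivariance passes through the integral. For right equivariance, \<open>k\<close>
  is moved into the integration variable by left invariance of the measure and reappears through the
  left equivariance of \<open>F\<close>.\<close>

lemma hecke_act_VE:
  assumes F: "hecke_spec g0 F" and v: "v \<in> VE 2"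
  shows "hecke_act p dg F v \<in> VE 2"
proof (rule VE_2_I)
  fix g :: "'a mp"
  { assume "g \<notin> carrier (Mp p)"
    then show "hecke_act p dg F v g = 0" by (simp add: hecke_act_def) }
  { fix b :: "'a mp" assume b: "b \<in> Bbar" and g: "g \<in> carrier (Mp p)"
    note bc = Bbar_carrier[OF b]
    have "(LINT h|dg. F h * v (b \<odot> g \<odot> h)) = (LINT h|dg. muB b * (F h * v (g \<odot> h)))"
    proof (rule Bochner_Integration.integral_cong[OF refl])
      fix h assume "h \<in> space dg"
      then have h: "h \<in> carrier (Mp p)" by (simp add: space_dg)
      have "v (b \<odot> g \<odot> h) = muB b * v (g \<odot> h)"
        using VE_left[OF v b, of "g \<odot> h"] bc g h by (simp add: G.m_assoc)
      then show "F h * v (b \<odot> g \<odot> h) = muB b * (F h * v (g \<odot> h))" by simp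
    qed
    then show "hecke_act p dg F v (b \<odot> g) = muB b * hecke_act p dg F v g"
      using bc g by (simp add: hecke_act_def) }
  { fix k :: "'a mp" assume g: "g \<in> carrier (Mp p)" and k: "k \<in> Kbar p 2"
    note kc = Kbar_carrier[OF k]
    define H where "H h = eta' k * (F h * v (g \<odot> h))" for h
    have meas: "H \<in> borel_measurable dg"
    proof -
      have "f \<in> borel_measurable dg" if "f = F \<or> f = (\<lambda>h. v (g \<odot> h))" for f
        using that
      proof
        assume "f = F"
        then show ?thesis using hecke_spec_right[OF F] by (intro measurable_right_invariant) simp
      next
        assume f: "f = (\<lambda>h. v (g \<odot> h))"
        show ?thesis unfolding f
        proof (rule measurable_right_invariant)
          fix h k' :: "'a mp" assume h: "h \<in> carrier (Mp p)" and k': "k' \<in> Kbar p 2"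
          show "v (g \<odot> (h \<odot> k')) = v (g \<odot> h) * eta' k'"
            using VE_right[OF v _ k', of "g \<odot> h"] g h Kbar_carrier[OF k'] by (simp add: G.m_assoc)
        qed
      qed
      then show ?thesis unfolding H_def by (intro borel_measurable_times) auto
    qed
    have "(LINT h|dg. F h * v (g \<odot> k \<odot> h)) = (LINT h|dg. H (k \<odot> h))"
    proof (rule Bochner_Integration.integral_cong[OF refl])
      fix h assume "h \<in> space dg"
      then have h: "h \<in> carrier (Mp p)" by (simp add: space_dg)
      show "F h * v (g \<odot> k \<odot> h) = H (k \<odot> h)"
        using hecke_spec_left[OF F k h] eta'_sq[OF Kbar_2_1[OF k]] g kc h
        by (simp add: H_def G.m_assoc)
    qed
    also have "\<dots> = (LINT h|dg. H h)" using kc meas by (rule integral_left_translate)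
    also have "\<dots> = eta' k * (LINT h|dg. F h * v (g \<odot> h))" unfolding H_def by (rule integral_mult_right_zero)
    finally show "hecke_act p dg F v (g \<odot> k) = hecke_act p dg F v g * eta' k"
      using g kc by (simp add: hecke_act_def) }
qed

text \<open>At y(ap) the integrand vanishes pointwise, so the double coset of \<open>w(1)\<close> is
  never decomposed into cosets.\<close>

lemma U0_eq_0:
  assumes v: "v \<in> VE 2" and l: "absp l = 1" "lg l = - 1"
  shows "U0_op p dg \<eta> v = 0"
proof -
  define F where "F = hecke_fun p \<eta> w_elt"
  have F: "hecke_spec w_elt F" unfolding F_def using compatible_w by (rule hecke_spec_hecke_fun)
  have u: "hecke_act p dg F v \<in> VE 2" using F v by (rule hecke_act_VE)
  have "ph (hecke_act p dg F v) a = 0" if a: "absp a = 1" for a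
  proof -
    let ?y = "y_elt (a * of_nat p)"
    have y: "?y \<in> Kbar p 1" using a by (intro y_elt_in_Kbar_1 mult_p_small) simp
    have z: "F g * v (?y \<odot> g) = 0" for g
    proof (cases "F g = 0")
      case False
      then obtain k k' where k: "k \<in> Kbar p 2" "k' \<in> Kbar p 2" "g = k \<odot> w_elt \<odot> k'"
        using F unfolding hecke_spec_def by blast
      note car = k(1,2)[THEN Kbar_carrier] y_elt_carrier[of "a * of_nat p"] w_elt_carrier
      have yk: "?y \<odot> k \<in> Kbar p 1" using y Kbar_2_1[OF k(1)] by (intro Kbar_mult) simp_all
      have "?y \<odot> g = (?y \<odot> k) \<odot> w_elt \<odot> k'" using car by (simp add: k(3) G.m_assoc)
      then have "v (?y \<odot> g) = v ((?y \<odot> k) \<odot> w_elt) * eta' k'"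
        using VE_right[OF v _ k(2), of "(?y \<odot> k) \<odot> w_elt"] car by simp
      then show ?thesis using VE_Kbar_w[OF v yk] by simp
    qed simp
    show ?thesis by (simp add: ph_def hecke_act_def z)
  qed
  then show ?thesis unfolding U0_op_def F_def[symmetric] using VE_2_eq_0[OF u l] l by simp
qed

definition yj :: "int \<Rightarrow> 'a mp" where
  "yj j = y_elt (of_int j * of_nat p)"

lemma yj_carrier: "yj j \<in> carrier (Mp p)"
  by (simp add: yj_def y_elt_carrier)

lemma Kbar_2_in_sets: "Kbar p 2 \<in> sets dg"
proof (intro openin_sets openin_Mp_invariant)
  show "Kbar p 2 \<subseteq> (carrier (Mp p) :: 'a mp set)" using Kbar_carrier by blast
  fix g :: "'a mp" and u :: "'a^2^2" assume "g \<in> Kbar p 2" "(u, 1) \<in> Kbar p 2"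
  then show "g \<odot> (u, 1) \<in> Kbar p 2" by (intro Kbar_mult) simp_all
qed

lemma coset_in_sets_dg: "(\<lambda>h. yj j \<odot> h) ` Kbar p 2 \<in> sets dg"
proof -
  have "(\<lambda>h. yj j \<odot> h) ` Kbar p 2 = (\<lambda>g. mp_inv (yj j) \<odot> g) -` Kbar p 2 \<inter> space dg"
  proof (intro equalityI subsetI)
    fix g assume "g \<in> (\<lambda>h. yj j \<odot> h) ` Kbar p 2"
    then obtain k where k: "k \<in> Kbar p 2" "g = yj j \<odot> k" by blast
    then show "g \<in> (\<lambda>g. mp_inv (yj j) \<odot> g) -` Kbar p 2 \<inter> space dg"
      using inv_mult_cancel[OF yj_carrier Kbar_carrier[OF k(1)], of j] Kbar_carrier[OF k(1)] yj_carrier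
      by (simp add: space_dg)
  next
    fix g assume g: "g \<in> (\<lambda>g. mp_inv (yj j) \<odot> g) -` Kbar p 2 \<inter> space dg"
    then have "g = yj j \<odot> (mp_inv (yj j) \<odot> g)" using yj_carrier by (simp add: space_dg flip: G.m_assoc)
    then show "g \<in> (\<lambda>h. yj j \<odot> h) ` Kbar p 2" using g by blast
  qed
  also have "\<dots> \<in> sets dg"
    using left_translate_measurable[OF G.inv_closed[OF yj_carrier]] Kbar_2_in_sets by (rule measurable_sets)
  finally show ?thesis .
qed

lemma disjoint_yj: "disjoint_family_on (\<lambda>j. (\<lambda>h. yj j \<odot> h) ` Kbar p 2) {0..<int p}"
  unfolding disjoint_family_on_def
proof (intro ballI impI)
  fix i j assume ij: "i \<in> {0..<int p}" "j \<in> {0..<int p}" "i \<noteq> j"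
  show "(\<lambda>h. yj i \<odot> h) ` Kbar p 2 \<inter> (\<lambda>h. yj j \<odot> h) ` Kbar p 2 = {}"
  proof (rule ccontr)
    assume "\<not> ?thesis"
    then obtain k k' where k: "k \<in> Kbar p 2" "k' \<in> Kbar p 2" "yj i \<odot> k = yj j \<odot> k'" by blast
    note car = k(1,2)[THEN Kbar_carrier] yj_carrier[of i] yj_carrier[of j]
    have s: "absp (of_int i * of_nat p :: 'a) < 1" "absp (of_int j * of_nat p :: 'a) < 1"
      by (intro mult_p_small absp_of_int_le)+
    have "mp_inv (yj j) \<odot> yj i = mp_inv (yj j) \<odot> (yj i \<odot> k) \<odot> mp_inv k" using car by (simp add: G.m_assoc)
    also have "\<dots> = k' \<odot> mp_inv k" unfolding k(3) using car by (simp add: inv_mult_cancel)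
    also have "\<dots> \<in> Kbar p 2" using k by (intro Kbar_mult Kbar_inv) simp_all
    also have "mp_inv (yj j) \<odot> yj i = y_elt (- (of_int j * of_nat p) + of_int i * of_nat p)"
      unfolding yj_def using s by (simp add: y_elt_inv y_elt_add)
    finally have "absp (- (of_int j * of_nat p) + of_int i * of_nat p :: 'a) \<le> 1 / real p ^ 2"
      by (simp add: y_elt_def Kbar_iff mat2_in_K0)
    moreover have "- (of_int j * of_nat p) + of_int i * of_nat p = (of_int (i - j) * of_nat p :: 'a)"
      by (simp add: algebra_simps)
    ultimately have "absp (of_int (i - j) :: 'a) * (1 / real p) \<le> 1 / real p ^ 2"
      by (simp only: absp_mult absp_p)
    then have "absp (of_int (i - j) :: 'a) \<le> 1 / real p"
      using p_gt_0 by (simp add: power2_eq_square field_simps del: of_int_diff)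
    then have "int p dvd i - j" by (simp flip: absp_lt_1 absp_of_int_lt_1_iff)
    then have "i mod int p = j mod int p" by (simp add: mod_eq_dvd_iff)
    then show False using ij by simp
  qed
qed

text \<open>\<open>Kbar p 1\<close> is the disjoint union of the cosets \<open>yj j Kbar p 2\<close>, \<open>0 \<le> j < p\<close>, and contains the
  double coset supporting the Hecke function.\<close>
lemma V1_op_eq:
  assumes v: "v \<in> VE 2" and a: "absp a = 1" and x: "x \<in> carrier (Mp p)"
  shows "V1_op p dg \<eta> a v x =
    (\<Sum>j\<in>{0..<int p}. (if absp (of_int j :: 'a) = 1 \<and> lg (of_int j) = lg a then 1 else 0) * v (x \<odot> yj j))"
proof -
  define F where "F = hecke_fun p \<eta> (y_elt (a * of_nat p))"
  have as: "absp (a * of_nat p) < 1" using a by (intro mult_p_small) simp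
  have F: "hecke_spec (y_elt (a * of_nat p)) F"
    unfolding F_def using compatible_y[OF as] by (rule hecke_spec_hecke_fun)
  have y1: "y_elt (a * of_nat p) \<in> Kbar p 1" using as by (rule y_elt_in_Kbar_1)
  have "has_bochner_integral dg (\<lambda>g. F g * v (x \<odot> g))
      (\<Sum>j\<in>{0..<int p}. measure dg ((\<lambda>h. yj j \<odot> h) ` Kbar p 2) *\<^sub>R (F (yj j) * v (x \<odot> yj j)))"
  proof (rule has_bochner_integral_finite_partition)
    show "emeasure dg ((\<lambda>h. yj j \<odot> h) ` Kbar p 2) < \<infinity>" for j
      unfolding emeasure_left[OF yj_carrier Kbar_2_in_sets] vol by simp
    show "F g * v (x \<odot> g) = F (yj j) * v (x \<odot> yj j)" if g: "g \<in> (\<lambda>h. yj j \<odot> h) ` Kbar p 2" for j g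
    proof -
      obtain k where k: "k \<in> Kbar p 2" "g = yj j \<odot> k" using g by blast
      have 1: "F g = F (yj j) * eta' k" unfolding k(2) using F k(1) yj_carrier by (rule hecke_spec_right)
      have 2: "v (x \<odot> g) = v (x \<odot> yj j) * eta' k"
        using VE_right[OF v _ k(1), of "x \<odot> yj j"] x yj_carrier[of j] Kbar_carrier[OF k(1)]
        by (simp add: k(2) G.m_assoc)
      have "F g * v (x \<odot> g) = F (yj j) * v (x \<odot> yj j) * (eta' k * eta' k)"
        unfolding 1 2 by (simp only: mult_ac)
      then show ?thesis using eta'_sq[OF Kbar_2_1[OF k(1)]] by simp
    qed
    show "F g * v (x \<odot> g) = 0" if g: "g \<notin> (\<Union>j\<in>{0..<int p}. (\<lambda>h. yj j \<odot> h) ` Kbar p 2)" for g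
    proof (rule ccontr)
      assume "F g * v (x \<odot> g) \<noteq> 0"
      then have "F g \<noteq> 0" by simp
      then obtain k k' where k: "k \<in> Kbar p 2" "k' \<in> Kbar p 2" "g = k \<odot> y_elt (a * of_nat p) \<odot> k'"
        using F unfolding hecke_spec_def by blast
      have "g \<in> Kbar p 1" unfolding k(3) using y1 k(1,2)[THEN Kbar_2_1] by (intro Kbar_mult) simp_all
      then obtain j k'' where "j \<in> {0..<int p}" "k'' \<in> Kbar p 2" "g = yj j \<odot> k''"
        unfolding yj_def by (rule Kbar_1_coset)
      then show False using g by blast
    qed
  qed (simp_all add: disjoint_yj coset_in_sets_dg)
  moreover have "measure dg ((\<lambda>h. yj j \<odot> h) ` Kbar p 2) = 1" for j
    unfolding measure_def emeasure_left[OF yj_carrier Kbar_2_in_sets] vol by simp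
  moreover have "F (yj j) = (if absp (of_int j :: 'a) = 1 \<and> lg (of_int j) = lg a then 1 else 0)" for j
    unfolding F_def yj_def using a absp_of_int_le by (rule hecke_fun_y)
  ultimately show ?thesis
    unfolding V1_op_def hecke_act_def F_def[symmetric] using x
    by (simp add: has_bochner_integral_integral_eq)
qed

lemma V1_op_VE: "v \<in> VE 2 \<Longrightarrow> absp a = 1 \<Longrightarrow> V1_op p dg \<eta> a v \<in> VE 2"
  unfolding V1_op_def
  by (rule hecke_act_VE[OF hecke_spec_hecke_fun[OF compatible_y[OF mult_p_small]]]) simp_all

lemma VE_add: "u \<in> VE 2 \<Longrightarrow> v \<in> VE 2 \<Longrightarrow> u + v \<in> VE 2"
  by (rule VE_2_I) (simp_all add: VE_off VE_left VE_right algebra_simps)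

lemma VE_scale: "v \<in> VE 2 \<Longrightarrow> cscale c v \<in> VE 2"
  by (rule VE_2_I) (simp_all add: cscale_def VE_off VE_left VE_right)

lemma VE_diff: "u \<in> VE 2 \<Longrightarrow> v \<in> VE 2 \<Longrightarrow> u - v \<in> VE 2"
  by (rule VE_2_I) (simp_all add: VE_off VE_left VE_right algebra_simps)

lemma absp_of_int_cases: "absp (of_int j :: 'a) = 1 \<or> absp (of_int j :: 'a) < 1"
  using absp_of_int_le[of j] by linarith

text \<open>Restriction to integers, which turns functions of the residue into periodic functions
  that can be summed over 0, ..., p - 1.\<close>

definition phi :: "('a mp \<Rightarrow> complex) \<Rightarrow> int \<Rightarrow> complex" where
  "phi v n = ph v (of_int n)"

lemma phi_cong: "v \<in> VE 2 \<Longrightarrow> [m = n] (mod int p) \<Longrightarrow> phi v m = phi v n"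
  unfolding phi_def using absp_of_int_le by (intro ph_cong) (simp_all add: of_int_close_iff_1)

lemma phi_mod: "v \<in> VE 2 \<Longrightarrow> phi v (n mod int p) = phi v n"
  by (rule phi_cong) (simp_all add: cong_def)

lemma ph_add_yj: "v (y_elt (of_int n * of_nat p) \<odot> yj j) = phi v (n + j)"
proof -
  have "absp (of_int n * of_nat p :: 'a) < 1" "absp (of_int j * of_nat p :: 'a) < 1"
    by (intro mult_p_small absp_of_int_le)+
  then show ?thesis by (simp add: phi_def ph_def yj_def y_elt_add distrib_right)
qed

lemma phi_square:
  assumes v: "v \<in> VE 2" and t: "absp t = 1"
  shows "phi v ((residue_mod p t)\<^sup>2 * j) = chi t * phi v j"
proof -
  define r where "r = residue_mod p t"
  have r: "absp (t - of_int r) < 1" using residue_mod(3)[of t] t by (simp add: r_def)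
  have "t\<^sup>2 - of_int (r\<^sup>2) = (t - of_int r) * (t + of_int r)" by (simp add: power2_eq_square algebra_simps)
  moreover have "absp (t + of_int r) \<le> 1" using t absp_of_int_le by (intro absp_add_le) simp_all
  then have "absp (t - of_int r) * absp (t + of_int r) \<le> absp (t - of_int r) * 1" by (intro mult_left_mono) simp_all
  ultimately have tr: "absp (t\<^sup>2 - of_int (r\<^sup>2)) < 1" using r by (simp only: absp_mult)
  have "absp (of_int j * (t\<^sup>2 - of_int (r\<^sup>2)) :: 'a) \<le> 1 * absp (t\<^sup>2 - of_int (r\<^sup>2))"
    unfolding absp_mult by (intro mult_right_mono absp_of_int_le) simp
  then have "absp (of_int j * t\<^sup>2 - of_int (r\<^sup>2 * j)) < 1" using tr by (simp add: algebra_simps)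
  moreover have "absp (of_int j * t\<^sup>2) \<le> 1" using t absp_of_int_le[of j] by (simp add: absp_mult absp_power)
  ultimately have "ph v (of_int j * t\<^sup>2) = ph v (of_int (r\<^sup>2 * j))" using v by (intro ph_cong)
  then show ?thesis using ph_square[OF v absp_of_int_le t, of j] by (simp add: phi_def r_def)
qed

lemma coprime_p: "\<not> int p dvd r \<Longrightarrow> coprime r (int p)"
  using prime_p by (metis coprime_commute prime_imp_coprime prime_nat_int_transfer)

text \<open>Multiplication by the square of a nonzero residue permutes the summands and scales the
  sum by \<open>chi t\<close>, and some \<open>chi t\<close> differs from 1.\<close>

lemma sum_phi_0:
  assumes v: "v \<in> VE 2"
  shows "(\<Sum>j\<in>{0..<int p}. phi v j) = 0"
proof -
  obtain t where t: "absp t = 1" "chi t \<noteq> 1" using chi_nontrivial by blast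
  define r where "r = residue_mod p t"
  have "\<not> int p dvd r" using residue_mod_cong_0[OF t(1)] by (simp add: r_def cong_0_iff)
  then have cop: "coprime (r\<^sup>2) (int p)" using coprime_p by simp
  have "(\<Sum>j\<in>{0..<int p}. phi v (r\<^sup>2 * j + 0)) = (\<Sum>j\<in>{0..<int p}. phi v j)"
    by (rule sum_periodic_affine[of "phi v", OF phi_mod[OF v] cop p_gt_0])
  then have "chi t * (\<Sum>j\<in>{0..<int p}. phi v j) = (\<Sum>j\<in>{0..<int p}. phi v j)"
    using phi_square[OF v t(1)] by (simp add: r_def sum_distrib_left)
  then show ?thesis using t(2) by simp
qed

lemma sum_phi_shift: "v \<in> VE 2 \<Longrightarrow> (\<Sum>j\<in>{0..<int p}. phi v (n + j)) = 0"
  using sum_periodic_affine[of "phi v" p 1 n] phi_mod[of v] sum_phi_0[of v] p_gt_0 by (simp add: add.commute)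

lemma Legendre_mod: "Legendre (n mod int p) (int p) = Legendre n (int p)"
  by (rule Legendre_cong) (simp add: cong_def)

lemma Legendre_mod_diff: "Legendre (a - n mod int p) (int p) = Legendre (a - n) (int p)"
  by (rule Legendre_cong) (simp add: cong_def mod_diff_right_eq)

lemma sum_Legendre: "(\<Sum>j\<in>{0..<int p}. of_int (Legendre j (int p))) = (0 :: complex)"
  using sum_squares_mod[OF prime_p p_gt_2, of "\<lambda>_. 1"] by (simp add: sum.distrib)

text \<open>The convolution square of the Legendre symbol, which two applications of
  \<open>W\<close> produce.\<close>

definition jac :: "int \<Rightarrow> complex" where
  "jac m = (\<Sum>i\<in>{0..<int p}. of_int (Legendre i (int p) * Legendre (m - i) (int p)))"

text \<open>The autocorrelation of the Legendre symbol: constant off 0 by scaling, and its values sum to 0.\<close>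
lemma jac_eq:
  assumes m: "m \<in> {0..<int p}"
  shows "jac m = of_int (Legendre (- 1) (int p)) * ((if m = 0 then of_nat p else 0) - 1)"
proof -
  have L_sq: "Legendre i (int p) * Legendre i (int p) = (if int p dvd i then 0 else 1)" for i
    by (auto simp: Legendre_def cong_0_iff)
  have Lm: "Legendre (a * b) (int p) = Legendre a (int p) * Legendre b (int p)" for a b
    by (rule Legendre_mult[OF prime_p p_gt_2])
  have per: "complex_of_int (Legendre (n mod int p) (int p) * Legendre (m - n mod int p) (int p)) =
      of_int (Legendre n (int p) * Legendre (m - n) (int p))" for m n
    by (simp only: Legendre_mod Legendre_mod_diff)
  have dvd: "int p dvd i \<longleftrightarrow> i = 0" if "i \<in> {0..<int p}" for i
    using that zdvd_imp_le[of "int p" i] by (cases "i = 0") auto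
  have z: "jac 0 = of_int (Legendre (- 1) (int p)) * (of_nat p - 1)"
  proof -
    have "Legendre i (int p) * Legendre (0 - i) (int p) = Legendre (- 1) (int p) * (if i = 0 then 0 else 1)"
      if "i \<in> {0..<int p}" for i
      using Lm[of "- 1" i] L_sq[of i] dvd[OF that] by (simp add: mult.left_commute)
    then have "jac 0 = (\<Sum>i\<in>{0..<int p}. of_int (Legendre (- 1) (int p)) * (1 - (if i = 0 then 1 else 0)))"
      unfolding jac_def by (intro sum.cong) auto
    then show ?thesis using p_gt_0 by (simp add: sum_distrib_left[symmetric] sum_subtractf sum.delta)
  qed
  have one: "jac m = jac 1" if m: "m \<in> {0..<int p}" "m \<noteq> 0" for m
  proof -
    have nd: "\<not> int p dvd m" using m dvd by blast
    have "jac m = (\<Sum>i\<in>{0..<int p}. of_int (Legendre (m * i + 0) (int p) * Legendre (m - (m * i + 0)) (int p)))"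
      unfolding jac_def using coprime_p[OF nd] p_gt_0 per
      by (intro sum_periodic_affine[of "\<lambda>i. of_int (Legendre i (int p) * Legendre (m - i) (int p))", symmetric]) auto
    also have "\<dots> = jac 1"
      unfolding jac_def
    proof (intro sum.cong refl)
      fix i
      have "m - (m * i + 0) = m * (1 - i)" by (simp add: algebra_simps)
      then have "Legendre (m * i + 0) (int p) * Legendre (m - (m * i + 0)) (int p) =
          (Legendre m (int p) * Legendre m (int p)) * (Legendre i (int p) * Legendre (1 - i) (int p))"
        by (simp only: add_0_right Lm mult_ac)
      then show "(of_int (Legendre (m * i + 0) (int p) * Legendre (m - (m * i + 0)) (int p)) :: complex) =
          of_int (Legendre i (int p) * Legendre (1 - i) (int p))"
        using L_sq[of m] nd by simp
    qed
    finally show ?thesis .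
  qed
  have "(\<Sum>m\<in>{0..<int p}. jac m) = 0"
  proof -
    have inner: "(\<Sum>m\<in>{0..<int p}. of_int (Legendre (m - i) (int p))) = (0 :: complex)" for i
      using sum_periodic_affine[of "\<lambda>m. of_int (Legendre m (int p)) :: complex" p 1 "- i"] Legendre_mod p_gt_0 sum_Legendre
      by simp
    have "(\<Sum>m\<in>{0..<int p}. jac m) =
        (\<Sum>i\<in>{0..<int p}. of_int (Legendre i (int p)) * (\<Sum>m\<in>{0..<int p}. of_int (Legendre (m - i) (int p))))"
      unfolding jac_def by (subst sum.swap) (simp add: sum_distrib_left)
    also have "\<dots> = 0" by (simp only: inner mult_zero_right sum.neutral_const)
    finally show ?thesis .
  qed
  moreover have "(\<Sum>m\<in>{0..<int p}. jac m) = (\<Sum>m\<in>{0..<int p}. (if m = 0 then jac 0 - jac 1 else 0) + jac 1)"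
  proof (intro sum.cong refl)
    fix m assume m: "m \<in> {0..<int p}"
    show "jac m = (if m = 0 then jac 0 - jac 1 else 0) + jac 1"
    proof (cases "m = 0")
      case False
      show ?thesis using one[OF m False] False by simp
    qed simp
  qed
  ultimately have "jac 0 - jac 1 + of_nat p * jac 1 = 0"
    using p_gt_0 by (simp add: sum.distrib sum.delta)
  then have "(of_nat p - 1) * jac 1 = (of_nat p - 1) * (- of_int (Legendre (- 1) (int p)))"
    unfolding z by (simp add: algebra_simps)
  moreover have nz: "(of_nat p - 1 :: complex) \<noteq> 0" using p_gt_1 by simp
  ultimately have "jac 1 = - of_int (Legendre (- 1) (int p))" unfolding mult_left_cancel[OF nz] by simp
  then show ?thesis using z one[OF m] by (cases "m = 0") simp_all
qed

section \<open>\<open>Y\<close> and \<open>W\<close> as convolution operators on residues\<close>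

context
  fixes l :: 'a
  assumes l: "absp l = 1" "lg l = - 1"
begin

abbreviation W :: "('a mp \<Rightarrow> complex) \<Rightarrow> 'a mp \<Rightarrow> complex" where "W \<equiv> W1_op p dg \<eta> l"
abbreviation Y :: "('a mp \<Rightarrow> complex) \<Rightarrow> 'a mp \<Rightarrow> complex" where "Y \<equiv> Y1_op p dg \<eta> l"

lemma W_VE: "v \<in> VE 2 \<Longrightarrow> W v \<in> VE 2"
  unfolding W1_op_def using l by (intro VE_diff V1_op_VE) simp_all

lemma Y_VE: "v \<in> VE 2 \<Longrightarrow> Y v \<in> VE 2"
  unfolding Y1_op_def using l by (intro VE_add V1_op_VE) simp_all

text \<open>The difference of the indicators of the two square classes is the Legendre symbol, with
  value 0 at multiples of \<open>p\<close>.\<close>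

lemma W_eq:
  assumes v: "v \<in> VE 2" and x: "x \<in> carrier (Mp p)"
  shows "W v x = (\<Sum>j\<in>{0..<int p}. of_int (Legendre j (int p)) * v (x \<odot> yj j))"
proof -
  have "(if absp (of_int j :: 'a) = 1 \<and> lg (of_int j) = lg 1 then 1 else 0) -
      (if absp (of_int j :: 'a) = 1 \<and> lg (of_int j) = lg l then 1 else 0) = (of_int (Legendre j (int p)) :: complex)" for j
    using absp_of_int_cases[of j] lg_cases[of "of_int j"] lg_not_unit[of "of_int j"] l lg_of_int[of j] by auto
  then show ?thesis
    using V1_op_eq[OF v _ x, of 1] V1_op_eq[OF v l(1) x] unfolding W1_op_def
    by (simp flip: sum_subtractf left_diff_distrib)
qed

text \<open>The identity operator contributes the residue \<open>j = 0\<close>, which neither square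
  class contains.\<close>

lemma Y_eq:
  assumes v: "v \<in> VE 2" and x: "x \<in> carrier (Mp p)"
  shows "Y v x = (\<Sum>j\<in>{0..<int p}. v (x \<odot> yj j))"
proof -
  have c: "(if absp (of_int j :: 'a) = 1 \<and> lg (of_int j) = 1 then 1 else 0) +
      (if absp (of_int j :: 'a) = 1 \<and> lg (of_int j) = lg l then 1 else 0) = (if j = 0 then 0 else 1 :: complex)"
    if j: "j \<in> {0..<int p}" for j
  proof (cases "j = 0")
    case False
    then have "\<not> int p dvd j" using j zdvd_imp_le[of "int p" j] by auto
    then have "absp (of_int j :: 'a) = 1" by (rule absp_of_int_eq_1)
    then show ?thesis using lg_cases[of "of_int j"] l False by auto
  qed simp
  have "V1_op p dg \<eta> 1 v x + V1_op p dg \<eta> l v x = (\<Sum>j\<in>{0..<int p}. (if j = 0 then 0 else 1) * v (x \<odot> yj j))"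
  proof -
    have 1: "V1_op p dg \<eta> 1 v x =
        (\<Sum>j\<in>{0..<int p}. (if absp (of_int j :: 'a) = 1 \<and> lg (of_int j) = 1 then 1 else 0) * v (x \<odot> yj j))"
      using V1_op_eq[OF v _ x, of 1] by simp
    show ?thesis
      unfolding 1 V1_op_eq[OF v l(1) x] sum.distrib[symmetric] distrib_right[symmetric]
      by (rule sum.cong[OF refl]) (simp only: c)
  qed
  moreover have "v x = (\<Sum>j\<in>{0..<int p}. if j = 0 then v (x \<odot> yj j) else 0)"
    using x p_gt_0 by (simp add: sum.delta yj_def y_elt_0)
  ultimately have "Y v x = (\<Sum>j\<in>{0..<int p}. (if j = 0 then v (x \<odot> yj j) else 0) + (if j = 0 then 0 else 1) * v (x \<odot> yj j))"
    unfolding Y1_op_def by (simp add: sum.distrib add.assoc)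
  also have "\<dots> = (\<Sum>j\<in>{0..<int p}. v (x \<odot> yj j))" by (intro sum.cong) auto
  finally show ?thesis .
qed

lemma phi_W: "v \<in> VE 2 \<Longrightarrow> phi (W v) n = (\<Sum>j\<in>{0..<int p}. of_int (Legendre j (int p)) * phi v (n + j))"
  unfolding phi_def[of "W v"] ph_def by (subst W_eq) (simp_all add: y_elt_carrier ph_add_yj)

lemma phi_Y: "v \<in> VE 2 \<Longrightarrow> phi (Y v) n = (\<Sum>j\<in>{0..<int p}. phi v (n + j))"
  unfolding phi_def[of "Y v"] ph_def by (subst Y_eq) (simp_all add: y_elt_carrier ph_add_yj)

lemma phi_determines:
  assumes v: "v \<in> VE 2" and z: "\<And>n. phi v n = 0"
  shows "v = 0"
proof (rule VE_2_eq_0[OF v l])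
  show "ph v 1 = 0" using z[of 1] by (simp add: phi_def)
  have "ph v l = phi v (residue_mod p l)"
    unfolding phi_def using residue_mod(3)[of l] l by (intro ph_cong[OF v]) simp_all
  then show "ph v l = 0" using z by simp
qed

lemma Y_eq_0:
  assumes v: "v \<in> VE 2" shows "Y v = 0"
  by (rule phi_determines[OF Y_VE[OF v]]) (simp add: phi_Y[OF v] sum_phi_shift[OF v])

text \<open>The convolution kernel \<open>jac\<close> is \<open>p\<close> times a delta function
  minus a constant, up to the symbol of - 1; the constant is annihilated because
  \<open>phi v\<close> sums to 0 over the residues.\<close>

lemma W_W:
  assumes v: "v \<in> VE 2"
  shows "W (W v) = cscale (of_int (lg (- 1)) * of_nat p) v"
proof -
  let ?L = "\<lambda>j. complex_of_int (Legendre j (int p))"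
  have "W (W v) - cscale (of_int (lg (- 1)) * of_nat p) v = 0"
  proof (rule phi_determines)
    show "W (W v) - cscale (of_int (lg (- 1)) * of_nat p) v \<in> VE 2"
      using v by (intro VE_diff W_VE VE_scale)
    fix n
    have "phi (W (W v)) n = (\<Sum>i\<in>{0..<int p}. ?L i * (\<Sum>j\<in>{0..<int p}. ?L j * phi v (n + i + j)))"
      by (simp add: phi_W[OF W_VE[OF v]] phi_W[OF v])
    also have "\<dots> = (\<Sum>i\<in>{0..<int p}. ?L i * (\<Sum>m\<in>{0..<int p}. ?L (m - i) * phi v (n + m)))"
    proof -
      have "(\<Sum>m\<in>{0..<int p}. ?L (1 * m + (- i)) * phi v (n + i + (1 * m + (- i)))) =
          (\<Sum>j\<in>{0..<int p}. ?L j * phi v (n + i + j))" for i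
      proof (rule sum_periodic_affine[of "\<lambda>j. ?L j * phi v (n + i + j)"])
        show "?L (j mod int p) * phi v (n + i + j mod int p) = ?L j * phi v (n + i + j)" for j
          using phi_cong[OF v, of "n + i + j mod int p" "n + i + j"]
          by (simp add: Legendre_mod cong_def mod_add_right_eq)
      qed (use p_gt_0 in auto)
      then have "(\<Sum>j\<in>{0..<int p}. ?L j * phi v (n + i + j)) = (\<Sum>m\<in>{0..<int p}. ?L (m - i) * phi v (n + m))" for i
        by simp
      then show ?thesis by simp
    qed
    also have "\<dots> = (\<Sum>i\<in>{0..<int p}. \<Sum>m\<in>{0..<int p}. of_int (Legendre i (int p) * Legendre (m - i) (int p)) * phi v (n + m))"
      by (simp add: sum_distrib_left mult.assoc)
    also have "\<dots> = (\<Sum>m\<in>{0..<int p}. jac m * phi v (n + m))"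
      unfolding jac_def by (subst sum.swap) (simp only: sum_distrib_right)
    also have "\<dots> = (\<Sum>m\<in>{0..<int p}. ?L (- 1) * ((if m = 0 then of_nat p * phi v n else 0) - phi v (n + m)))"
      by (intro sum.cong refl) (auto simp: jac_eq algebra_simps)
    also have "\<dots> = ?L (- 1) * (of_nat p * phi v n - (\<Sum>m\<in>{0..<int p}. phi v (n + m)))"
      using p_gt_0 by (simp add: sum_distrib_left[symmetric] sum_subtractf sum.delta)
    finally have "phi (W (W v)) n = ?L (- 1) * of_nat p * phi v n"
      using sum_phi_shift[OF v, of n] by (simp add: mult.assoc)
    moreover have "lg (- 1) = Legendre (- 1) (int p)" using lg_of_int[of "- 1"] by simp
    ultimately show "phi (W (W v) - cscale (of_int (lg (- 1)) * of_nat p) v) n = 0"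
      by (simp add: phi_def ph_def cscale_def)
  qed
  then show ?thesis by simp
qed

lemma W_add: "u \<in> VE 2 \<Longrightarrow> v \<in> VE 2 \<Longrightarrow> W (u + v) = W u + W v"
proof -
  assume uv: "u \<in> VE 2" "v \<in> VE 2"
  have "W (u + v) - (W u + W v) = 0"
  proof (rule phi_determines)
    show "W (u + v) - (W u + W v) \<in> VE 2" using uv by (intro VE_diff W_VE VE_add)
    fix n
    have "phi (W (u + v) - (W u + W v)) n = phi (W (u + v)) n - (phi (W u) n + phi (W v) n)"
      by (simp add: phi_def ph_def)
    moreover have "phi (u + v) k = phi u k + phi v k" for k by (simp add: phi_def ph_def)
    ultimately show "phi (W (u + v) - (W u + W v)) n = 0"
      using uv by (simp add: phi_W VE_add distrib_left sum.distrib)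
  qed
  then show ?thesis by simp
qed

lemma W_scale: "v \<in> VE 2 \<Longrightarrow> W (cscale c v) = cscale c (W v)"
proof -
  assume v: "v \<in> VE 2"
  have "W (cscale c v) - cscale c (W v) = 0"
  proof (rule phi_determines)
    show "W (cscale c v) - cscale c (W v) \<in> VE 2" using v by (intro VE_diff W_VE VE_scale)
    fix n
    have "phi (W (cscale c v) - cscale c (W v)) n = phi (W (cscale c v)) n - c * phi (W v) n"
      by (simp add: phi_def ph_def cscale_def)
    moreover have "phi (cscale c v) k = c * phi v k" for k by (simp add: phi_def ph_def cscale_def)
    ultimately show "phi (W (cscale c v) - cscale c (W v)) n = 0"
      using v by (simp add: phi_W VE_scale sum_distrib_left mult.left_commute)
  qed
  then show ?thesis by simp
qed

end

end

subsection \<open>The eigenbasis\<close>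

text \<open>An empty space would also differ from \<open>{0}\<close>. With 0 always a member, the
  condition in \<open>c_eta\<close> and in the hypothesis does mean that a nonzero vector
  exists.\<close>

lemma (in principal) zero_in_V_eta: "0 \<in> VE m"
proof -
  have o: "openin (Mp_topology p) (carrier (Mp p) :: 'a mp set)"
  proof (rule openin_Mp_invariant)
    fix g u :: "_" assume "g \<in> (carrier (Mp p) :: 'a mp set)" "(u, 1) \<in> (Kbar p 2 :: 'a mp set)"
    then show "g \<odot> (u, 1) \<in> carrier (Mp p)" using Kbar_carrier by (intro G.m_closed) blast+
  qed simp
  show ?thesis unfolding V_eta_def V_space_def
    using o by (auto intro!: exI[of _ "carrier (Mp p) :: 'a mp set"])
qed

locale hecke_even = hecke p ty dx \<psi> \<mu> \<eta> dg + principal_even p ty dx \<psi> \<mu> \<eta>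
  for p and ty :: "'a::{field_char_0,complete_space} itself" and dx \<psi> \<mu> \<eta> dg +
  fixes l :: 'a
  assumes l: "absp l = 1" "lg l = - 1"
begin

abbreviation f1 :: "'a mp \<Rightarrow> complex" where "f1 \<equiv> f_fun p dx \<psi> \<mu> \<eta> (of_nat p)"
abbreviation fl :: "'a mp \<Rightarrow> complex" where "fl \<equiv> ff l"
abbreviation Wop :: "('a mp \<Rightarrow> complex) \<Rightarrow> 'a mp \<Rightarrow> complex" where "Wop \<equiv> W1_op p dg \<eta> l"

lemma f1_VE: "f1 \<in> VE 2" and fl_VE: "fl \<in> VE 2"
  using ff_in_VE[of 1] ff_in_VE[of l] l by simp_all

lemma ph_f: "ph f1 1 = 1" "ph f1 l = 0" "ph fl 1 = 0" "ph fl l = 1"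
  using ph_ff_same[of 1] ph_ff_same[of l] ph_ff_other[of 1 l] ph_ff_other[of l 1] l by simp_all

lemma VE_span:
  assumes v: "v \<in> VE 2"
  shows "v = cscale (ph v 1) f1 + cscale (ph v l) fl"
proof -
  have "v - (cscale (ph v 1) f1 + cscale (ph v l) fl) = 0"
  proof (rule VE_2_eq_0[OF _ l])
    show "v - (cscale (ph v 1) f1 + cscale (ph v l) fl) \<in> VE 2"
      using v f1_VE fl_VE by (intro VE_diff VE_add VE_scale)
    have "ph (v - (cscale (ph v 1) f1 + cscale (ph v l) fl)) z = ph v z - (ph v 1 * ph f1 z + ph v l * ph fl z)" for z
      by (simp add: ph_def cscale_def)
    then show "ph (v - (cscale (ph v 1) f1 + cscale (ph v l) fl)) 1 = 0"
      "ph (v - (cscale (ph v 1) f1 + cscale (ph v l) fl)) l = 0" by (simp_all add: ph_f)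
  qed
  then show ?thesis by (simp only: right_minus_eq)
qed

lemma VE_in_span: "v \<in> VE 2 \<Longrightarrow> v \<in> cfun.span {f1, fl}"
  by (subst VE_span, assumption) (intro cfun.span_add cfun.span_scale cfun.span_base, simp_all)

lemma f1_not_multiple: "f1 \<noteq> cscale c fl"
proof
  assume "f1 = cscale c fl"
  then have "ph f1 1 = c * ph fl 1" by (simp add: ph_def cscale_def)
  then show False by (simp add: ph_f)
qed

lemma fl_nonzero: "fl \<noteq> 0" and f1_nonzero: "f1 \<noteq> 0"
  using ph_f by (auto simp: ph_def)

lemma independent_pair:
  assumes "v \<noteq> (0 :: 'a mp \<Rightarrow> complex)" "\<And>c. u \<noteq> cscale c v"
  shows "cfun.independent {u, v}" and "u \<noteq> v"
proof -
  have "u \<notin> cfun.span {v}" unfolding cfun.span_singleton using assms(2) by auto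
  moreover have "cfun.independent {v}"
    using assms(1) by (simp only: cfun.dependent_single not_False_eq_True)
  ultimately show "cfun.independent {u, v}" by (rule cfun.independent_insertI)
  show "u \<noteq> v"
  proof
    assume "u = v"
    then have "u = cscale 1 v" by (simp add: cscale_def)
    then show False using assms(2) by blast
  qed
qed

text \<open>Since \<open>l\<close> is a nonresidue, \<open>fl\<close> is \<open>f1\<close> rescaled by \<open>l\<close>; this makes \<open>W\<close> traceless.\<close>
lemma ph_fl_scale:
  assumes z: "absp z \<le> 1" shows "ph fl (l * z) = ph f1 z"
proof -
  have l_z: "absp (l * z) = absp z" using l by (simp add: absp_mult)
  show ?thesis
  proof (cases "absp z < 1")
    case True
    have "ph fl (l * z) = ph fl 0" using l_z True by (intro ph_cong[OF fl_VE]) simp_all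
    moreover have "ph f1 z = ph f1 0" using True by (intro ph_cong[OF f1_VE]) simp_all
    ultimately show ?thesis using ph_0[OF fl_VE] ph_0[OF f1_VE] by simp
  next
    case False
    then have u: "absp z = 1" using z by simp
    have one: "absp (1 :: 'a) = 1" by simp
    from lg_cases[OF u] show ?thesis
    proof
      assume "lg z = 1"
      then have "lg 1 = lg z" by simp
      then obtain t where t: "z = 1 * t\<^sup>2" "absp t = 1" by (rule nonresidue_square_class[OF one u])
      then show ?thesis
        using ph_square[OF fl_VE _ t(2), of l] ph_square[OF f1_VE _ t(2), of 1] l by (simp add: ph_f)
    next
      assume "lg z = - 1"
      then have "lg l = lg z" using l by simp
      then obtain t where t: "z = l * t\<^sup>2" "absp t = 1" by (rule nonresidue_square_class[OF l(1) u])
      have lt: "absp (l * t) = 1" using l t by (simp add: absp_mult)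
      have "l * z = 1 * (l * t)\<^sup>2" by (simp add: t(1) power2_eq_square)
      then have "ph fl (l * z) = 0" using ph_square[OF fl_VE _ lt, of 1] by (simp add: ph_f)
      moreover have "ph f1 z = 0" using ph_square[OF f1_VE _ t(2), of l] l by (simp add: t(1) ph_f)
      ultimately show ?thesis by simp
    qed
  qed
qed

text \<open>These are the diagonal entries of \<open>Wop\<close> in the basis \<open>f1\<close>,
  \<open>fl\<close>. Rescaling the residues by the nonresidue \<open>r\<close> carries
  \<open>fl\<close> to \<open>f1\<close> and reverses the sign of the Legendre kernel.\<close>

lemma W_trace: "ph (Wop fl) l = - ph (Wop f1) 1"
proof -
  define r where "r = residue_mod p l"
  have r: "absp (l - of_int r) < 1" using residue_mod(3)[of l] l by (simp add: r_def)
  have Lr: "Legendre r (int p) = - 1" using l(2) by (simp add: lg_def r_def)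
  have "\<not> int p dvd r" using residue_mod_cong_0[OF l(1)] by (simp add: r_def cong_0_iff)
  then have cop: "coprime r (int p)" by (rule coprime_p)
  have phi_r: "phi fl (r * n) = phi f1 n" for n
  proof -
    have n: "absp (of_int n :: 'a) \<le> 1" by (rule absp_of_int_le)
    have "absp ((l - of_int r) * of_int n) \<le> absp (l - of_int r) * 1"
      unfolding absp_mult using n by (intro mult_left_mono) simp_all
    then have "absp (l * of_int n - of_int (r * n)) < 1" using r by (simp add: algebra_simps)
    moreover have "absp (l * of_int n) \<le> 1" using l n by (simp add: absp_mult)
    ultimately have "ph fl (l * of_int n) = ph fl (of_int (r * n))" by (intro ph_cong[OF fl_VE])
    then show ?thesis using ph_fl_scale[OF n] by (simp add: phi_def)
  qed
  have "ph (Wop fl) l = phi (Wop fl) r"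
    unfolding phi_def using r l by (intro ph_cong[OF W_VE[OF l fl_VE]]) simp_all
  also have "\<dots> = (\<Sum>j\<in>{0..<int p}. of_int (Legendre j (int p)) * phi fl (r + j))"
    by (rule phi_W[OF l fl_VE])
  also have "\<dots> = (\<Sum>j\<in>{0..<int p}. of_int (Legendre (r * j + 0) (int p)) * phi fl (r + (r * j + 0)))"
  proof (rule sum_periodic_affine[of "\<lambda>j. of_int (Legendre j (int p)) * phi fl (r + j)", OF _ cop p_gt_0, symmetric])
    show "of_int (Legendre (j mod int p) (int p)) * phi fl (r + j mod int p) = of_int (Legendre j (int p)) * phi fl (r + j)" for j
      using phi_cong[OF fl_VE, of "r + j mod int p" "r + j"]
      by (simp add: Legendre_mod cong_def mod_add_right_eq)
  qed
  also have "\<dots> = (\<Sum>j\<in>{0..<int p}. - (of_int (Legendre j (int p)) * phi f1 (1 + j)))"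
  proof (intro sum.cong refl)
    fix j
    have "r + (r * j + 0) = r * (1 + j)" by (simp add: algebra_simps)
    then show "of_int (Legendre (r * j + 0) (int p)) * phi fl (r + (r * j + 0)) =
        - (of_int (Legendre j (int p)) * phi f1 (1 + j))"
      using phi_r[of "1 + j"] Lr by (simp add: Legendre_mult[OF prime_p p_gt_2])
  qed
  also have "\<dots> = - phi (Wop f1) 1" by (simp add: phi_W[OF l f1_VE] sum_negf)
  finally show ?thesis by (simp add: phi_def)
qed

text \<open>A nonzero scalar on a plane has nonzero trace.\<close>

lemma W_not_scalar:
  assumes "c \<noteq> 0" shows "\<exists>f\<in>{f1, fl}. Wop f \<noteq> cscale c f"
proof (rule ccontr)
  assume "\<not> ?thesis"
  then have "Wop f1 = cscale c f1" "Wop fl = cscale c fl" by blast+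
  then have "ph (Wop f1) 1 = c" "ph (Wop fl) l = c"
    using ph_f by (simp_all add: ph_def cscale_def)
  then show False using W_trace assms by simp
qed

text \<open>As \<open>Wop\<close> squares to \<open>s * s\<close>, the image of Wop + s consists of
  eigenvectors for \<open>s\<close> and 0. It is not zero because \<open>Wop\<close> is not the
  scalar \<open>- s\<close>.\<close>

lemma eigenvector:
  assumes s: "s * s = of_int (lg (- 1)) * of_nat p" and s0: "s \<noteq> 0"
  obtains v where "v \<in> VE 2" "v \<noteq> 0" "Wop v = cscale s v"
proof -
  obtain f where f: "f \<in> {f1, fl}" "Wop f \<noteq> cscale (- s) f" using W_not_scalar[of "- s"] s0 by auto
  have fV: "f \<in> VE 2" using f(1) f1_VE fl_VE by blast
  define v where "v = Wop f + cscale s f"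
  have v: "v \<in> VE 2" unfolding v_def using fV by (intro VE_add W_VE[OF l] VE_scale)
  have "v \<noteq> 0"
  proof
    assume "v = 0"
    then have "Wop f = - cscale s f" unfolding v_def by (simp only: eq_neg_iff_add_eq_0)
    also have "- cscale s f = cscale (- s) f" by (simp add: cscale_def fun_eq_iff)
    finally show False using f(2) by blast
  qed
  moreover have "Wop v = cscale s v"
  proof -
    have "Wop v = Wop (Wop f) + cscale s (Wop f)"
      unfolding v_def using fV by (simp add: W_add[OF l] W_VE[OF l] VE_scale W_scale[OF l])
    also have "Wop (Wop f) = cscale (s * s) f" unfolding s by (rule W_W[OF l fV])
    also have "cscale (s * s) f + cscale s (Wop f) = cscale s (Wop f + cscale s f)"
      by (rule ext) (simp add: cscale_def algebra_simps)
    finally show ?thesis unfolding v_def .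
  qed
  ultimately show ?thesis using v that by blast
qed

text \<open>Formulated for an arbitrary square root \<open>s\<close> of p*, so that the Weil index
  enters only through its square.\<close>

theorem eigenbasis:
  assumes s: "s * s = of_int (lg (- 1)) * of_nat p"
  shows "{f1, fl} \<subseteq> VE 2 \<and> cfun.dim (cfun.span {f1, fl}) = 2 \<and>
    (\<exists>v1 v2. v1 \<noteq> v2 \<and> cfun.independent {v1, v2} \<and> cfun.span {v1, v2} = cfun.span {f1, fl} \<and>
      U0_op p dg \<eta> v1 = 0 \<and> U0_op p dg \<eta> v2 = 0 \<and> Y1_op p dg \<eta> l v1 = 0 \<and> Y1_op p dg \<eta> l v2 = 0 \<and>
      Wop v1 = cscale s v1 \<and> Wop v2 = cscale (- s) v2)"
proof (intro conjI)
  have s0: "s \<noteq> 0"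
  proof
    assume "s = 0"
    then show False using s lg_cases[of "- 1"] p_gt_0 by auto
  qed
  show "{f1, fl} \<subseteq> VE 2" using f1_VE fl_VE by blast
  have ind: "cfun.independent {f1, fl}" and ne: "f1 \<noteq> fl"
    using independent_pair[OF fl_nonzero f1_not_multiple] by blast+
  show "cfun.dim (cfun.span {f1, fl}) = 2"
    unfolding cfun.dim_span_eq_card_independent[OF ind] using ne by simp
  obtain v1 where v1: "v1 \<in> VE 2" "v1 \<noteq> 0" "Wop v1 = cscale s v1" using s s0 by (rule eigenvector)
  have s': "(- s) * (- s) = of_int (lg (- 1)) * of_nat p" and s0': "- s \<noteq> 0" using s s0 by simp_all
  obtain v2 where v2: "v2 \<in> VE 2" "v2 \<noteq> 0" "Wop v2 = cscale (- s) v2" using s' s0' by (rule eigenvector)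
  have nm: "v1 \<noteq> cscale c v2" for c
  proof
    assume e: "v1 = cscale c v2"
    obtain x where x: "v1 x \<noteq> 0" using v1(2) by (auto simp: fun_eq_iff)
    have "cscale s v1 = cscale c (cscale (- s) v2)"
      using W_scale[OF l v2(1), of c] unfolding e[symmetric] v1(3) v2(3) .
    from fun_cong[OF this, of x] have "s * v1 x = c * (- s * v2 x)" by (simp only: cscale_def)
    also have "\<dots> = - (s * v1 x)" by (simp add: e cscale_def)
    finally have "s * v1 x = 0" by simp
    then show False using s0 x by simp
  qed
  have ind': "cfun.independent {v1, v2}" and ne': "v1 \<noteq> v2"
    using independent_pair[OF v2(2) nm] by blast+
  have sub: "{v1, v2} \<subseteq> cfun.span {f1, fl}" using VE_in_span v1(1) v2(1) by blast
  have "cfun.span {v1, v2} = cfun.span {f1, fl}"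
  proof (rule cfun.span_subspace[OF sub _ cfun.subspace_span])
    have "f \<in> cfun.span {v1, v2}" if f: "f \<in> cfun.span {f1, fl}" for f
    proof (rule ccontr)
      assume nf: "f \<notin> cfun.span {v1, v2}"
      then have i3: "cfun.independent (insert f {v1, v2})" using ind' by (rule cfun.independent_insertI)
      have "f \<notin> {v1, v2}" using nf cfun.span_base by blast
      then have "card (insert f {v1, v2}) = 3" using ne' by simp
      moreover have "card (insert f {v1, v2}) \<le> card {f1, fl}"
        using cfun.independent_span_bound[OF _ i3, of "{f1, fl}"] sub f by simp
      ultimately show False using ne by simp
    qed
    then show "cfun.span {f1, fl} \<subseteq> cfun.span {v1, v2}" by blast
  qed
  then show "\<exists>v1 v2. v1 \<noteq> v2 \<and> cfun.independent {v1, v2} \<and> cfun.span {v1, v2} = cfun.span {f1, fl} \<and>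
      U0_op p dg \<eta> v1 = 0 \<and> U0_op p dg \<eta> v2 = 0 \<and> Y1_op p dg \<eta> l v1 = 0 \<and> Y1_op p dg \<eta> l v2 = 0 \<and>
      Wop v1 = cscale s v1 \<and> Wop v2 = cscale (- s) v2"
    using ne' ind' v1 v2 U0_eq_0[OF _ l] Y_eq_0[OF l] by (intro exI[of _ v1] exI[of _ v2]) simp
qed

text \<open>The function \<open>f1\<close> lives at level 2, and below it
  \<open>VE_low_level\<close> leaves only 0.\<close>

lemma c_eta_eq_2:
  assumes c: "cond_exp p \<eta> \<le> 2"
  shows "c_eta p dx \<psi> \<mu> \<eta> = 2"
  unfolding c_eta_def
proof (rule Least_equality)
  have "f1 \<in> VE 2" "f1 \<noteq> 0" by (rule f1_VE f1_nonzero)+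
  then show "cond_exp p \<eta> \<le> 2 \<and> VE 2 \<noteq> {0}" using c by blast
  fix m assume m: "cond_exp p \<eta> \<le> m \<and> VE m \<noteq> {0}"
  show "2 \<le> m"
  proof (rule ccontr)
    assume "\<not> 2 \<le> m"
    then have m1: "m \<le> 1" by simp
    have "0 \<in> VE m"
      by (rule zero_in_V_eta)
    then show False using m VE_low_level[OF _ m1] by blast
  qed
qed

end

text \<open>Doubling expands distances to 1, so no nontrivial subgroup stays within \<open>1/2\<close> of 1.\<close>
lemma no_small_subgroup:
  fixes z :: complex
  assumes "\<And>n. norm (z ^ n - 1) \<le> 1 / 2"
  shows "z = 1"
proof (rule ccontr)
  assume "z \<noteq> 1"
  then have pos: "norm (z - 1) > 0" by simp
  have grow: "(3 / 2) ^ k * norm (z - 1) \<le> norm (z ^ (2 ^ k) - 1)" for k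
  proof (induction k)
    case (Suc k)
    let ?w = "z ^ (2 ^ k)"
    have "norm (?w + 1) \<ge> 2 - norm (?w - 1)"
      using norm_triangle_ineq4[of "?w + 1" "?w - 1"] by simp
    then have ge: "norm (?w + 1) \<ge> 3 / 2" using assms[of "2 ^ k"] by simp
    have "z ^ (2 ^ Suc k) - 1 = (?w - 1) * (?w + 1)"
      by (simp add: power_mult power2_eq_square algebra_simps)
    then have "norm (z ^ (2 ^ Suc k) - 1) = norm (?w - 1) * norm (?w + 1)" by (simp only: norm_mult)
    also have "\<dots> \<ge> norm (?w - 1) * (3 / 2)" using ge by (intro mult_left_mono) simp_all
    finally show ?case using Suc by simp
  qed simp
  obtain k where "1 / norm (z - 1) < (3 / 2) ^ k" using real_arch_pow[of "3 / 2"] by auto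
  then have "1 < (3 / 2) ^ k * norm (z - 1)" using pos by (simp add: divide_less_eq)
  then show False using grow[of k] assms[of "2 ^ k"] by linarith
qed

section \<open>From the hypotheses to the locale assumptions\<close>

context padic
begin

text \<open>\<open>cond_exp\<close> is a least number, so its value is informative only once some
  level is known to exist. Continuity maps a small subgroup of units to a group of complex numbers
  near 1, and such a group is trivial.\<close>

lemma mult_character_near_1:
  assumes mu: "mult_character \<mu>" and c: "cond_exp p \<mu> = 1" and u: "absp (u - 1 :: 'a) < 1"
  shows "\<mu> u = 1"
proof -
  have mult: "\<mu> (x * y) = \<mu> x * \<mu> y" if "x \<noteq> 0" "y \<noteq> 0" for x y using mu that by (simp add: mult_character_def)
  have nz: "\<mu> x \<noteq> 0" if "x \<noteq> 0" for x using mu that by (simp add: mult_character_def)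
  have m1: "\<mu> 1 = 1" using mult[of 1 1] nz[of 1] by simp
  have pw: "\<mu> (x ^ n) = \<mu> x ^ n" if "x \<noteq> 0" for x n
    by (induction n) (simp_all add: m1 mult that)
  let ?P = "\<lambda>n. \<forall>u\<in>Zp_units. u - 1 \<in> pow_ideal p n \<longrightarrow> \<mu> u = 1"
  have "\<exists>n. ?P n"
  proof -
    have "continuous_on (- {0}) \<mu>" using mu by (simp add: mult_character_def)
    moreover have "(1 :: 'a) \<in> - {0}" by simp
    moreover have "(0 :: real) < 1 / 2" by simp
    ultimately obtain d where d: "d > 0" "\<forall>x\<in>- {0}. dist x 1 < d \<longrightarrow> dist (\<mu> x) (\<mu> 1) < 1 / 2"
      unfolding continuous_on_iff by blast
    obtain m :: nat where "real p powi (- (0 + int m)) < d" using d(1) by (rule pball_small)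
    then have m: "1 / real p ^ m < d" by (simp add: power_int_minus inverse_eq_divide)
    have "\<mu> x = 1" if x: "x \<in> Zp_units" "x - 1 \<in> pow_ideal p m" for x
    proof (rule no_small_subgroup)
      fix n
      have x1: "absp x = 1" "absp (x - 1) \<le> 1 / real p ^ m" using x by (simp_all add: Zp_units_def pow_ideal_iff)
      then have x0: "x \<noteq> 0" by auto
      have "absp (x ^ n - 1) \<le> 1 / real p ^ m"
      proof (induction n)
        case (Suc n)
        have eq: "x ^ Suc n - 1 = x * (x ^ n - 1) + (x - 1)" by (simp add: algebra_simps)
        have "absp (x * (x ^ n - 1)) \<le> 1 / real p ^ m" using Suc x1 by (simp add: absp_mult)
        from absp_add_le[OF this x1(2)] show ?case unfolding eq .
      qed simp
      then have "dist (x ^ n) 1 < d" using m by (simp add: dist_absp)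
      then have "dist (\<mu> (x ^ n)) (\<mu> 1) < 1 / 2" using d(2) x0 by simp
      then show "norm (\<mu> x ^ n - 1) \<le> 1 / 2" using pw[OF x0] m1 by (simp add: dist_norm)
    qed
    then show ?thesis by blast
  qed
  then have "?P (cond_exp p \<mu>)" unfolding cond_exp_def by (rule LeastI_ex)
  moreover have "u \<in> Zp_units" using absp_eq_of_close[of u 1] u by (simp add: Zp_units_def)
  moreover have "u - 1 \<in> pow_ideal p (cond_exp p \<mu>)" using u by (simp add: c pow_ideal_iff absp_lt_1)
  ultimately show ?thesis by blast
qed

lemma cond_exp_posD:
  assumes "cond_exp p \<xi> > 0"
  shows "\<exists>u :: 'a. absp u = 1 \<and> \<xi> u \<noteq> 1"
proof -
  have "\<not> (\<forall>u\<in>Zp_units. u - 1 \<in> pow_ideal p 0 \<longrightarrow> \<xi> u = 1)"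
    using assms unfolding cond_exp_def by (rule not_less_Least)
  then show ?thesis by (auto simp: Zp_units_def)
qed

lemma cond_exp_le_2:
  assumes "\<And>u :: 'a. absp (u - 1) < 1 \<Longrightarrow> \<xi> u = 1"
  shows "cond_exp p \<xi> \<le> 2"
proof -
  have "cond_exp p \<xi> \<le> 1"
    unfolding cond_exp_def by (rule Least_le) (use assms in \<open>auto simp: pow_ideal_iff absp_lt_1\<close>)
  then show ?thesis by simp
qed

lemma legendre_char_eq_lg: "legendre_char p u = of_int (lg u)"
  by (simp add: legendre_char_def lg_def)

lemma padic_haar_left_haar_measure:
  assumes "left_haar_measure add_grp euclidean (dx :: 'a measure)"
  shows "padic_haar p ty dx"
proof -
  have sets: "sets dx = sets borel"
    using assms by (simp add: left_haar_measure_def add_grp_def borel_def)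
  have tr: "\<forall>g\<in>carrier add_grp. \<forall>S\<in>sets dx. emeasure dx ((\<lambda>h. g \<otimes>\<^bsub>add_grp\<^esub> h) ` S) = emeasure dx S"
    and fin: "\<forall>C. compactin euclidean C \<longrightarrow> emeasure dx C < \<infinity>"
    and pos: "\<forall>U. openin euclidean U \<longrightarrow> U \<noteq> {} \<longrightarrow> emeasure dx U > 0"
    using assms unfolding left_haar_measure_def by blast+
  show ?thesis
  proof unfold_locales
    show "sets dx = sets borel" by (rule sets)
    show "emeasure dx ((+) a ` S) = emeasure dx S" if "S \<in> sets borel" for a S
      using tr that by (simp add: sets add_grp_def)
    show "emeasure dx (pball 0) \<noteq> \<infinity>" using fin compact_pball[of 0] by (auto simp: less_top)
    have "pball 0 \<noteq> {}" using zero_in_pball by blast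
    then show "emeasure dx (pball 0) \<noteq> 0" using pos open_pball[of 0] by (auto simp: zero_less_iff_neq_zero)
  qed
qed

end

theorem proposition4p5:
  fixes p :: nat
    and l :: "'a::{field_char_0,complete_space}"
    and \<psi> \<mu> \<eta> :: "'a \<Rightarrow> complex"
    and dx :: "'a measure"
    and dg :: "'a mp measure"
  assumes "padic_field p TYPE('a)" and "odd p"
    and "l \<in> Zp_units" and "\<not> QuadRes (int p) (residue_mod p l)"
    and "left_haar_measure add_grp euclidean dx"
    and "left_haar_measure (Mp p) (Mp_topology p) dg" and "emeasure dg (Kbar p 2) = 1"
    and "additive_character \<psi>" and "conductor_zero p \<psi>"
    and "mult_character \<mu>" and "cond_exp p \<mu> = 1"
    and "\<eta> = (\<lambda>_. 1) \<or> \<eta> = legendre_char p"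
    and "cond_exp p (\<lambda>u. \<eta> u * \<mu> u) > 0"
    and "cond_exp p (\<lambda>u. \<eta> u * inverse (\<mu> u)) > 0"
    and "\<exists>m\<ge>cond_exp p \<eta>. V_eta p dx \<psi> \<mu> \<eta> m \<noteq> {0}"
  shows "let f1 = f_fun p dx \<psi> \<mu> \<eta> (of_nat p); fl = f_fun p dx \<psi> \<mu> \<eta> (l * of_nat p) in
    c_eta p dx \<psi> \<mu> \<eta> = 2 \<and>
    {f1, fl} \<subseteq> V_eta p dx \<psi> \<mu> \<eta> 2 \<and>
    cfun.dim (cfun.span {f1, fl}) = 2 \<and>
    (\<exists>v1 v2. v1 \<noteq> v2 \<and> cfun.independent {v1, v2} \<and> cfun.span {v1, v2} = cfun.span {f1, fl} \<and>
      U0_op p dg \<eta> v1 = 0 \<and> U0_op p dg \<eta> v2 = 0 \<and>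
      Y1_op p dg \<eta> l v1 = 0 \<and> Y1_op p dg \<eta> l v2 = 0 \<and>
      W1_op p dg \<eta> l v1 = cscale (sqrt_pstar p dx \<psi>) v1 \<and>
      W1_op p dg \<eta> l v2 = cscale (- sqrt_pstar p dx \<psi>) v2)"
proof -
  interpret padic p "TYPE('a)" using assms(1,2) by unfold_locales
  have eta_c: "\<eta> u = 1 \<or> \<eta> u = - 1" if "absp u = 1" for u
    using assms(12) lg_cases[OF that] by (auto simp: legendre_char_eq_lg)
  have eta_m: "\<eta> (u * v) = \<eta> u * \<eta> v" if "absp u = 1" "absp v = 1" for u v
    using assms(12) lg_mult[of u v] that by (auto simp: legendre_char_eq_lg)
  have eta_k: "\<eta> u = \<eta> v" if "absp u = 1" "absp (u - v) < 1" for u v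
    using assms(12) lg_close[of u v] that by (auto simp: legendre_char_eq_lg)
  interpret padic_haar p "TYPE('a)" dx
    using assms(5) by (rule padic_haar_left_haar_measure)
  interpret group "Mp p :: 'a mp monoid" using assms(6) by (simp add: left_haar_measure_def)
  have mu1: "\<mu> u = 1" if "absp (u - 1) < 1" for u using assms(10,11) that by (rule mult_character_near_1)
  have em: "\<exists>u. absp u = 1 \<and> \<eta> u * \<mu> u \<noteq> 1" using assms(13) by (rule cond_exp_posD)
  interpret principal p "TYPE('a)" dx \<psi> \<mu> \<eta>
    by unfold_locales (fact assms mu1 em eta_c eta_m eta_k)+
  have sign: "\<mu> (- 1) = \<eta> (- 1)"
  proof -
    obtain m where m: "V_eta p dx \<psi> \<mu> \<eta> m \<noteq> {0}" using assms(15) by blast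
    show ?thesis
    proof (cases "V_eta p dx \<psi> \<mu> \<eta> m = {}")
      case True
      have "0 \<in> V_eta p dx \<psi> \<mu> \<eta> m"
        by (rule zero_in_V_eta)
      then show ?thesis using True by simp
    next
      case False
      then obtain v where "v \<in> V_eta p dx \<psi> \<mu> \<eta> m" "v \<noteq> 0" using m by blast
      then show ?thesis by (rule sign_condition)
    qed
  qed
  have lu: "absp l = 1" using assms(3) by (simp add: Zp_units_def)
  have "lg l = - 1" using assms(4) residue_mod_cong_0[OF lu] by (simp add: lg_def Legendre_def)
  interpret hecke_even p "TYPE('a)" dx \<psi> \<mu> \<eta> dg l
    by unfold_locales (fact assms sign lu \<open>lg l = - 1\<close>)+
  have "\<eta> u = 1" if "absp (u - 1) < 1" for u
    using eta_k[of 1 u] that absp_diff_commute[of 1 u] by simp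
  then have c2: "c_eta p dx \<psi> \<mu> \<eta> = 2" by (intro c_eta_eq_2 cond_exp_le_2)
  have "sqrt_pstar p dx \<psi> * sqrt_pstar p dx \<psi> =
      (weil_gamma dx \<psi> (of_nat p) * weil_gamma dx \<psi> (of_nat p)) * of_real (sqrt (real p) * sqrt (real p))"
    unfolding sqrt_pstar_def of_real_mult by (simp only: mult_ac)
  also have "\<dots> = of_int (lg (- 1)) * of_nat p" unfolding weil_gamma_p_sq by simp
  finally have "sqrt_pstar p dx \<psi> * sqrt_pstar p dx \<psi> = of_int (lg (- 1)) * of_nat p" .
  from eigenbasis[OF this] c2 show ?thesis
    unfolding Let_def mult_1_left by blast
qed

end
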